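(* Let $B$ be a compact smooth connected manifold with universal covering $p:\tilde B\to B$ and covering transformation group $\Gamma$, let $F$ be a compact $q$-dimensional manifold, and let $h:\Gamma\to\mathrm{Diff}(F)$ be a group homomorphism. Let $\mathcal{F}$ be the suspension of $h$, i.e. the foliation of $M=(\tilde B\times F)/\Gamma$ obtained by projecting the foliation of $\tilde B\times F$ with leaves $\tilde B\times\{z\}$, $z\in F$. Equip $M$ and $F$ with Riemannian metrics. Then the Hausdorff leaf space $\mathrm{HLS}(\mathcal{F})$ is homeomorphic to the Hausdorff orbit space $\mathrm{HOS}(F/h(\Gamma))$ of the action of $h(\Gamma)$ on $F$.
   Context: Suspension: $\Gamma$ acts on $\tilde B\times F$ by $\gamma(x,z)=(\gamma(x),h(\gamma)(z))$, $x\in\tilde B$, $z\in F$; $M$ is the quotient manifold, a fibre bundle over $B$ with fibre $F$. Riemannian distance: $M$ and $F$ carry the distances induced by their Riemannian metrics; points in different connected components are at distance $\infty$. Hausdorff leaf space: for a compact foliated Riemannian manifold $(M,\mathcal{F},g)$ with Riemannian distance $d$ and set of leaves $\mathcal{L}$, put $\mathrm{dist}(L,L')=\inf\{d(x,y):x\in L,\,y\in L'\}$ and $$\rho(L,L')=\inf\Big\{\sum_{i=1}^{n-1}\mathrm{dist}(L_i,L_{i+1})\Big\},$$ the infimum being over all finite sequences of leaves $L_1,\dots,L_n$ with $L_1=L$, $L_n=L'$. Put $L\sim L'$ iff $\rho(L,L')=0$, $\tilde{\mathcal{L}}=\mathcal{L}/_\sim$ and $\tilde\rho([L],[L'])=\rho(L,L')$.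 The metric space $(\tilde{\mathcal{L}},\tilde\rho)$ is the Hausdorff leaf space $\mathrm{HLS}(\mathcal{F})$. Hausdorff orbit space: let a group $G$ act on a metric space $(Y,d_Y)$. For orbits $G',G''$ put $d_Y(G',G'')=\inf\{d_Y(x,y):x\in G',\,y\in G''\}$ and let $\rho(G(x),G(y))=\inf\sum_{i=1}^{n-1}d_Y(G_i,G_{i+1})$, the infimum being over all finite sequences of orbits $G_1,\dots,G_n$ with $G_1=G(x)$, $G_n=G(y)$, where $G(z)$ is the orbit of $z$. Identify orbits at $\rho$-distance $0$; the resulting space with the induced metric $\tilde\rho([G(x)],[G(y)])=\rho(G(x),G(y))$ is $\mathrm{HOS}(Y/G)$. Here $Y=F$ with its Riemannian distance and $G=h(\Gamma)$. *)

theory Defs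
  imports "HOL-Analysis.Analysis" "HOL-Algebra.Group_Action"
begin

section \<open>Smooth manifolds\<close>

text \<open>
  \<^term>\<open>Ck_on k S f\<close>: \<open>f\<close> is of class \<open>C\<^sup>k\<close> on the open set \<open>S\<close> of a finite-dimensional space,
  defined by recursion through the directional derivatives of the total derivative.
\<close>

primrec Ck_on ::
  "nat \<Rightarrow> 'a::real_normed_vector set \<Rightarrow> ('a \<Rightarrow> 'b::real_normed_vector) \<Rightarrow> bool" where
  "Ck_on 0 S f \<longleftrightarrow> continuous_on S f"
| "Ck_on (Suc k) S f \<longleftrightarrow>
     (\<forall>x\<in>S. f differentiable (at x)) \<and>
     (\<forall>v. Ck_on k S (\<lambda>x. frechet_derivative f (at x) v))"

definition smooth_on ::
  "'a::real_normed_vector set \<Rightarrow> ('a \<Rightarrow> 'b::real_normed_vector) \<Rightarrow> bool" where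
  "smooth_on S f \<longleftrightarrow> (\<forall>k. Ck_on k S f)"

text \<open>
  A chart is a pair of a domain and a coordinate map; the values of the coordinate map outside
  its domain are irrelevant.  Charts take values in a finite-dimensional real vector space \<open>'e\<close>.
  The class \<open>euclidean_space\<close> is not required of \<open>'e\<close>, because it excludes dimension zero.
\<close>

type_synonym ('a, 'e) chart = "'a set \<times> ('a \<Rightarrow> 'e)"

record ('a, 'e) mfd =
  mtop :: "'a topology"
  atlas :: "('a, 'e) chart set"

abbreviation points :: "('a, 'e) mfd \<Rightarrow> 'a set" where
  "points M \<equiv> topspace (mtop M)"

definition smooth_manifold :: "nat \<Rightarrow> ('a, 'e::real_normed_vector) mfd \<Rightarrow> bool" where
  "smooth_manifold n M \<longleftrightarrow>
     (\<exists>S :: 'e set. finite S \<and> independent S \<and> span S = UNIV \<and> card S = n) \<and>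
     Hausdorff_space (mtop M) \<and> second_countable (mtop M) \<and>
     (\<forall>(U, \<phi>) \<in> atlas M. openin (mtop M) U \<and> open (\<phi> ` U) \<and>
        homeomorphic_map (subtopology (mtop M) U) (top_of_set (\<phi> ` U)) \<phi>) \<and>
     (\<Union>(U, \<phi>) \<in> atlas M. U) = points M \<and>
     (\<forall>(U, \<phi>) \<in> atlas M. \<forall>(V, \<psi>) \<in> atlas M. smooth_on (\<phi> ` (U \<inter> V)) (\<psi> \<circ> inv_into U \<phi>))"

definition smooth_map ::
  "('a, 'd::real_normed_vector) mfd \<Rightarrow> ('b, 'e::real_normed_vector) mfd \<Rightarrow> ('a \<Rightarrow> 'b) \<Rightarrow> bool" where
  "smooth_map M N f \<longleftrightarrow>
     continuous_map (mtop M) (mtop N) f \<and>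
     (\<forall>(U, \<phi>) \<in> atlas M. \<forall>(V, \<psi>) \<in> atlas N.
        smooth_on (\<phi> ` {x \<in> U. f x \<in> V}) (\<psi> \<circ> f \<circ> inv_into U \<phi>))"

definition diffeomorphism ::
  "('a, 'd::real_normed_vector) mfd \<Rightarrow> ('b, 'e::real_normed_vector) mfd \<Rightarrow> ('a \<Rightarrow> 'b) \<Rightarrow> bool" where
  "diffeomorphism M N f \<longleftrightarrow>
     bij_betw f (points M) (points N) \<and> smooth_map M N f \<and> smooth_map N M (inv_into (points M) f)"

definition open_submanifold :: "('a, 'e) mfd \<Rightarrow> 'a set \<Rightarrow> ('a, 'e) mfd" where
  "open_submanifold M W =
     \<lparr>mtop = subtopology (mtop M) W, atlas = (\<lambda>(U, \<phi>). (U \<inter> W, \<phi>)) ` atlas M\<rparr>"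

definition prod_manifold :: "('a, 'd) mfd \<Rightarrow> ('b, 'e) mfd \<Rightarrow> ('a \<times> 'b, 'd \<times> 'e) mfd" where
  "prod_manifold M N =
     \<lparr>mtop = prod_topology (mtop M) (mtop N),
      atlas = {(U \<times> V, map_prod \<phi> \<psi>) | U \<phi> V \<psi>. (U, \<phi>) \<in> atlas M \<and> (V, \<psi>) \<in> atlas N}\<rparr>"


section \<open>Quotients by group actions\<close>

definition orbit_topology :: "'g monoid \<Rightarrow> 'a topology \<Rightarrow> ('g \<Rightarrow> 'a \<Rightarrow> 'a) \<Rightarrow> 'a set topology" where
  "orbit_topology G X act =
     topology (\<lambda>V. V \<subseteq> orbits G (topspace X) act \<and> openin X {x \<in> topspace X. orbit G act x \<in> V})"

lemma openin_orbit_topology: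
  "openin (orbit_topology G X act) V \<longleftrightarrow>
     V \<subseteq> orbits G (topspace X) act \<and> openin X {x \<in> topspace X. orbit G act x \<in> V}"
proof -
  let ?P = "\<lambda>V. V \<subseteq> orbits G (topspace X) act \<and> openin X {x \<in> topspace X. orbit G act x \<in> V}"
  have "istopology ?P"
    unfolding istopology_def
  proof (intro conjI allI impI)
    fix S T assume S: "?P S" and T: "?P T"
    have "{x \<in> topspace X. orbit G act x \<in> S \<inter> T} =
        {x \<in> topspace X. orbit G act x \<in> S} \<inter> {x \<in> topspace X. orbit G act x \<in> T}"
      by auto
    then show "openin X {x \<in> topspace X. orbit G act x \<in> S \<inter> T}"
      using S T by (simp add: openin_Int)
    show "S \<inter> T \<subseteq> orbits G (topspace X) act"
      using S by auto
  next
    fix K assume K: "\<forall>V\<in>K. ?P V"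
    have "{x \<in> topspace X. orbit G act x \<in> \<Union>K} =
        (\<Union>V\<in>K. {x \<in> topspace X. orbit G act x \<in> V})"
      by auto
    then show "openin X {x \<in> topspace X. orbit G act x \<in> \<Union>K}"
      using K by (auto intro!: openin_Union)
    show "\<Union>K \<subseteq> orbits G (topspace X) act"
      using K by auto
  qed
  then show ?thesis
    by (simp add: orbit_topology_def topology_inverse')
qed

lemma topspace_orbit_topology: "topspace (orbit_topology G X act) = orbits G (topspace X) act"
proof -
  have "{x \<in> topspace X. orbit G act x \<in> orbits G (topspace X) act} = topspace X"
    by (auto simp: orbits_def)
  then have "openin (orbit_topology G X act) (orbits G (topspace X) act)"
    by (simp add: openin_orbit_topology)
  then show ?thesis
    by (metis openin_orbit_topology openin_subset openin_topspace subset_antisym)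
qed

lemma quotient_map_orbit: "quotient_map X (orbit_topology G X act) (orbit G act)"
  unfolding quotient_map_def topspace_orbit_topology
  by (auto simp: openin_orbit_topology orbits_def)

text \<open>
  For a free and properly discontinuous action by diffeomorphisms, the smooth structure of the
  quotient is the one for which the orbit projection is a local diffeomorphism: its charts are the
  charts of \<open>N\<close> on open sets that the projection maps injectively, composed with the local inverse
  of the projection.
\<close>

definition quotient_manifold ::
  "'g monoid \<Rightarrow> ('a, 'e) mfd \<Rightarrow> ('g \<Rightarrow> 'a \<Rightarrow> 'a) \<Rightarrow> ('a set, 'e) mfd" where
  "quotient_manifold G N act =
     \<lparr>mtop = orbit_topology G (mtop N) act,
      atlas = {(orbit G act ` W, \<phi> \<circ> inv_into W (orbit G act)) | W U \<phi>.
        (U, \<phi>) \<in> atlas N \<and> openin (mtop N) W \<and> W \<subseteq> U \<and> inj_on (orbit G act) W}\<rparr>"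


section \<open>Riemannian metrics and distance\<close>

text \<open>
  A Riemannian metric is given by its local representations: \<open>g c x v w\<close> is the inner product of
  the two tangent vectors at \<open>x\<close> whose coordinates in the chart \<open>c\<close> are \<open>v\<close> and \<open>w\<close>.  The last
  condition is the transformation law under the Jacobians of the coordinate changes.
\<close>

definition riemannian_metric ::
  "('a, 'e::real_normed_vector) mfd \<Rightarrow> (('a, 'e) chart \<Rightarrow> 'a \<Rightarrow> 'e \<Rightarrow> 'e \<Rightarrow> real) \<Rightarrow> bool" where
  "riemannian_metric M g \<longleftrightarrow>
     (\<forall>(U, \<phi>) \<in> atlas M.
        (\<forall>x\<in>U. bilinear (g (U, \<phi>) x) \<and> (\<forall>v w. g (U, \<phi>) x v w = g (U, \<phi>) x w v) \<and>
           (\<forall>v. v \<noteq> 0 \<longrightarrow> 0 < g (U, \<phi>) x v v)) \<and>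
        (\<forall>v w. smooth_on (\<phi> ` U) (\<lambda>y. g (U, \<phi>) (inv_into U \<phi> y) v w))) \<and>
     (\<forall>(U, \<phi>) \<in> atlas M. \<forall>(V, \<psi>) \<in> atlas M. \<forall>x \<in> U \<inter> V. \<forall>v w.
        g (U, \<phi>) x v w =
          g (V, \<psi>) x (frechet_derivative (\<psi> \<circ> inv_into U \<phi>) (at (\<phi> x)) v)
                     (frechet_derivative (\<psi> \<circ> inv_into U \<phi>) (at (\<phi> x)) w))"

definition C1_curve ::
  "('a, 'e::real_normed_vector) mfd \<Rightarrow> real \<Rightarrow> real \<Rightarrow> (real \<Rightarrow> 'a) \<Rightarrow> bool" where
  "C1_curve M a b \<gamma> \<longleftrightarrow>
     continuous_map (top_of_set {a..b}) (mtop M) \<gamma> \<and>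
     (\<forall>(U, \<phi>) \<in> atlas M. \<exists>D.
        continuous_on {t \<in> {a..b}. \<gamma> t \<in> U} D \<and>
        (\<forall>t \<in> {a..b}. \<gamma> t \<in> U \<longrightarrow> (\<phi> \<circ> \<gamma> has_vector_derivative D t) (at t within {a..b})))"

definition piecewise_C1_curve ::
  "('a, 'e::real_normed_vector) mfd \<Rightarrow> real \<Rightarrow> real \<Rightarrow> (real \<Rightarrow> 'a) \<Rightarrow> bool" where
  "piecewise_C1_curve M a b \<gamma> \<longleftrightarrow>
     a \<le> b \<and> continuous_map (top_of_set {a..b}) (mtop M) \<gamma> \<and>
     (\<exists>P. finite P \<and> {a, b} \<subseteq> P \<and> P \<subseteq> {a..b} \<and>
        (\<forall>s\<in>P. \<forall>t\<in>P. s < t \<and> P \<inter> {s<..<t} = {} \<longrightarrow> C1_curve M s t \<gamma>))"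

text \<open>
  By the transformation law the speed does not depend on the chosen chart.  At the finitely many
  break points the velocity need not exist; this does not affect the length.
\<close>

definition speed ::
  "('a, 'e::real_normed_vector) mfd \<Rightarrow> (('a, 'e) chart \<Rightarrow> 'a \<Rightarrow> 'e \<Rightarrow> 'e \<Rightarrow> real) \<Rightarrow>
    (real \<Rightarrow> 'a) \<Rightarrow> real \<Rightarrow> real" where
  "speed M g \<gamma> t =
     (let c = (SOME c. c \<in> atlas M \<and> \<gamma> t \<in> fst c);
          v = vector_derivative (snd c \<circ> \<gamma>) (at t)
      in sqrt (g c (\<gamma> t) v v))"

definition curve_length ::
  "('a, 'e::real_normed_vector) mfd \<Rightarrow> (('a, 'e) chart \<Rightarrow> 'a \<Rightarrow> 'e \<Rightarrow> 'e \<Rightarrow> real) \<Rightarrow>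
    real \<Rightarrow> real \<Rightarrow> (real \<Rightarrow> 'a) \<Rightarrow> real" where
  "curve_length M g a b \<gamma> = integral {a..b} (speed M g \<gamma>)"

text \<open>
  The infimum of the empty set in \<^typ>\<open>ennreal\<close> is \<open>\<infinity>\<close>, so points in different components are at
  distance \<open>\<infinity>\<close>.
\<close>

definition riemannian_dist ::
  "('a, 'e::real_normed_vector) mfd \<Rightarrow> (('a, 'e) chart \<Rightarrow> 'a \<Rightarrow> 'e \<Rightarrow> 'e \<Rightarrow> real) \<Rightarrow>
    'a \<Rightarrow> 'a \<Rightarrow> ennreal" where
  "riemannian_dist M g x y =
     Inf {ennreal (curve_length M g a b \<gamma>) | a b \<gamma>. piecewise_C1_curve M a b \<gamma> \<and> \<gamma> a = x \<and> \<gamma> b = y}"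


section \<open>Universal coverings and suspensions\<close>

definition simply_connected_space :: "'a topology \<Rightarrow> bool" where
  "simply_connected_space X \<longleftrightarrow>
     path_connected_space X \<and>
     (\<forall>\<gamma>. pathin X \<gamma> \<and> \<gamma> 0 = \<gamma> 1 \<longrightarrow>
        (\<exists>a \<in> topspace X. homotopic_with (\<lambda>r. r 0 = r 1) (top_of_set {0..1}) X \<gamma> (\<lambda>t. a)))"

definition smooth_covering ::
  "('a, 'd::real_normed_vector) mfd \<Rightarrow> ('b, 'e::real_normed_vector) mfd \<Rightarrow> ('a \<Rightarrow> 'b) \<Rightarrow> bool" where
  "smooth_covering N M p \<longleftrightarrow>
     smooth_map N M p \<and> p ` points N = points M \<and>
     (\<forall>y \<in> points M. \<exists>V. openin (mtop M) V \<and> y \<in> V \<and>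
        (\<exists>\<U>. (\<forall>U\<in>\<U>. openin (mtop N) U) \<and> pairwise disjnt \<U> \<and>
           \<Union>\<U> = {x \<in> points N. p x \<in> V} \<and>
           (\<forall>U\<in>\<U>. diffeomorphism (open_submanifold N U) (open_submanifold M V) p)))"

definition universal_covering ::
  "('a, 'd::real_normed_vector) mfd \<Rightarrow> ('b, 'e::real_normed_vector) mfd \<Rightarrow> ('a \<Rightarrow> 'b) \<Rightarrow> bool" where
  "universal_covering N M p \<longleftrightarrow> smooth_covering N M p \<and> simply_connected_space (mtop N)"

text \<open>
  Both groups are subgroups of \<^const>\<open>BijGroup\<close>, whose elements are \<open>undefined\<close> outside the
  underlying set.
\<close>

definition deck_group :: "('a, 'd) mfd \<Rightarrow> ('a \<Rightarrow> 'b) \<Rightarrow> ('a \<Rightarrow> 'a) monoid" where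
  "deck_group N p = (BijGroup (points N))
     \<lparr>carrier := {f \<in> Bij (points N).
        homeomorphic_map (mtop N) (mtop N) f \<and> (\<forall>x \<in> points N. p (f x) = p x)}\<rparr>"

definition diff_group :: "('a, 'e::real_normed_vector) mfd \<Rightarrow> ('a \<Rightarrow> 'a) monoid" where
  "diff_group F = (BijGroup (points F))\<lparr>carrier := {f \<in> Bij (points F). diffeomorphism F F f}\<rparr>"

definition suspension_action ::
  "('c, 'd) mfd \<Rightarrow> ('f, 'e) mfd \<Rightarrow> (('c \<Rightarrow> 'c) \<Rightarrow> 'f \<Rightarrow> 'f) \<Rightarrow> ('c \<Rightarrow> 'c) \<Rightarrow> 'c \<times> 'f \<Rightarrow> 'c \<times> 'f" where
  "suspension_action Bt F h \<gamma> = (\<lambda>(x, z) \<in> points Bt \<times> points F. (\<gamma> x, h \<gamma> z))"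

definition suspension_manifold ::
  "('c, 'd) mfd \<Rightarrow> ('c \<Rightarrow> 'b) \<Rightarrow> ('f, 'e) mfd \<Rightarrow> (('c \<Rightarrow> 'c) \<Rightarrow> 'f \<Rightarrow> 'f) \<Rightarrow>
    (('c \<times> 'f) set, 'd \<times> 'e) mfd" where
  "suspension_manifold Bt p F h =
     quotient_manifold (deck_group Bt p) (prod_manifold Bt F) (suspension_action Bt F h)"

text \<open>The foliation is represented by its set of leaves.\<close>

definition suspension_leaves ::
  "('c, 'd) mfd \<Rightarrow> ('c \<Rightarrow> 'b) \<Rightarrow> ('f, 'e) mfd \<Rightarrow> (('c \<Rightarrow> 'c) \<Rightarrow> 'f \<Rightarrow> 'f) \<Rightarrow> ('c \<times> 'f) set set set" where
  "suspension_leaves Bt p F h =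
     (\<lambda>z. orbit (deck_group Bt p) (suspension_action Bt F h) ` (points Bt \<times> {z})) ` points F"


section \<open>Hausdorff leaf spaces and Hausdorff orbit spaces\<close>

definition set_dist :: "('a \<Rightarrow> 'a \<Rightarrow> ennreal) \<Rightarrow> 'a set \<Rightarrow> 'a set \<Rightarrow> ennreal" where
  "set_dist d A B = Inf {d x y | x y. x \<in> A \<and> y \<in> B}"

definition chain_dist :: "('a \<Rightarrow> 'a \<Rightarrow> ennreal) \<Rightarrow> 'a set set \<Rightarrow> 'a set \<Rightarrow> 'a set \<Rightarrow> ennreal" where
  "chain_dist d P A B =
     Inf {(\<Sum>i<length Ls - 1. set_dist d (Ls ! i) (Ls ! Suc i)) | Ls.
       Ls \<noteq> [] \<and> set Ls \<subseteq> P \<and> hd Ls = A \<and> last Ls = B}"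

definition chain_rel :: "('a \<Rightarrow> 'a \<Rightarrow> ennreal) \<Rightarrow> 'a set set \<Rightarrow> ('a set \<times> 'a set) set" where
  "chain_rel d P = {(A, B) \<in> P \<times> P. chain_dist d P A B = 0}"

definition class_dist ::
  "('a \<Rightarrow> 'a \<Rightarrow> ennreal) \<Rightarrow> 'a set set \<Rightarrow> 'a set set \<Rightarrow> 'a set set \<Rightarrow> ennreal" where
  "class_dist d P X Y = (THE r. \<forall>A\<in>X. \<forall>B\<in>Y. r = chain_dist d P A B)"

text \<open>
  The metrics may take the value \<open>\<infinity>\<close>, so the locale \<open>Metric_space\<close>, which is for
  real-valued metrics, does not apply.
\<close>

definition ext_metric_topology :: "'a set \<Rightarrow> ('a \<Rightarrow> 'a \<Rightarrow> ennreal) \<Rightarrow> 'a topology" where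
  "ext_metric_topology S d = topology (\<lambda>U. U \<subseteq> S \<and> (\<forall>x\<in>U. \<exists>e>0. \<forall>y\<in>S. d x y < e \<longrightarrow> y \<in> U))"

definition hausdorff_quotient :: "('a \<Rightarrow> 'a \<Rightarrow> ennreal) \<Rightarrow> 'a set set \<Rightarrow> 'a set set topology" where
  "hausdorff_quotient d P = ext_metric_topology (P // chain_rel d P) (class_dist d P)"

definition HLS ::
  "('a, 'e::real_normed_vector) mfd \<Rightarrow> (('a, 'e) chart \<Rightarrow> 'a \<Rightarrow> 'e \<Rightarrow> 'e \<Rightarrow> real) \<Rightarrow>
    'a set set \<Rightarrow> 'a set set topology" where
  "HLS M g leaves = hausdorff_quotient (riemannian_dist M g) leaves"

definition HOS ::
  "'g monoid \<Rightarrow> ('g \<Rightarrow> 'a \<Rightarrow> 'a) \<Rightarrow> 'a set \<Rightarrow> ('a \<Rightarrow> 'a \<Rightarrow> ennreal) \<Rightarrow> 'a set set topology" where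
  "HOS G act Y d = hausdorff_quotient d (orbits G Y act)"

lemma openin_ext_metric_topology:
  "openin (ext_metric_topology S d) U \<longleftrightarrow>
     U \<subseteq> S \<and> (\<forall>x\<in>U. \<exists>e>0. \<forall>y\<in>S. d x y < e \<longrightarrow> y \<in> U)"
proof -
  let ?P = "\<lambda>U. U \<subseteq> S \<and> (\<forall>x\<in>U. \<exists>e>0. \<forall>y\<in>S. d x y < e \<longrightarrow> y \<in> U)"
  have "istopology ?P"
    unfolding istopology_def
  proof (intro conjI allI impI ballI)
    fix A B x assume A: "?P A" and B: "?P B" and x: "x \<in> A \<inter> B"
    from A x obtain e where e: "e > 0" "\<forall>y\<in>S. d x y < e \<longrightarrow> y \<in> A" by blast
    from B x obtain e' where e': "e' > 0" "\<forall>y\<in>S. d x y < e' \<longrightarrow> y \<in> B" by blast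
    show "\<exists>e>0. \<forall>y\<in>S. d x y < e \<longrightarrow> y \<in> A \<inter> B"
      by (rule exI[of _ "min e e'"]) (use e e' in auto)
  next
    fix A B assume "?P A" "?P B"
    then show "A \<inter> B \<subseteq> S" by auto
  next
    fix K assume "\<forall>A\<in>K. ?P A"
    then show "\<Union>K \<subseteq> S" by auto
  next
    fix K x assume K: "\<forall>A\<in>K. ?P A" and x: "x \<in> \<Union>K"
    then obtain A where A: "A \<in> K" "x \<in> A" by blast
    with K obtain e where "e > 0" "\<forall>y\<in>S. d x y < e \<longrightarrow> y \<in> A" by blast
    with A show "\<exists>e>0. \<forall>y\<in>S. d x y < e \<longrightarrow> y \<in> \<Union>K" by blast
  qed
  then show ?thesis
    by (simp add: ext_metric_topology_def topology_inverse')
qed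

lemma topspace_ext_metric_topology: "topspace (ext_metric_topology S d) = S"
proof -
  have "openin (ext_metric_topology S d) S"
    by (auto simp: openin_ext_metric_topology intro: exI[of _ 1])
  then show ?thesis
    by (metis openin_ext_metric_topology openin_subset openin_topspace subset_antisym)
qed

lemma chain_dist_refl: "A \<in> P \<Longrightarrow> chain_dist d P A A = 0"
proof -
  assume "A \<in> P"
  then have "chain_dist d P A A \<le> 0"
    unfolding chain_dist_def by (intro Inf_lower) (auto intro!: exI[of _ "[A]"])
  then show ?thesis by simp
qed

lemma chain_dist_triangle: "chain_dist d P A C \<le> chain_dist d P A B + chain_dist d P B C"
proof -
  let ?s = "\<lambda>Ls. \<Sum>i<length Ls - 1. set_dist d (Ls ! i) (Ls ! Suc i)"
  let ?ok = "\<lambda>A B Ls. Ls \<noteq> [] \<and> set Ls \<subseteq> P \<and> hd Ls = A \<and> last Ls = B"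
  have step: "chain_dist d P A C \<le> ?s Ks + ?s Ls" if Ks: "?ok A B Ks" and Ls: "?ok B C Ls" for Ks Ls
  proof -
    let ?Ms = "Ks @ tl Ls"
    have ok: "?ok A C ?Ms"
      using Ks Ls by (cases Ls) (auto simp: last_append)
    have len: "length ?Ms - 1 = (length Ks - 1) + (length Ls - 1)"
      using Ks Ls by (cases Ks; cases Ls) auto
    have nth1: "?Ms ! i = Ks ! i" if "i < length Ks" for i
      using that by (simp add: nth_append)
    have nth2: "?Ms ! (length Ks - 1 + i) = Ls ! i" if "i < length Ls" for i
    proof (cases i)
      case 0
      then show ?thesis using Ks Ls
        by (simp add: nth_append) (metis One_nat_def hd_conv_nth last_conv_nth)
    next
      case (Suc j)
      have *: "length Ks - 1 + i = length Ks + j"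
        using Ks Suc by (cases Ks) auto
      show ?thesis unfolding * using Suc that by (simp add: nth_append nth_tl)
    qed
    have split: "(\<Sum>i<m + n. f i) = (\<Sum>i<m. f i) + (\<Sum>i<n. f (m + i))"
      for m n :: nat and f :: "nat \<Rightarrow> ennreal"
      by (induction n) (auto simp: add.assoc)
    have "?s ?Ms = ?s Ks + ?s Ls"
      unfolding len split
    proof (rule arg_cong2[where f = "(+)"])
      show "(\<Sum>i<length Ks - 1. set_dist d (?Ms ! i) (?Ms ! Suc i)) = ?s Ks"
        by (intro sum.cong refl) (auto simp: nth1)
      show "(\<Sum>i<length Ls - 1. set_dist d (?Ms ! (length Ks - 1 + i)) (?Ms ! Suc (length Ks - 1 + i))) = ?s Ls"
      proof (intro sum.cong refl)
        fix i assume "i \<in> {..<length Ls - 1}"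
        then show "set_dist d (?Ms ! (length Ks - 1 + i)) (?Ms ! Suc (length Ks - 1 + i)) =
            set_dist d (Ls ! i) (Ls ! Suc i)"
          using nth2[of i] nth2[of "Suc i"] by simp
      qed
    qed
    then show ?thesis
      using ok unfolding chain_dist_def by (intro Inf_lower2[where u = "?s ?Ms"]) (blast, simp)
  qed
  show ?thesis
  proof (rule ennreal_le_epsilon)
    fix e :: real assume fin: "chain_dist d P A B + chain_dist d P B C < top_class.top" and e: "0 < e"
    have near: "\<exists>Ls. ?ok A B Ls \<and> ?s Ls < chain_dist d P A B + ennreal (e/2)"
      if "chain_dist d P A B < top_class.top" for A B
    proof -
      have "chain_dist d P A B < chain_dist d P A B + ennreal (e/2)"
        using that e by (cases "chain_dist d P A B") (auto simp: ennreal_less_iff simp flip: ennreal_plus)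
      then have "Inf {?s Ls | Ls. ?ok A B Ls} < chain_dist d P A B + ennreal (e/2)"
        by (simp add: chain_dist_def)
      then show ?thesis
        by (auto simp: Inf_less_iff)
    qed
    obtain Ks where Ks: "?ok A B Ks" "?s Ks < chain_dist d P A B + ennreal (e/2)"
      using near[of A B] fin by (auto simp: ennreal_add_eq_top less_top)
    obtain Ls where Ls: "?ok B C Ls" "?s Ls < chain_dist d P B C + ennreal (e/2)"
      using near[of B C] fin by (auto simp: ennreal_add_eq_top less_top)
    have "chain_dist d P A C \<le> ?s Ks + ?s Ls"
      using step Ks Ls by blast
    also have "\<dots> \<le> (chain_dist d P A B + ennreal (e/2)) + (chain_dist d P B C + ennreal (e/2))"
      using Ks Ls by (intro add_mono) auto
    also have "\<dots> = chain_dist d P A B + chain_dist d P B C + (ennreal (e/2) + ennreal (e/2))"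
      by (simp add: ac_simps)
    also have "ennreal (e/2) + ennreal (e/2) = ennreal e"
      using e by (simp flip: ennreal_plus)
    finally show "chain_dist d P A C \<le> chain_dist d P A B + chain_dist d P B C + ennreal e" .
  qed
qed

lemma chain_dist_sym:
  assumes "\<And>x y. d x y = d y x"
  shows "chain_dist d P A B = chain_dist d P B A"
proof -
  have sd: "set_dist d X Y = set_dist d Y X" for X Y
    unfolding set_dist_def using assms by (intro arg_cong[where f = Inf]) blast
  have le: "chain_dist d P A B \<le> chain_dist d P B A" for A B
    unfolding chain_dist_def
  proof (rule Inf_mono, clarify, goal_cases)
    case (1 _ Ls)
    have "(\<Sum>i<length Ls - 1. set_dist d (Ls ! i) (Ls ! Suc i)) =
        (\<Sum>i<length (rev Ls) - 1. set_dist d (rev Ls ! i) (rev Ls ! Suc i))"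
    proof -
      have "(\<Sum>i<length Ls - 1. set_dist d (Ls ! i) (Ls ! Suc i)) =
          (\<Sum>i<length Ls - 1. set_dist d (Ls ! (length Ls - 1 - Suc i)) (Ls ! Suc (length Ls - 1 - Suc i)))"
        by (rule sum.nat_diff_reindex[symmetric])
      also have "\<dots> = (\<Sum>i<length (rev Ls) - 1. set_dist d (rev Ls ! i) (rev Ls ! Suc i))"
      proof (intro sum.cong)
        fix i assume "i \<in> {..<length (rev Ls) - 1}"
        then have i: "Suc i < length Ls" by auto
        have "Suc (length Ls - 1 - Suc i) = length Ls - Suc i"
             "length Ls - 1 - Suc i = length Ls - Suc (Suc i)" using i by auto
        then show "set_dist d (Ls ! (length Ls - 1 - Suc i)) (Ls ! Suc (length Ls - 1 - Suc i)) =
            set_dist d (rev Ls ! i) (rev Ls ! Suc i)"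
          using i by (simp add: rev_nth sd)
      qed simp
      finally show ?thesis .
    qed
    with 1 show ?case
      by (intro bexI[of _ "\<Sum>i<length (rev Ls) - 1. set_dist d (rev Ls ! i) (rev Ls ! Suc i)"])
         (auto intro!: exI[of _ "rev Ls"] simp: hd_rev last_rev)
  qed
  show ?thesis
    using le[of A B] le[of B A] by (rule order_antisym)
qed

lemma equiv_chain_rel:
  assumes "\<And>x y. d x y = d y x"
  shows "equiv P (chain_rel d P)"
proof (rule equivI)
  show "chain_rel d P \<subseteq> P \<times> P"
    by (auto simp: chain_rel_def)
  show "refl_on P (chain_rel d P)"
    by (auto simp: refl_on_def chain_rel_def chain_dist_refl)
  show "sym (chain_rel d P)"
    unfolding sym_def chain_rel_def using chain_dist_sym[of d, OF assms] by auto
  show "trans (chain_rel d P)"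
  proof (rule transI)
    fix A B C assume "(A, B) \<in> chain_rel d P" "(B, C) \<in> chain_rel d P"
    then show "(A, C) \<in> chain_rel d P"
      using chain_dist_triangle[of d P A C B] by (auto simp: chain_rel_def)
  qed
qed

lemma class_dist_eq:
  assumes sym: "\<And>x y. d x y = d y x" and A: "A \<in> P" and B: "B \<in> P"
  shows "class_dist d P (chain_rel d P `` {A}) (chain_rel d P `` {B}) = chain_dist d P A B"
proof -
  have le: "chain_dist d P A' B' \<le> chain_dist d P A B"
    if "chain_dist d P A' A = 0" "chain_dist d P B B' = 0" for A A' B B'
  proof -
    have "chain_dist d P A' B' \<le> chain_dist d P A' A + (chain_dist d P A B + chain_dist d P B B')"
      by (meson add_left_mono chain_dist_triangle order_trans)
    with that show ?thesis by simp
  qed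
  have eq: "chain_dist d P A B = chain_dist d P A' B'"
    if "A' \<in> chain_rel d P `` {A}" "B' \<in> chain_rel d P `` {B}" for A' B'
  proof -
    have "chain_dist d P A A' = 0" "chain_dist d P B B' = 0"
      using that by (auto simp: chain_rel_def)
    moreover from this have "chain_dist d P A' A = 0" "chain_dist d P B' B = 0"
      by (simp_all add: chain_dist_sym[of d P A', OF sym] chain_dist_sym[of d P B', OF sym])
    ultimately show ?thesis
      by (intro order_antisym le) auto
  qed
  have "A \<in> chain_rel d P `` {A}" "B \<in> chain_rel d P `` {B}"
    using A B by (auto simp: chain_rel_def chain_dist_refl)
  then show ?thesis
    unfolding class_dist_def using eq by (intro the_equality) blast+
qed

end

theory Submission
  imports Defs
begin

text \<open>
  In the suspension \<open>M = (Bt \<times> F) / \<Gamma>\<close>, the leaf of a fibre point \<open>z\<close> consists of the classes of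
  the points \<open>(x, z)\<close>, and two fibre points lie on the same leaf exactly when they lie in the same orbit of
  the holonomy group \<open>h(\<Gamma>)\<close>.  Leaves and orbits are thus in bijection, and what has to be
  compared are two chain distances on the same set.  Chains may have arbitrarily many links, so a
  mere uniform comparison of the distances between leaves with the distances between orbits says
  nothing about their chain distances: many small errors can add up.  A Lipschitz comparison
  survives the passage to chains (\<open>chain_dist_Lipschitz\<close>), and Lipschitz comparisons in both
  directions make the Hausdorff quotients homeomorphic (\<open>hausdorff_quotient_homeomorphic\<close>).

  Both comparisons follow from one principle, \<open>locally_Lipschitz_imp_Lipschitz\<close>: on a compact
  manifold, a pseudometric that near each point is bounded by a multiple of the distance of the
  coordinates in some chart is globally bounded by a multiple of the Riemannian distance.  Indeed
  a curve can be cut into short pieces, the length of each piece dominates the displacement of its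
  coordinates, and the resulting bounds add up by the triangle inequality.  The principle is applied
  to the chain distance of leaves as a pseudometric on \<open>F\<close>, and to the chain distance of orbits as a
  pseudometric on \<open>M\<close>.  Its local hypothesis holds because the charts of \<open>M\<close> are product charts: fixing
  the coordinates in the base embeds the coordinates of \<open>F\<close> isometrically, and forgetting them does not
  increase distances; moreover the Riemannian distance is locally at most a multiple of the
  distance of the coordinates (\<open>length_comparable_to_chart_norm\<close>).  The derivatives of the maps
  \<open>h(\<gamma>)\<close> may be unbounded, but these maps enter only through the equality of orbits: a chain of orbits
  may move freely inside an orbit, so a curve in \<open>M\<close> can be followed in \<open>F\<close> from one local
  trivialization to the next.

  The principle needs \<open>M\<close> to be compact.  It is the image of \<open>K \<times> F\<close> for a compact set \<open>K\<close> in the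
  universal covering that meets all fibres of \<open>p\<close>, provided that the covering transformations act
  transitively on these fibres.  This is where simple connectedness enters
  (\<open>deck_transitive\<close>): a covering transformation is built by transporting points along pairs of paths
  with the same projection, and the result depends on the end point alone because a homotopy that contracts
  a loop lifts over the square (\<open>lifts_over_square\<close>, \<open>companion_of_loop\<close>).  The principle also needs
  that the speed of a curve in \<open>M\<close> can be computed in any chart, hence that coordinate changes of \<open>M\<close>
  are differentiable (\<open>transition_M\<close>); locally they are products of coordinate expressions of a
  covering transformation and of a map \<open>h(\<gamma>)\<close>.
\<close>

section \<open>Covering maps and deck transformations\<close>

lemma continuous_map_restrict:
  "continuous_map (top_of_set S) X f \<Longrightarrow> T \<subseteq> S \<Longrightarrow> continuous_map (top_of_set T) X f"
  by (metis continuous_map_from_subtopology inf.absorb_iff2 subtopology_subtopology)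

lemma continuous_map_If_closed_Un:
  assumes S: "closed S" and T: "closed T"
    and f: "continuous_map (top_of_set S) X f" and g: "continuous_map (top_of_set T) X g"
    and eq: "\<And>x. x \<in> S \<Longrightarrow> x \<in> T \<Longrightarrow> f x = g x"
  shows "continuous_map (top_of_set (S \<union> T)) X (\<lambda>x. if x \<in> S then f x else g x)"
  unfolding continuous_map_closedin
proof (intro conjI allI impI)
  show "(\<lambda>x. if x \<in> S then f x else g x) \<in> topspace (top_of_set (S \<union> T)) \<rightarrow> topspace X"
    using f g by (auto simp: continuous_map_def)
next
  fix C assume C: "closedin X C"
  have "closedin (top_of_set S) {x \<in> S. f x \<in> C}" "closedin (top_of_set T) {x \<in> T. g x \<in> C}"
    using f g C unfolding continuous_map_closedin by auto
  then have "closed {x \<in> S. f x \<in> C}" "closed {x \<in> T. g x \<in> C}"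
    using S T closedin_closed_trans by blast+
  then have "closed ({x \<in> S. f x \<in> C} \<union> {x \<in> T. g x \<in> C})"
    by (rule closed_Un)
  moreover have "{x \<in> topspace (top_of_set (S \<union> T)). (if x \<in> S then f x else g x) \<in> C} =
      {x \<in> S. f x \<in> C} \<union> {x \<in> T. g x \<in> C}"
    using eq by auto
  ultimately show "closedin (top_of_set (S \<union> T))
      {x \<in> topspace (top_of_set (S \<union> T)). (if x \<in> S then f x else g x) \<in> C}"
    by (auto intro!: closed_subset)
qed

abbreviation (input) unit_square :: "(real \<times> real) set" where
  "unit_square \<equiv> {0..1} \<times> {0..1}"

text \<open>
  A covering map, described by what it is used for: over a suitable neighbourhood \<open>V\<close> of each point,
  through every point above \<open>V\<close> passes an open sheet that is the image of a continuous section.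
\<close>

locale sheeted_map =
  fixes X :: "'c topology" and Y :: "'b topology" and p :: "'c \<Rightarrow> 'b"
  assumes cont: "continuous_map X Y p"
    and Hausdorff: "Hausdorff_space X"
    and sheets: "b \<in> topspace Y \<Longrightarrow> \<exists>V. openin Y V \<and> b \<in> V \<and>
       (\<forall>y \<in> topspace X. p y \<in> V \<longrightarrow> (\<exists>U s. openin X U \<and> y \<in> U \<and> p ` U \<subseteq> V \<and>
          continuous_map (subtopology Y V) X s \<and> s ` V \<subseteq> U \<and>
          (\<forall>v\<in>V. p (s v) = v) \<and> (\<forall>u\<in>U. s (p u) = u)))"
begin

lemma in_base: "x \<in> topspace X \<Longrightarrow> p x \<in> topspace Y"
  using cont by (auto simp: continuous_map_def)

lemma local_section:
  assumes "x \<in> topspace X"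
  obtains V U s where "openin Y V" "openin X U" "x \<in> U" "p ` U = V"
    "continuous_map (subtopology Y V) (subtopology X U) s" "s ` V = U"
    "\<forall>v\<in>V. p (s v) = v" "\<forall>u\<in>U. s (p u) = u"
proof -
  obtain V where V: "openin Y V" "p x \<in> V" and *:
       "\<forall>y \<in> topspace X. p y \<in> V \<longrightarrow> (\<exists>U s. openin X U \<and> y \<in> U \<and> p ` U \<subseteq> V \<and>
          continuous_map (subtopology Y V) X s \<and> s ` V \<subseteq> U \<and>
          (\<forall>v\<in>V. p (s v) = v) \<and> (\<forall>u\<in>U. s (p u) = u))"
    using sheets[OF in_base[OF assms]] by blast
  obtain U s where Us: "openin X U" "x \<in> U" "p ` U \<subseteq> V" "continuous_map (subtopology Y V) X s"
    "s ` V \<subseteq> U" "\<forall>v\<in>V. p (s v) = v" "\<forall>u\<in>U. s (p u) = u"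
    using *[rule_format, OF assms V(2)] by (elim exE conjE) (rule that)
  have 1: "p ` U = V"
  proof
    show "V \<subseteq> p ` U"
    proof
      fix v assume "v \<in> V"
      then have "v = p (s v)" "s v \<in> U" using Us(5,6) by auto
      then show "v \<in> p ` U" by (rule image_eqI)
    qed
  qed (rule Us(3))
  have 2: "s ` V = U"
  proof
    show "U \<subseteq> s ` V"
    proof
      fix u assume "u \<in> U"
      then have "u = s (p u)" "p u \<in> V" using Us(3,7) by auto
      then show "u \<in> s ` V" by (rule image_eqI)
    qed
  qed (rule Us(5))
  have "continuous_map (subtopology Y V) (subtopology X U) s"
    using Us(4,5) by (simp add: continuous_map_in_subtopology image_subset_iff_funcset openin_subset[OF V(1)] Pi_iff)
  then show thesis
    by (rule that[OF V(1) Us(1,2) 1 _ 2]) (use Us(6,7) in simp_all)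
qed

lemma open_map: "open_map X Y p"
  unfolding open_map_def
proof (intro allI impI)
  fix W assume W: "openin X W"
  have "\<exists>T. openin Y T \<and> b \<in> T \<and> T \<subseteq> p ` W" if b: "b \<in> p ` W" for b
  proof -
    obtain x where x: "x \<in> W" "p x = b" using b by blast
    then have "x \<in> topspace X" using W openin_subset by blast
    then obtain V U s where *: "openin Y V" "openin X U" "x \<in> U" "p ` U = V"
      "continuous_map (subtopology Y V) (subtopology X U) s" "s ` V = U"
      "\<forall>v\<in>V. p (s v) = v" "\<forall>u\<in>U. s (p u) = u"
      by (rule local_section)
    let ?T = "{v \<in> V. s v \<in> W}"
    have "continuous_map (subtopology Y V) X s"
      using *(5) by (simp add: continuous_map_in_subtopology)
    then have "openin (subtopology Y V) {v \<in> topspace (subtopology Y V). s v \<in> W}"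
      using W openin_continuous_map_preimage by blast
    moreover have "{v \<in> topspace (subtopology Y V). s v \<in> W} = ?T"
      using *(1) openin_subset by fastforce
    ultimately have "openin Y ?T"
      using openin_trans_full[OF _ *(1)] by simp
    moreover have "p x \<in> V" "s (p x) = x" using *(3,4,8) by auto
    then have "b \<in> ?T" using x by simp
    moreover have "?T \<subseteq> p ` W"
    proof
      fix v assume "v \<in> ?T"
      then have "v = p (s v)" "s v \<in> W" using *(7) by auto
      then show "v \<in> p ` W" by (rule image_eqI)
    qed
    ultimately show ?thesis by blast
  qed
  then show "openin Y (p ` W)" by (subst openin_subopen) blast
qed

text \<open>
  The two lifts agree on a closed set, because the total space is Hausdorff, and on an open set,
  because \<open>p\<close> is injective on sheets.
\<close>

lemma lift_unique:
  assumes T: "connected_space T" and f: "continuous_map T X f" and g: "continuous_map T X g"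
    and eq: "\<And>t. t \<in> topspace T \<Longrightarrow> p (f t) = p (g t)"
    and t0: "t0 \<in> topspace T" "f t0 = g t0" and t: "t \<in> topspace T"
  shows "f t = g t"
proof -
  let ?A = "{t \<in> topspace T. f t = g t}"
  have "closedin T ?A"
    using closedin_continuous_maps_eq[OF Hausdorff f g] .
  moreover have "openin T ?A"
  proof (subst openin_subopen, intro ballI)
    fix t assume t: "t \<in> ?A"
    then have "f t \<in> topspace X" using continuous_map_image_subset_topspace[OF f] by blast
    then obtain V U s where *: "openin X U" "f t \<in> U" "\<forall>u\<in>U. s (p u) = u"
      by (rule local_section)
    let ?B = "{t \<in> topspace T. f t \<in> U} \<inter> {t \<in> topspace T. g t \<in> U}"
    have "openin T ?B"
      by (intro openin_Int openin_continuous_map_preimage[OF f *(1)]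
          openin_continuous_map_preimage[OF g *(1)])
    moreover have "?B \<subseteq> ?A"
    proof
      fix t assume t: "t \<in> ?B"
      then have "f t \<in> U" "g t \<in> U" by simp_all
      from this[THEN bspec[OF *(3)]] have "s (p (f t)) = f t" "s (p (g t)) = g t" .
      moreover have tT: "t \<in> topspace T" using t by simp
      ultimately have "f t = g t" using eq[OF tT] by argo
      with tT show "t \<in> ?A" by simp
    qed
    ultimately show "\<exists>B. openin T B \<and> t \<in> B \<and> B \<subseteq> ?A"
      using t *(2) by (intro exI[of _ ?B]) simp
  qed
  ultimately have "?A = {} \<or> ?A = topspace T"
    using T[unfolded connected_space_clopen_in, rule_format, of ?A] by fast
  moreover have "t0 \<in> ?A" using t0 by simp
  ultimately have "?A = topspace T" by fast
  with t have "t \<in> ?A" by simp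
  then show ?thesis by simp
qed

text \<open>
  The starting point \<open>r\<close> of the lift is arbitrary in \<open>R\<close>.  This makes the property additive under gluing:
  a lift over one part can be continued from any common point.
\<close>

definition lifts_over :: "(real \<times> real) set \<Rightarrow> (real \<times> real \<Rightarrow> 'b) \<Rightarrow> bool" where
  "lifts_over R H \<longleftrightarrow> (\<forall>r\<in>R. \<forall>y \<in> topspace X. p y = H r \<longrightarrow>
     (\<exists>K. continuous_map (top_of_set R) X K \<and> (\<forall>z\<in>R. p (K z) = H z) \<and> K r = y))"

text \<open>
  The two partial lifts agree at one common point, hence on the whole connected intersection.
\<close>

lemma lifts_over_Un:
  assumes A: "closed A" "lifts_over A H" and B: "closed B" "lifts_over B H"
    and AB: "connected (A \<inter> B)" "A \<inter> B \<noteq> {}"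
  shows "lifts_over (A \<union> B) H"
proof -
  have main: "\<exists>K. continuous_map (top_of_set (A \<union> B)) X K \<and> (\<forall>z\<in>A \<union> B. p (K z) = H z) \<and> K r = y"
    if A: "closed A" "lifts_over A H" and B: "closed B" "lifts_over B H"
      and AB: "connected (A \<inter> B)" "A \<inter> B \<noteq> {}" and r: "r \<in> A"
      and y: "y \<in> topspace X" "p y = H r" for A B r y
  proof -
    obtain K where K: "continuous_map (top_of_set A) X K" "\<forall>z\<in>A. p (K z) = H z" "K r = y"
      using A r y unfolding lifts_over_def by meson
    obtain r' where r': "r' \<in> A" "r' \<in> B" using AB by blast
    have "K r' \<in> topspace X" using K(1) r' by (auto simp: continuous_map_def)
    moreover have "p (K r') = H r'" using K(2) r' by blast
    ultimately obtain L where L: "continuous_map (top_of_set B) X L" "\<forall>z\<in>B. p (L z) = H z" "L r' = K r'"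
      using B r' unfolding lifts_over_def by meson
    have eq: "K z = L z" if "z \<in> A" "z \<in> B" for z
    proof (rule lift_unique[of "top_of_set (A \<inter> B)" K L r' z])
      show "connected_space (top_of_set (A \<inter> B))"
        using AB(1)[folded connectedin_iff_connected] unfolding connectedin_def by blast
      show "continuous_map (top_of_set (A \<inter> B)) X K" "continuous_map (top_of_set (A \<inter> B)) X L"
        using continuous_map_restrict[OF K(1)] continuous_map_restrict[OF L(1)] by auto
    qed (use that K L r' in auto)
    show ?thesis
      by (rule exI[of _ "\<lambda>z. if z \<in> A then K z else L z"])
        (use continuous_map_If_closed_Un[OF A(1) B(1) K(1) L(1) eq] K L r in auto)
  qed
  show ?thesis
    unfolding lifts_over_def using main[OF assms] main[OF B A] AB
    by (auto simp: Int_commute Un_commute)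
qed

text \<open>
  A small set is mapped into an evenly covered neighbourhood and is lifted by a section.
\<close>

lemma lifts_over_small:
  assumes H: "continuous_map (top_of_set R) Y H" and r: "r \<in> R"
  shows "\<exists>e>0. \<forall>A \<subseteq> R \<inter> ball r e. lifts_over A H"
proof -
  have "H r \<in> topspace Y" using H r by (auto simp: continuous_map_def)
  then obtain V where V: "openin Y V" "H r \<in> V" and sh:
       "\<forall>y \<in> topspace X. p y \<in> V \<longrightarrow> (\<exists>U s. openin X U \<and> y \<in> U \<and> p ` U \<subseteq> V \<and>
          continuous_map (subtopology Y V) X s \<and> s ` V \<subseteq> U \<and>
          (\<forall>v\<in>V. p (s v) = v) \<and> (\<forall>u\<in>U. s (p u) = u))"
    using sheets[OF \<open>H r \<in> topspace Y\<close>] by blast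
  have "openin (top_of_set R) {z \<in> topspace (top_of_set R). H z \<in> V}"
    by (rule openin_continuous_map_preimage[OF H V(1)])
  moreover have "r \<in> {z \<in> topspace (top_of_set R). H z \<in> V}" using r V(2) by simp
  ultimately have "\<exists>e>0. \<forall>z\<in>R. dist z r < e \<longrightarrow> z \<in> {z \<in> topspace (top_of_set R). H z \<in> V}"
    unfolding openin_euclidean_subtopology_iff by blast
  then obtain e where e: "e > 0" "\<And>z. z \<in> R \<Longrightarrow> dist z r < e \<Longrightarrow> H z \<in> V"
    by auto
  have "lifts_over A H" if A: "A \<subseteq> R \<inter> ball r e" for A
    unfolding lifts_over_def
  proof (intro ballI impI)
    fix a y assume a: "a \<in> A" and y: "y \<in> topspace X" "p y = H a"
    have HA: "H z \<in> V" if "z \<in> A" for z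
    proof -
      have "z \<in> R" "z \<in> ball r e" using A that by blast+
      then show ?thesis using e(2)[of z] by (simp add: dist_commute)
    qed
    then obtain U s where s: "continuous_map (subtopology Y V) X s" "y \<in> U"
       "\<forall>v\<in>V. p (s v) = v" "\<forall>u\<in>U. s (p u) = u"
      using sh[rule_format, OF y(1), unfolded y(2), OF HA[OF a]] by (elim exE conjE) (rule that)
    have "continuous_map (top_of_set A) (subtopology Y V) H"
      using continuous_map_restrict[OF H] A HA by (auto simp: continuous_map_in_subtopology)
    then have "continuous_map (top_of_set A) X (s \<circ> H)"
      using s(1) continuous_map_compose by blast
    moreover have "(s \<circ> H) a = y" using s y by auto
    ultimately show "\<exists>K. continuous_map (top_of_set A) X K \<and> (\<forall>z\<in>A. p (K z) = H z) \<and> K a = y"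
      using s(3) HA by (intro exI[of _ "s \<circ> H"]) auto
  qed
  with e(1) show ?thesis by blast
qed

text \<open>
  Bisection in one direction shows that a thin strip around each vertical line can be lifted, and
  bisection in the other direction assembles the strips.
\<close>

lemma lifts_over_square:
  assumes H: "continuous_map (top_of_set unit_square) Y H"
  shows "lifts_over unit_square H"
proof -
  \<comment> \<open>\<open>P s0 c d\<close>: over the height \<open>[c, d]\<close>, all sufficiently thin strips around \<open>s0\<close> can be lifted.\<close>
  define P where "P s0 c d \<longleftrightarrow> (0 \<le> c \<and> d \<le> 1 \<longrightarrow> (\<exists>\<delta>>0. \<forall>a b. 0 \<le> a \<and> a \<le> s0 \<and> s0 \<le> b \<and> b \<le> 1 \<and> b - a < \<delta> \<longrightarrow>
      lifts_over ({a..b} \<times> {c..d}) H))" for s0 c d :: real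
  have strip: "P s0 0 1" if s0: "0 \<le> s0" "s0 \<le> 1" for s0
    using zero_le_one
  proof (induction rule: Bolzano)
    case (trans c d e)
    show ?case
      unfolding P_def
    proof
      assume ce: "0 \<le> c \<and> e \<le> 1"
      then obtain x where x: "x > 0" "\<forall>a b. 0 \<le> a \<and> a \<le> s0 \<and> s0 \<le> b \<and> b \<le> 1 \<and> b - a < x \<longrightarrow>
          lifts_over ({a..b} \<times> {c..d}) H"
        using trans(1) \<open>d \<le> e\<close> unfolding P_def by fastforce
      obtain y where y: "y > 0" "\<forall>a b. 0 \<le> a \<and> a \<le> s0 \<and> s0 \<le> b \<and> b \<le> 1 \<and> b - a < y \<longrightarrow>
          lifts_over ({a..b} \<times> {d..e}) H"
        using ce trans(2) \<open>c \<le> d\<close> unfolding P_def by fastforce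
      show "\<exists>\<delta>>0. \<forall>a b. 0 \<le> a \<and> a \<le> s0 \<and> s0 \<le> b \<and> b \<le> 1 \<and> b - a < \<delta> \<longrightarrow>
          lifts_over ({a..b} \<times> {c..e}) H"
      proof (intro exI[of _ "min x y"] conjI allI impI)
        fix a b assume ab: "0 \<le> a \<and> a \<le> s0 \<and> s0 \<le> b \<and> b \<le> 1 \<and> b - a < min x y"
        have "{a..b} \<times> {c..d} \<inter> {a..b} \<times> {d..e} = {a..b} \<times> {d}"
          using trans by auto
        then have "connected ({a..b} \<times> {c..d} \<inter> {a..b} \<times> {d..e})" "{a..b} \<times> {c..d} \<inter> {a..b} \<times> {d..e} \<noteq> {}"
          using ab by (auto intro!: connected_Times)
        then have "lifts_over ({a..b} \<times> {c..d} \<union> {a..b} \<times> {d..e}) H"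
          using ab x y by (intro lifts_over_Un) (auto intro!: closed_Times)
        moreover have "{a..b} \<times> {c..d} \<union> {a..b} \<times> {d..e} = {a..b} \<times> {c..e}"
          using trans by auto
        ultimately show "lifts_over ({a..b} \<times> {c..e}) H" by simp
      qed (use x y in auto)
    qed
  next
    case (local t)
    obtain e where e: "e > 0" "\<forall>A \<subseteq> unit_square \<inter> ball (s0, t) e. lifts_over A H"
      using lifts_over_small[OF H, of "(s0, t)"] s0 local by auto
    have "P s0 c d" if cd: "c \<le> t" "t \<le> d" "d - c < e/2" for c d
      unfolding P_def
    proof (intro impI exI[of _ "e/2"] conjI allI)
      fix a b assume "0 \<le> c \<and> d \<le> 1" and ab: "0 \<le> a \<and> a \<le> s0 \<and> s0 \<le> b \<and> b \<le> 1 \<and> b - a < e / 2"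
      have "(x, y) \<in> ball (s0, t) e" if "x \<in> {a..b}" "y \<in> {c..d}" for x y
      proof -
        have "dist (s0, t) (x, y) \<le> \<bar>s0 - x\<bar> + \<bar>t - y\<bar>"
          by (simp add: dist_Pair_Pair dist_real_def sqrt_sum_squares_le_sum_abs)
        also have "\<dots> < e" using that ab cd by (auto simp: abs_if)
        finally show ?thesis by simp
      qed
      then have "{a..b} \<times> {c..d} \<subseteq> unit_square \<inter> ball (s0, t) e"
        using \<open>0 \<le> c \<and> d \<le> 1\<close> ab by auto
      with e show "lifts_over ({a..b} \<times> {c..d}) H" by blast
    qed (use e in auto)
    with e(1) show ?case by (intro exI[of _ "e/2"]) auto
  qed
  define Q where "Q a b \<longleftrightarrow> (0 \<le> a \<and> b \<le> 1 \<longrightarrow> lifts_over ({a..b} \<times> {0..1}) H)" for a b :: real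
  have "Q 0 1"
    using zero_le_one
  proof (induction rule: Bolzano)
    case (trans a b c)
    show ?case
      unfolding Q_def
    proof
      assume ac: "0 \<le> a \<and> c \<le> 1"
      have "{a..b} \<times> {0..1::real} \<inter> {b..c} \<times> {0..1} = {b} \<times> {0..1}"
        using trans by auto
      then have "connected ({a..b} \<times> {0..1::real} \<inter> {b..c} \<times> {0..1})"
          "{a..b} \<times> {0..1::real} \<inter> {b..c} \<times> {0..1} \<noteq> {}"
        by (auto intro!: connected_Times)
      then have "lifts_over ({a..b} \<times> {0..1} \<union> {b..c} \<times> {0..1}) H"
        using ac trans unfolding Q_def by (intro lifts_over_Un) (auto intro!: closed_Times)
      moreover have "{a..b} \<times> {0..1::real} \<union> {b..c} \<times> {0..1} = {a..c} \<times> {0..1}"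
        using trans by auto
      ultimately show "lifts_over ({a..c} \<times> {0..1}) H" by simp
    qed
  next
    case (local s)
    then obtain d where "d > 0" "\<forall>a b. 0 \<le> a \<and> a \<le> s \<and> s \<le> b \<and> b \<le> 1 \<and> b - a < d \<longrightarrow>
        lifts_over ({a..b} \<times> {0..1}) H"
      using strip[of s] unfolding P_def by auto
    then show ?case unfolding Q_def by blast
  qed
  then show ?thesis by (simp add: Q_def)
qed

text \<open>
  Two paths upstairs with the same projection.  Lifting a path downstairs from a new starting point
  means finding a companion with that starting point.
\<close>

definition companions :: "(real \<Rightarrow> 'c) \<Rightarrow> (real \<Rightarrow> 'c) \<Rightarrow> bool" where
  "companions \<gamma> \<delta> \<longleftrightarrow> pathin X \<gamma> \<and> pathin X \<delta> \<and> (\<forall>t\<in>{0..1}. p (\<gamma> t) = p (\<delta> t))"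

lemma companions_sym: "companions \<gamma> \<delta> \<Longrightarrow> companions \<delta> \<gamma>"
  by (simp add: companions_def)

lemma companions_unique:
  assumes "companions \<gamma> \<delta>" "companions \<gamma> \<delta>'" "t0 \<in> {0..1}" "\<delta> t0 = \<delta>' t0" "t \<in> {0..1}"
  shows "\<delta> t = \<delta>' t"
proof (rule lift_unique[of "top_of_set {0..1}" \<delta> \<delta>' t0 t])
  show "connected_space (top_of_set {0..1::real})"
    using connected_Icc[of 0 "1::real", folded connectedin_iff_connected] unfolding connectedin_def by blast
qed (use assms in \<open>auto simp: companions_def pathin_def\<close>)

lemma square_lift:
  fixes H :: "real \<times> real \<Rightarrow> 'c"
  assumes H: "continuous_map (top_of_set unit_square) X H" and y: "y \<in> topspace X" "p y = p (H (0, 0))"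
  obtains K where "continuous_map (top_of_set unit_square) X K"
    "\<forall>z\<in>unit_square. p (K z) = p (H z)" "K (0, 0) = y"
proof -
  have "lifts_over unit_square (p \<circ> H)"
    by (rule lifts_over_square[OF continuous_map_compose[OF H cont]])
  moreover have "(0, 0) \<in> {0..1::real} \<times> {0..1::real}" by simp
  moreover have "p y = (p \<circ> H) (0, 0)" using y by simp
  ultimately have "\<exists>K. continuous_map (top_of_set unit_square) X K \<and>
      (\<forall>z\<in>unit_square. p (K z) = (p \<circ> H) z) \<and> K (0, 0) = y"
    unfolding lifts_over_def using y(1) by blast
  then show thesis using that by auto
qed

lemma slice_continuous:
  fixes K :: "real \<times> real \<Rightarrow> 'c"
  assumes "continuous_map (top_of_set unit_square) X K" "continuous_on {0..1} f" "f ` {0..1} \<subseteq> unit_square"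
  shows "pathin X (K \<circ> f)"
  unfolding pathin_def
  by (rule continuous_map_compose[OF _ assms(1)])
     (use assms(2,3) in \<open>simp add: continuous_map_in_subtopology image_subset_iff_funcset\<close>)

text \<open>
  Path lifting is square lifting for a map that is constant in the second variable.
\<close>

lemma companion_exists:
  assumes "pathin X \<gamma>" "y \<in> topspace X" "p y = p (\<gamma> 0)"
  obtains \<delta> where "companions \<gamma> \<delta>" "\<delta> 0 = y"
proof -
  have "continuous_map (top_of_set unit_square) (top_of_set {0..1}) (fst :: real \<times> real \<Rightarrow> real)"
    by (auto simp: continuous_map_in_subtopology continuous_on_fst)
  then have c: "continuous_map (top_of_set unit_square) X (\<gamma> \<circ> (fst :: real \<times> real \<Rightarrow> real))"
    using assms(1) unfolding pathin_def by (rule continuous_map_compose)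
  have "p y = p ((\<gamma> \<circ> fst) (0, 0))" using assms(3) by simp
  then obtain K where K: "continuous_map (top_of_set unit_square) X K"
    "\<forall>z\<in>unit_square. p (K z) = p ((\<gamma> \<circ> fst) z)" "K (0, 0) = y"
    by (rule square_lift[OF c assms(2)])
  have "pathin X (K \<circ> (\<lambda>t. (t, 0)))"
    by (rule slice_continuous[OF K(1)]) (auto intro!: continuous_intros)
  then show thesis
    using assms(1) K by (intro that[of "K \<circ> (\<lambda>t. (t, 0))"]) (auto simp: companions_def)
qed

lemma pathin_reparam:
  assumes "pathin X \<gamma>" "continuous_on {0..1} f" "f ` {0..1} \<subseteq> {0..1}"
  shows "pathin X (\<gamma> \<circ> f)"
  using assms(1) unfolding pathin_def
  by (rule continuous_map_compose[rotated])
     (use assms(2,3) in \<open>simp add: continuous_map_in_subtopology image_subset_iff_funcset\<close>)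

lemma companions_reparam:
  assumes "companions \<gamma> \<delta>" "continuous_on {0..1} f" "f ` {0..1} \<subseteq> {0..1}"
  shows "companions (\<gamma> \<circ> f) (\<delta> \<circ> f)"
  using assms pathin_reparam[OF _ assms(2,3)] by (auto simp: companions_def)

definition join_paths :: "(real \<Rightarrow> 'c) \<Rightarrow> (real \<Rightarrow> 'c) \<Rightarrow> real \<Rightarrow> 'c" where
  "join_paths \<gamma> \<delta> t = (if t \<le> 1/2 then \<gamma> (2 * t) else \<delta> (2 * t - 1))"

lemma pathin_join:
  assumes \<gamma>: "pathin X \<gamma>" and \<delta>: "pathin X \<delta>" and eq: "\<gamma> 1 = \<delta> 0"
  shows "pathin X (join_paths \<gamma> \<delta>)"
proof -
  have "continuous_map (top_of_set {0..1/2}) X (\<gamma> \<circ> (\<lambda>t. 2 * t))"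
    by (rule continuous_map_compose[OF _ \<gamma>[unfolded pathin_def]])
       (auto simp: continuous_map_in_subtopology intro!: continuous_intros)
  moreover have "continuous_map (top_of_set {1/2..1}) X (\<delta> \<circ> (\<lambda>t. 2 * t - 1))"
    by (rule continuous_map_compose[OF _ \<delta>[unfolded pathin_def]])
       (auto simp: continuous_map_in_subtopology intro!: continuous_intros)
  ultimately have "continuous_map (top_of_set ({0..1/2} \<union> {1/2..1})) X
      (\<lambda>t. if t \<in> {0..1/2} then (\<gamma> \<circ> (\<lambda>t. 2 * t)) t else (\<delta> \<circ> (\<lambda>t. 2 * t - 1)) t)"
  proof (rule continuous_map_If_closed_Un[rotated 2])
    fix t :: real assume "t \<in> {0..1/2}" "t \<in> {1/2..1}"
    then have t: "t = 1/2" by simp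
    show "(\<gamma> \<circ> (\<lambda>t. 2 * t)) t = (\<delta> \<circ> (\<lambda>t. 2 * t - 1)) t" unfolding t using eq by simp
  qed auto
  moreover have "{0..1/2} \<union> {1/2..1} = {0..1::real}" by auto
  ultimately have "continuous_map (top_of_set {0..1}) X
      (\<lambda>t. if t \<in> {0..1/2} then (\<gamma> \<circ> (\<lambda>t. 2 * t)) t else (\<delta> \<circ> (\<lambda>t. 2 * t - 1)) t)" by simp
  then show ?thesis
    unfolding pathin_def by (rule continuous_map_eq) (auto simp: join_paths_def)
qed

lemma companions_join:
  assumes "companions \<gamma> \<delta>" "companions \<gamma>' \<delta>'" "\<gamma> 1 = \<gamma>' 0" "\<delta> 1 = \<delta>' 0"
  shows "companions (join_paths \<gamma> \<gamma>') (join_paths \<delta> \<delta>')"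
  using assms pathin_join by (auto simp: companions_def join_paths_def)

text \<open>
  Let \<open>H\<close> contract the loop \<open>\<gamma>\<close> through loops and let \<open>K\<close> lift the projection of \<open>H\<close> from the starting
  point of \<open>\<delta>\<close>.  The two sides of \<open>K\<close> have the same projection, and they agree at the end where
  \<open>H\<close> is constant; so they agree throughout, and \<open>K (0, 0) = K (0, 1)\<close> says that \<open>\<delta>\<close> is closed.
\<close>

lemma companion_of_loop:
  assumes sc: "simply_connected_space X" and co: "companions \<gamma> \<delta>" and loop: "\<gamma> 0 = \<gamma> 1"
  shows "\<delta> 0 = \<delta> 1"
proof -
  have "pathin X \<gamma>" using co by (simp add: companions_def)
  then obtain a where a: "a \<in> topspace X"
    and hom: "homotopic_with (\<lambda>r. r 0 = r 1) (top_of_set {0..1}) X \<gamma> (\<lambda>t. a)"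
    using sc loop unfolding simply_connected_space_def by blast
  then obtain H where H: "continuous_map (prod_topology (top_of_set {0..1::real}) (top_of_set {0..1::real})) X H"
     "\<And>t. H (0, t) = \<gamma> t" "\<And>t. H (1, t) = a" "\<And>s. s \<in> {0..1} \<Longrightarrow> H (s, 0) = H (s, 1)"
    unfolding homotopic_with_def by auto
  have cH: "continuous_map (top_of_set unit_square) X H"
    using H(1) by (simp add: prod_topology_subtopology subtopology_subtopology Times_Int_Times)
  have "\<delta> 0 \<in> topspace X"
    using co unfolding companions_def pathin_def by (auto simp: continuous_map_def Pi_iff)
  moreover have "p (\<delta> 0) = p (H (0, 0))" using co H by (simp add: companions_def)
  ultimately obtain K where K: "continuous_map (top_of_set unit_square) X K"
    "\<forall>z\<in>unit_square. p (K z) = p (H z)" "K (0, 0) = \<delta> 0"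
    by (rule square_lift[OF cH])
  have Kc: "companions (H \<circ> f) (K \<circ> f)" if "continuous_on {0..1} f" "f ` {0..1} \<subseteq> unit_square" for f
    unfolding companions_def
    using slice_continuous[OF K(1) that] slice_continuous[OF cH that] K(2) that(2) by auto
  have "companions (H \<circ> (\<lambda>t. (1, t))) (K \<circ> (\<lambda>t. (1, t)))"
    by (rule Kc) (auto intro!: continuous_intros)
  then have c1: "companions (\<lambda>t. a) (K \<circ> (\<lambda>t. (1, t)))"
    using H(3) by (simp add: comp_def)
  have "K (1, 0) \<in> topspace X" using K(1) by (auto simp: continuous_map_def Pi_iff)
  then have "companions (\<lambda>t. a) (\<lambda>t. K (1, 0))"
    using a bspec[OF K(2), of "(1, 0)"] H(3) by (simp add: companions_def)
  from companions_unique[OF c1 this, of 0 1] have top: "K (1, 1) = K (1, 0)" by simp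
  have "companions (H \<circ> (\<lambda>s. (s, 0))) (K \<circ> (\<lambda>s. (s, 0)))" "companions (H \<circ> (\<lambda>s. (s, 1))) (K \<circ> (\<lambda>s. (s, 1)))"
    by (rule Kc; auto intro!: continuous_intros)+
  moreover from this have "companions (H \<circ> (\<lambda>s. (s, 0))) (K \<circ> (\<lambda>s. (s, 1)))"
    using H(4) by (auto simp: companions_def)
  ultimately have "K (0, 0) = K (0, 1)"
    using companions_unique[of "H \<circ> (\<lambda>s. (s, 0))" "K \<circ> (\<lambda>s. (s, 0))" "K \<circ> (\<lambda>s. (s, 1))" 1 0] top by simp
  moreover have "companions (H \<circ> (\<lambda>t. (0, t))) (K \<circ> (\<lambda>t. (0, t)))"
    by (rule Kc) (auto intro!: continuous_intros)
  then have "companions \<gamma> (K \<circ> (\<lambda>t. (0, t)))"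
    using H(2) by (simp add: comp_def)
  from companions_unique[OF co this, of 0 1] have "\<delta> 1 = K (0, 1)" using K(3) by simp
  ultimately show ?thesis using K(3) by simp
qed

text \<open>
  The point \<open>v\<close> is reached from \<open>y\<close> by following the projection of some path from \<open>x\<close> to \<open>u\<close>.  In a
  simply connected space this relation is the graph of the covering transformation that maps \<open>x\<close> to \<open>y\<close>.
\<close>

definition transport :: "'c \<Rightarrow> 'c \<Rightarrow> 'c \<Rightarrow> 'c \<Rightarrow> bool" where
  "transport x y u v \<longleftrightarrow> (\<exists>\<gamma> \<delta>. companions \<gamma> \<delta> \<and> \<gamma> 0 = x \<and> \<delta> 0 = y \<and> \<gamma> 1 = u \<and> \<delta> 1 = v)"

lemma transport_sym: "transport x y u v \<longleftrightarrow> transport y x v u"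
  unfolding transport_def using companions_sym by blast

lemma transport_trans: "transport x y u v \<Longrightarrow> transport u v u' v' \<Longrightarrow> transport x y u' v'"
  unfolding transport_def
proof (elim exE conjE)
  fix \<gamma> \<delta> \<gamma>' \<delta>'
  assume "companions \<gamma> \<delta>" "\<gamma> 0 = x" "\<delta> 0 = y" "\<gamma> 1 = u" "\<delta> 1 = v"
    "companions \<gamma>' \<delta>'" "\<gamma>' 0 = u" "\<delta>' 0 = v" "\<gamma>' 1 = u'" "\<delta>' 1 = v'"
  then show "\<exists>\<gamma> \<delta>. companions \<gamma> \<delta> \<and> \<gamma> 0 = x \<and> \<delta> 0 = y \<and> \<gamma> 1 = u' \<and> \<delta> 1 = v'"
    by (intro exI[of _ "join_paths \<gamma> \<gamma>'"] exI[of _ "join_paths \<delta> \<delta>'"]) (simp add: companions_join, simp add: join_paths_def)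
qed

lemma transport_in:
  assumes "transport x y u v" shows "u \<in> topspace X" "v \<in> topspace X" "p u = p v"
  using assms unfolding transport_def companions_def pathin_def
  by (auto simp: continuous_map_def Pi_iff)

text \<open>
  Two paths from \<open>x\<close> to \<open>u\<close> form a loop.  Its companion from \<open>y\<close> is closed, and read from both
  of its ends it consists of the companions of the two paths, which therefore meet in the middle.
\<close>

lemma transport_unique:
  assumes sc: "simply_connected_space X" and "transport x y u v" "transport x y u v'"
  shows "v = v'"
proof -
  obtain \<gamma> \<delta> \<gamma>' \<delta>' where *: "companions \<gamma> \<delta>" "\<gamma> 0 = x" "\<delta> 0 = y" "\<gamma> 1 = u" "\<delta> 1 = v"
    "companions \<gamma>' \<delta>'" "\<gamma>' 0 = x" "\<delta>' 0 = y" "\<gamma>' 1 = u" "\<delta>' 1 = v'"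
    using assms(2,3) unfolding transport_def by blast
  let ?r = "\<gamma>' \<circ> (\<lambda>t. 1 - t)"
  have r: "companions ?r (\<delta>' \<circ> (\<lambda>t. 1 - t))"
    by (rule companions_reparam[OF *(6)]) (auto intro!: continuous_intros)
  have "pathin X (join_paths \<gamma> ?r)"
    using *(1,4,9) r by (intro pathin_join) (auto simp: companions_def)
  moreover have "y \<in> topspace X" "p y = p x"
    using *(1-3) unfolding companions_def pathin_def by (auto simp: continuous_map_def Pi_iff)
  ultimately obtain \<epsilon> where \<epsilon>: "companions (join_paths \<gamma> ?r) \<epsilon>" "\<epsilon> 0 = y"
    using companion_exists[of "join_paths \<gamma> ?r" y] *(2) by (auto simp: join_paths_def)
  have "\<epsilon> 0 = \<epsilon> 1"
    by (rule companion_of_loop[OF sc \<epsilon>(1)]) (use * in \<open>simp add: join_paths_def\<close>)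
  with \<epsilon> have \<epsilon>1: "\<epsilon> 1 = y" by simp
  have "companions (join_paths \<gamma> ?r \<circ> (\<lambda>t. t / 2)) (\<epsilon> \<circ> (\<lambda>t. t / 2))"
    by (rule companions_reparam[OF \<epsilon>(1)]) (auto intro!: continuous_intros)
  then have "companions \<gamma> (\<epsilon> \<circ> (\<lambda>t. t / 2))"
    using *(1) by (auto simp: companions_def join_paths_def)
  from companions_unique[OF *(1) this, of 0 1] have "\<epsilon> (1/2) = v" using * \<epsilon> by simp
  moreover have "companions (join_paths \<gamma> ?r \<circ> (\<lambda>t. 1 - t / 2)) (\<epsilon> \<circ> (\<lambda>t. 1 - t / 2))"
    by (rule companions_reparam[OF \<epsilon>(1)]) (auto intro!: continuous_intros)
  moreover have "join_paths \<gamma> ?r (1 - t / 2) = \<gamma>' t" if "t \<in> {0..1}" for t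
    using that * by (auto simp: join_paths_def)
  ultimately have "companions \<gamma>' (\<epsilon> \<circ> (\<lambda>t. 1 - t / 2))"
    using *(6) unfolding companions_def by simp
  from companions_unique[OF *(6) this, of 0 1] have "\<epsilon> (1/2) = v'" using * \<epsilon>1 by simp
  then show ?thesis using \<open>\<epsilon> (1/2) = v\<close> by simp
qed

lemma transport_exists:
  assumes "path_connected_space X" "x \<in> topspace X" "y \<in> topspace X" "p x = p y" "u \<in> topspace X"
  obtains v where "transport x y u v"
proof -
  obtain \<gamma> where \<gamma>: "pathin X \<gamma>" "\<gamma> 0 = x" "\<gamma> 1 = u"
    using assms unfolding path_connected_space_def by blast
  then obtain \<delta> where "companions \<gamma> \<delta>" "\<delta> 0 = y"
    using companion_exists[of \<gamma> y] assms by auto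
  with \<gamma> that show thesis unfolding transport_def by blast
qed

text \<open>
  Near \<open>u\<close> the transported point is obtained by projecting and applying the section through \<open>f u\<close>:
  a path inside a small path connected neighbourhood of \<open>u\<close> has its companion in the sheet of \<open>f u\<close>.
\<close>

lemma transport_continuous:
  assumes sc: "simply_connected_space X" and lpc: "locally_path_connected_space X"
    and f: "\<And>u. u \<in> topspace X \<Longrightarrow> transport x y u (f u)"
  shows "continuous_map X X f"
  unfolding continuous_map_def
proof (intro conjI allI impI)
  show "f \<in> topspace X \<rightarrow> topspace X" using f transport_in(2) by blast
next
  fix W assume W: "openin X W"
  show "openin X {u \<in> topspace X. f u \<in> W}"
  proof (subst openin_subopen, intro ballI)
    fix u assume "u \<in> {u \<in> topspace X. f u \<in> W}"
    then have u: "u \<in> topspace X" "f u \<in> W" by auto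
    have fu: "f u \<in> topspace X" "p u = p (f u)" using f[OF u(1)] transport_in by blast+
    obtain V U s where *: "openin Y V" "openin X U" "f u \<in> U" "p ` U = V"
      "continuous_map (subtopology Y V) (subtopology X U) s" "s ` V = U"
      "\<forall>v\<in>V. p (s v) = v" "\<forall>u\<in>U. s (p u) = u"
      using fu(1) by (rule local_section)
    have s: "continuous_map (subtopology Y V) X s"
      using *(5) by (simp add: continuous_map_in_subtopology)
    have pre: "openin X {w \<in> topspace X. p w \<in> V}"
      by (rule openin_continuous_map_preimage[OF cont *(1)])
    let ?X' = "subtopology X {w \<in> topspace X. p w \<in> V}"
    have "continuous_map ?X' (subtopology Y V) p"
      using cont by (auto simp: continuous_map_in_subtopology continuous_map_from_subtopology)
    then have sp: "continuous_map ?X' X (s \<circ> p)"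
      using s by (rule continuous_map_compose)
    have "openin ?X' {w \<in> topspace ?X'. (s \<circ> p) w \<in> W}"
      by (rule openin_continuous_map_preimage[OF sp W])
    then have "openin X {w \<in> topspace ?X'. (s \<circ> p) w \<in> W}"
      by (rule openin_trans_full[OF _ pre])
    moreover have "p u \<in> V" using fu(2) *(3,4) by auto
    then have "u \<in> {w \<in> topspace ?X'. (s \<circ> p) w \<in> W}"
      using u fu *(3,8) by simp
    ultimately obtain N where N: "openin X N" "path_connectedin X N" "u \<in> N"
        "N \<subseteq> {w \<in> topspace ?X'. (s \<circ> p) w \<in> W}"
      using lpc unfolding locally_path_connected_space by meson
    have "f w \<in> W" if w: "w \<in> N" for w
    proof -
      obtain c where c: "pathin (subtopology X N) c" "c 0 = u" "c 1 = w"
        using N(2,3) w openin_subset[OF N(1)] unfolding path_connectedin_def path_connected_space_def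
          topspace_subtopology_subset[OF openin_subset[OF N(1)]] by blast
      have c': "pathin X c" "\<And>t. t \<in> {0..1} \<Longrightarrow> c t \<in> N"
        using c(1) by (auto simp: pathin_subtopology)
      have cV: "p (c t) \<in> V" "c t \<in> topspace X" if "t \<in> {0..1}" for t
        using c'(2)[OF that] N(4) by auto
      have "continuous_map (top_of_set {0..1}) ?X' c"
        using c' cV by (auto simp: pathin_def continuous_map_in_subtopology)
      then have "pathin X ((s \<circ> p) \<circ> c)"
        unfolding pathin_def using sp by (rule continuous_map_compose)
      then have "companions c ((s \<circ> p) \<circ> c)"
        using c'(1) cV(1) *(7) by (simp add: companions_def)
      moreover have "((s \<circ> p) \<circ> c) 0 = f u"
        using c(2) fu *(3,8) by simp
      ultimately have "transport u (f u) w (s (p w))"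
        unfolding transport_def using c(2,3) by (intro exI[of _ c] exI[of _ "(s \<circ> p) \<circ> c"]) simp
      then have "transport x y w (s (p w))"
        using f[OF u(1)] transport_trans by blast
      moreover have "w \<in> topspace X" using w openin_subset[OF N(1)] by blast
      ultimately have "f w = s (p w)"
        using f transport_unique[OF sc] by blast
      then show ?thesis using N(4) w by auto
    qed
    then show "\<exists>T. openin X T \<and> u \<in> T \<and> T \<subseteq> {u \<in> topspace X. f u \<in> W}"
      using N openin_subset[OF N(1)] by blast
  qed
qed

theorem deck_transitive:
  assumes sc: "simply_connected_space X" and lpc: "locally_path_connected_space X"
    and xy: "x \<in> topspace X" "y \<in> topspace X" "p x = p y"
  obtains f where "homeomorphic_map X X f" "\<And>u. u \<in> topspace X \<Longrightarrow> p (f u) = p u" "f x = y"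
proof -
  have pc: "path_connected_space X" using sc by (simp add: simply_connected_space_def)
  have "\<exists>v. transport x y u v" if "u \<in> topspace X" for u
    by (rule transport_exists[OF pc xy that]) (rule exI)
  then obtain f where f: "\<And>u. u \<in> topspace X \<Longrightarrow> transport x y u (f u)"
    by metis
  have "\<exists>v. transport y x u v" if "u \<in> topspace X" for u
    by (rule transport_exists[OF pc xy(2,1) xy(3)[symmetric] that]) (rule exI)
  then obtain g where g: "\<And>u. u \<in> topspace X \<Longrightarrow> transport y x u (g u)"
    by metis
  have "g (f u) = u" if "u \<in> topspace X" for u
  proof -
    have "transport y x (f u) u" using f[OF that] by (rule transport_sym[THEN iffD1])
    moreover from this have "transport y x (f u) (g (f u))" by (intro g transport_in(1))
    ultimately show ?thesis by (intro transport_unique[OF sc])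
  qed
  moreover have "f (g u) = u" if "u \<in> topspace X" for u
  proof -
    have "transport x y (g u) u" using g[OF that] by (rule transport_sym[THEN iffD1])
    moreover from this have "transport x y (g u) (f (g u))" by (intro f transport_in(1))
    ultimately show ?thesis by (intro transport_unique[OF sc])
  qed
  ultimately have "homeomorphic_maps X X f g"
    unfolding homeomorphic_maps_def
    using transport_continuous[OF sc lpc f] transport_continuous[OF sc lpc g] by simp
  then have "homeomorphic_map X X f" using homeomorphic_map_maps by blast
  moreover have "p (f u) = p u" if "u \<in> topspace X" for u
    using transport_in(3)[OF f[OF that]] by simp
  moreover have "companions (\<lambda>t. x) (\<lambda>t. y)" using xy by (simp add: companions_def)
  then have "transport x y x y" unfolding transport_def by (intro exI[of _ "\<lambda>t. x"] exI[of _ "\<lambda>t. y"]) simp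
  then have "f x = y" by (rule transport_unique[OF sc f[OF xy(1)]])
  ultimately show thesis by (rule that)
qed

end

section \<open>Finite-dimensional normed spaces\<close>

text \<open>
  A finite generating family with bounded coordinate functionals.  This form of finite
  dimensionality includes dimension zero, leaves the dimension out of the types and passes to products.
\<close>

definition bounded_coordinates ::
  "nat \<Rightarrow> (nat \<Rightarrow> 'e::real_normed_vector) \<Rightarrow> (nat \<Rightarrow> 'e \<Rightarrow> real) \<Rightarrow> bool" where
  "bounded_coordinates m e r \<longleftrightarrow>
     (\<forall>i<m. bounded_linear (r i)) \<and> (\<forall>v. (\<Sum>i<m. r i v *\<^sub>R e i) = v)"

lemma compact_coordinate_box:
  fixes I :: "nat \<Rightarrow> real set"
  assumes "\<And>i. compact (I i)"
  shows "compact (PiE UNIV I)"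
proof -
  have "compactin (product_topology (\<lambda>i::nat. euclideanreal) UNIV) (PiE UNIV I)"
    using assms by (auto simp: compactin_PiE)
  then show ?thesis by (simp add: euclidean_product_topology)
qed

lemma continuous_linear_combination:
  "continuous_on UNIV (\<lambda>a::nat \<Rightarrow> real. (\<Sum>i<m. a i *\<^sub>R (e i :: 'e::real_normed_vector)))"
  by (intro continuous_intros continuous_on_product_coordinates)

text \<open>
  The combinations whose \<open>j\<close>-th coefficient is \<open>1\<close> and whose other coefficients have absolute value at most \<open>1\<close> form a
  compact set, which omits \<open>0\<close> by linear independence.
\<close>

lemma independent_norm_lower_bound:
  fixes e :: "nat \<Rightarrow> 'e::real_normed_vector"
  assumes inj: "inj_on e {..<m}" and ind: "independent (e ` {..<m})" and j: "j < m"
  shows "\<exists>\<mu>>0. \<forall>a. a j = 1 \<and> (\<forall>i<m. \<bar>a i\<bar> \<le> 1) \<longrightarrow> \<mu> \<le> norm (\<Sum>i<m. a i *\<^sub>R e i)"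
proof -
  let ?I = "\<lambda>i. if i = j then {1} else if i < m then {-1..1::real} else {0}"
  let ?Q = "PiE UNIV ?I"
  let ?f = "\<lambda>a::nat\<Rightarrow>real. norm (\<Sum>i<m. a i *\<^sub>R e i)"
  have "compact ?Q" by (rule compact_coordinate_box) auto
  moreover have "(\<lambda>i. if i = j then 1 else 0) \<in> ?Q" using j by (auto simp: PiE_iff)
  then have "?Q \<noteq> {}" by blast
  moreover have "continuous_on ?Q ?f"
    by (rule continuous_on_subset[OF continuous_on_norm[OF continuous_linear_combination]]) auto
  ultimately obtain b where b: "b \<in> ?Q" "\<And>a. a \<in> ?Q \<Longrightarrow> ?f b \<le> ?f a"
    using continuous_attains_inf[of ?Q ?f] by blast
  have bj: "b j = 1" using b(1) by (auto simp: PiE_iff dest!: spec[of _ j])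
  have "?f b > 0"
  proof (rule ccontr)
    assume "\<not> ?f b > 0"
    then have 0: "(\<Sum>i<m. b i *\<^sub>R e i) = 0" by simp
    let ?u = "\<lambda>v. b (inv_into {..<m} e v)"
    have "(\<Sum>v\<in>e ` {..<m}. ?u v *\<^sub>R v) = (\<Sum>i<m. b i *\<^sub>R e i)"
      by (subst sum.reindex[OF inj]) (auto intro!: sum.cong simp: inv_into_f_f[OF inj])
    with 0 have "?u (e j) = 0"
      using ind j by (intro independentD[OF ind, of "e ` {..<m}"]) auto
    then show False using bj j by (simp add: inv_into_f_f[OF inj])
  qed
  moreover have "?f b \<le> norm (\<Sum>i<m. a i *\<^sub>R e i)" if a: "a j = 1 \<and> (\<forall>i<m. \<bar>a i\<bar> \<le> 1)" for a
  proof -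
    have "(\<lambda>i. if i < m then a i else 0) \<in> ?Q" using a j by (auto simp: PiE_iff abs_le_iff)
    from b(2)[OF this] show ?thesis by simp
  qed
  ultimately show ?thesis by blast
qed

text \<open>
  Normalizing a vector by its largest coordinate brings it into the situation of
  \<open>independent_norm_lower_bound\<close>, which bounds that coordinate by a multiple of the norm.
\<close>

lemma bounded_coordinates_exist:
  fixes S :: "'e::real_normed_vector set"
  assumes S: "finite S" "independent S" "span S = UNIV"
  obtains m e r where "bounded_coordinates m (e :: nat \<Rightarrow> 'e) r"
proof -
  let ?m = "card S"
  obtain e where "bij_betw e {0..<?m} S" using ex_bij_betw_nat_finite[OF S(1)] by blast
  then have inj: "inj_on e {..<?m}" and im: "e ` {..<?m} = S"
    by (auto simp: bij_betw_def atLeast0LessThan)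
  let ?r = "\<lambda>i v. representation S v (e i)"
  have sumr: "(\<Sum>i<?m. ?r i v *\<^sub>R e i) = v" for v
  proof -
    have "(\<Sum>i<?m. ?r i v *\<^sub>R e i) = (\<Sum>b\<in>e ` {..<?m}. representation S v b *\<^sub>R b)"
      by (subst sum.reindex[OF inj]) simp
    then show ?thesis
      using real_vector.sum_representation_eq[OF S(2), of v S] S im by simp
  qed
  have "\<forall>j<?m. \<exists>\<mu>>0. \<forall>a. a j = 1 \<and> (\<forall>i<?m. \<bar>a i\<bar> \<le> 1) \<longrightarrow> \<mu> \<le> norm (\<Sum>i<?m. a i *\<^sub>R e i)"
    using independent_norm_lower_bound[OF inj] im S(2) by simp
  then obtain \<mu> where \<mu>: "\<And>j. j < ?m \<Longrightarrow> \<mu> j > 0"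
    "\<And>j a. j < ?m \<Longrightarrow> a j = 1 \<Longrightarrow> (\<forall>i<?m. \<bar>a i\<bar> \<le> 1) \<Longrightarrow> \<mu> j \<le> norm (\<Sum>i<?m. a i *\<^sub>R e i)"
    by metis
  define K where "K = (\<Sum>j<?m. 1 / \<mu> j)"
  have bound: "\<bar>?r i v\<bar> \<le> norm v * K" if i: "i < ?m" for i v
  proof -
    \<comment> \<open>It suffices to bound the coordinate \<open>j\<close> of largest absolute value.\<close>
    let ?A = "(\<lambda>j. \<bar>?r j v\<bar>) ` {..<?m}"
    have "Max ?A \<in> ?A" using i by (intro Max_in) auto
    then obtain j where j: "j < ?m" "\<bar>?r j v\<bar> = Max ?A" by auto
    have max: "\<bar>?r k v\<bar> \<le> \<bar>?r j v\<bar>" if "k < ?m" for k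
      unfolding j(2) using that by (intro Max_ge) auto
    have "\<bar>?r j v\<bar> \<le> norm v * K"
    proof (cases "?r j v = 0")
      case True
      have "K \<ge> 0" unfolding K_def using \<mu>(1) by (intro sum_nonneg) (auto intro: less_imp_le)
      then show ?thesis using True by simp
    next
      case False
      have "\<mu> j \<le> norm (\<Sum>i<?m. (?r i v / ?r j v) *\<^sub>R e i)"
        using False max j by (intro \<mu>(2)) (auto simp: divide_le_eq)
      also have "(\<Sum>i<?m. (?r i v / ?r j v) *\<^sub>R e i) = (1 / ?r j v) *\<^sub>R (\<Sum>i<?m. ?r i v *\<^sub>R e i)"
        by (simp add: scaleR_sum_right)
      also have "norm \<dots> = norm v / \<bar>?r j v\<bar>" by (simp add: sumr)
      finally have "\<bar>?r j v\<bar> \<le> norm v * (1 / \<mu> j)"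
        using \<mu>(1)[OF j(1)] False by (simp add: field_simps)
      also have "1 / \<mu> j \<le> K"
        unfolding K_def using \<mu>(1) j(1)
        by (intro member_le_sum[of j "{..<?m}" "\<lambda>j. 1 / \<mu> j"]) (auto intro: less_imp_le)
      finally show ?thesis by (simp add: mult_left_mono)
    qed
    with max[OF i] show ?thesis by simp
  qed
  have "bounded_coordinates ?m e ?r"
    unfolding bounded_coordinates_def
  proof (intro conjI allI impI)
    fix i assume "i < ?m"
    then show "bounded_linear (?r i)"
      using bound S by (intro bounded_linear_intro[where K = K])
        (auto simp: real_vector.representation_add real_vector.representation_scale)
  qed (rule sumr)
  then show thesis by (rule that)
qed

lemma bounded_coordinates_prod:
  assumes "bounded_coordinates m (e :: nat \<Rightarrow> 'd::real_normed_vector) r"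
    and "bounded_coordinates n (e' :: nat \<Rightarrow> 'e::real_normed_vector) r'"
  obtains k e'' r'' where "bounded_coordinates k (e'' :: nat \<Rightarrow> 'd \<times> 'e) r''"
proof -
  let ?e = "\<lambda>i. if i < m then (e i, 0) else (0, e' (i - m))"
  let ?r = "\<lambda>i v. if i < m then r i (fst v) else r' (i - m) (snd v)"
  have split: "(\<Sum>i<m+n. f i) = (\<Sum>i<m. f i) + (\<Sum>i<n. f (m + i))" for f :: "nat \<Rightarrow> 'd \<times> 'e"
    by (induction n) (auto simp: add.assoc)
  have "bounded_coordinates (m + n) ?e ?r"
    unfolding bounded_coordinates_def
  proof (intro conjI allI impI)
    fix i assume i: "i < m + n"
    show "bounded_linear (?r i)"
    proof (cases "i < m")
      case True
      then have "bounded_linear (r i)" using assms(1) by (simp add: bounded_coordinates_def)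
      from bounded_linear_compose[OF this bounded_linear_fst] show ?thesis using True by simp
    next
      case False
      then have "i - m < n" using i by simp
      then have "bounded_linear (r' (i - m))" using assms(2) by (simp add: bounded_coordinates_def)
      from bounded_linear_compose[OF this bounded_linear_snd] show ?thesis using False by simp
    qed
  next
    fix v :: "'d \<times> 'e"
    have "(\<Sum>i<m+n. ?r i v *\<^sub>R ?e i) = (\<Sum>i<m. (r i (fst v) *\<^sub>R e i, 0)) + (\<Sum>i<n. (0, r' i (snd v) *\<^sub>R e' i))"
      unfolding split by (intro arg_cong2[where f = "(+)"] sum.cong) auto
    also have "\<dots> = (\<Sum>i<m. r i (fst v) *\<^sub>R e i, \<Sum>i<n. r' i (snd v) *\<^sub>R e' i)"
      by (simp add: sum_prod)
    also have "\<dots> = v" using assms by (simp add: bounded_coordinates_def)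
    finally show "(\<Sum>i<m+n. ?r i v *\<^sub>R ?e i) = v" .
  qed
  then show thesis by (rule that)
qed

lemma compact_cball_finite_dim:
  assumes co: "bounded_coordinates m (e :: nat \<Rightarrow> 'e::real_normed_vector) r"
  shows "compact (cball (c::'e) R)"
proof -
  have bl: "\<And>i. i < m \<Longrightarrow> bounded_linear (r i)" and s: "\<And>v. (\<Sum>i<m. r i v *\<^sub>R e i) = v"
    using co by (auto simp: bounded_coordinates_def)
  let ?b = "\<lambda>i. onorm (r i) * (norm c + R)"
  let ?I = "\<lambda>i. if i < m then {- ?b i..?b i} else {0}"
  have "compact (PiE UNIV ?I)" by (rule compact_coordinate_box) auto
  then have "compact ((\<lambda>a. \<Sum>i<m. a i *\<^sub>R e i) ` PiE UNIV ?I)"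
    by (rule compact_continuous_image[OF continuous_on_subset[OF continuous_linear_combination subset_UNIV]])
  then have "compact ((\<lambda>a. \<Sum>i<m. a i *\<^sub>R e i) ` PiE UNIV ?I \<inter> cball c R)"
    by (rule compact_Int_closed) simp
  moreover have "cball c R \<subseteq> (\<lambda>a. \<Sum>i<m. a i *\<^sub>R e i) ` PiE UNIV ?I"
  proof
    fix v :: 'e assume v: "v \<in> cball c R"
    have "norm v \<le> norm c + norm (v - c)" by (rule norm_triangle_sub)
    with v have nv: "norm v \<le> norm c + R" by (simp add: dist_norm norm_minus_commute)
    have "\<bar>r i v\<bar> \<le> ?b i" if "i < m" for i
    proof -
      have "\<bar>r i v\<bar> \<le> onorm (r i) * norm v" using onorm[OF bl[OF that], of v] by simp
      also have "\<dots> \<le> ?b i" using nv onorm_pos_le[OF bl[OF that]] by (rule mult_left_mono)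
      finally show ?thesis .
    qed
    then have "(\<lambda>i. if i < m then r i v else 0) \<in> PiE UNIV ?I"
      by (auto simp: PiE_iff abs_le_iff minus_le_iff)
    moreover have "v = (\<Sum>i<m. (if i < m then r i v else 0) *\<^sub>R e i)" using s by simp
    ultimately show "v \<in> (\<lambda>a. \<Sum>i<m. a i *\<^sub>R e i) ` PiE UNIV ?I"
      by (intro image_eqI[where x = "\<lambda>i. if i < m then r i v else 0"])
  qed
  ultimately show ?thesis by (simp add: inf.absorb2)
qed

lemma compact_sphere_finite_dim:
  assumes co: "bounded_coordinates m (e :: nat \<Rightarrow> 'e::real_normed_vector) r"
  shows "compact (sphere (0::'e) 1)"
proof -
  have "compact (cball (0::'e) 1 \<inter> sphere 0 1)"
    by (rule compact_Int_closed[OF compact_cball_finite_dim[OF co]])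
       (auto simp: sphere_def intro!: closed_Collect_eq continuous_intros)
  then show ?thesis by (simp add: inf.absorb2 sphere_cball)
qed

lemma linear_coordinates:
  assumes "bounded_coordinates m e r" "linear f"
  shows "f v = (\<Sum>i<m. r i v *\<^sub>R f (e i))"
proof -
  have "f v = f (\<Sum>i<m. r i v *\<^sub>R e i)" using assms(1) by (simp add: bounded_coordinates_def)
  also have "\<dots> = (\<Sum>i<m. r i v *\<^sub>R f (e i))"
    using assms(2) by (simp add: linear_sum linear_scale)
  finally show ?thesis .
qed

lemma bilinear_coordinates:
  fixes G :: "'e::real_normed_vector \<Rightarrow> 'e \<Rightarrow> real"
  assumes co: "bounded_coordinates m (e :: nat \<Rightarrow> 'e) r" and G: "bilinear G"
  shows "G v w = (\<Sum>i<m. \<Sum>j<m. r i v * r j w * G (e i) (e j))"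
proof -
  have l1: "linear (\<lambda>v. G v w)" for w
    using G by (simp add: bilinear_def)
  have l2: "linear (G v)" for v
    using G by (simp add: bilinear_def)
  have "G v w = (\<Sum>i<m. r i v *\<^sub>R G (e i) w)"
    by (rule linear_coordinates[OF co l1])
  also have "\<dots> = (\<Sum>i<m. r i v *\<^sub>R (\<Sum>j<m. r j w *\<^sub>R G (e i) (e j)))"
    by (intro sum.cong refl arg_cong[where f = "(*\<^sub>R) _"] linear_coordinates[OF co l2])
  also have "\<dots> = (\<Sum>i<m. \<Sum>j<m. r i v * r j w * G (e i) (e j))"
    by (simp add: sum_distrib_left mult.assoc)
  finally show ?thesis .
qed

text \<open>
  A form that depends continuously on a point for fixed arguments is jointly continuous, because it is
  a finite sum of products of coordinates.
\<close>

lemma continuous_on_form: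
  fixes G :: "'a::topological_space \<Rightarrow> 'e::real_normed_vector \<Rightarrow> 'e \<Rightarrow> real"
  assumes co: "bounded_coordinates m (e :: nat \<Rightarrow> 'e) r" and G: "\<And>y. y \<in> S \<Longrightarrow> bilinear (G y)"
    and cG: "\<And>v w. continuous_on S (\<lambda>y. G y v w)"
    and y: "continuous_on T y" "y ` T \<subseteq> S" and v: "continuous_on T v"
  shows "continuous_on T (\<lambda>t. G (y t) (v t) (v t))"
proof -
  have bl: "\<And>i. i < m \<Longrightarrow> bounded_linear (r i)"
    using co by (auto simp: bounded_coordinates_def)
  have "continuous_on T (\<lambda>t. \<Sum>i<m. \<Sum>j<m. r i (v t) * r j (v t) * G (y t) (e i) (e j))"
    by (intro continuous_on_sum continuous_on_mult bounded_linear.continuous_on[OF bl v]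
          continuous_on_compose2[OF cG y]) auto
  then show ?thesis
    by (rule continuous_on_eq) (use y G bilinear_coordinates[OF co, symmetric] in auto)
qed

text \<open>
  At \<open>y0\<close> the form has a positive minimum \<open>\<mu>\<close> on the unit sphere.  Its values at nearby points
  differ by at most \<open>\<mu> / 2\<close> on the sphere, since they are governed by finitely many continuous matrix entries.
\<close>

lemma form_locally_comparable:
  fixes G :: "'a::real_normed_vector \<Rightarrow> 'e::real_normed_vector \<Rightarrow> 'e \<Rightarrow> real"
  assumes co: "bounded_coordinates m (e :: nat \<Rightarrow> 'e) r" and S: "open S" "y0 \<in> S"
    and G: "\<And>y. y \<in> S \<Longrightarrow> bilinear (G y)"
    and pos: "\<And>v. v \<noteq> 0 \<Longrightarrow> 0 < G y0 v v"
    and cG: "\<And>v w. continuous_on S (\<lambda>y. G y v w)"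
  obtains \<epsilon> c C where "\<epsilon> > 0" "c > 0" "C > 0" "ball y0 \<epsilon> \<subseteq> S"
    "\<And>y v. y \<in> ball y0 \<epsilon> \<Longrightarrow> c * norm v \<le> sqrt (G y v v) \<and> sqrt (G y v v) \<le> C * norm v"
proof -
  have bl: "\<And>i. i < m \<Longrightarrow> bounded_linear (r i)"
    using co by (auto simp: bounded_coordinates_def)
  define K where "K = (\<Sum>i<m. onorm (r i))"
  have K: "\<bar>r i v\<bar> \<le> K * norm v" if "i < m" for i v
  proof -
    have "\<bar>r i v\<bar> \<le> onorm (r i) * norm v" using onorm[OF bl[OF that], of v] by simp
    also have "onorm (r i) \<le> K"
      unfolding K_def using that bl by (intro member_le_sum[of i "{..<m}" "\<lambda>i. onorm (r i)"]) (auto intro: onorm_pos_le)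
    finally show ?thesis by (simp add: mult_right_mono)
  qed
  have K0: "K \<ge> 0" unfolding K_def using bl by (intro sum_nonneg) (auto intro: onorm_pos_le)
  have est: "\<bar>\<Sum>i<m. \<Sum>j<m. r i v * r j v * A i j\<bar> \<le> K\<^sup>2 * (\<Sum>i<m. \<Sum>j<m. \<bar>A i j\<bar>) * (norm v)\<^sup>2"
    for v :: 'e and A :: "nat \<Rightarrow> nat \<Rightarrow> real"
  proof -
    have "\<bar>\<Sum>i<m. \<Sum>j<m. r i v * r j v * A i j\<bar> \<le> (\<Sum>i<m. \<Sum>j<m. (K * norm v) * (K * norm v) * \<bar>A i j\<bar>)"
      unfolding abs_mult[symmetric]
      by (rule order_trans[OF sum_abs], rule sum_mono, rule order_trans[OF sum_abs], rule sum_mono)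
         (use K K0 in \<open>auto simp: abs_mult intro!: mult_mono\<close>)
    also have "\<dots> = K\<^sup>2 * (\<Sum>i<m. \<Sum>j<m. \<bar>A i j\<bar>) * (norm v)\<^sup>2"
      by (simp add: sum_distrib_left sum_distrib_right power2_eq_square mult_ac)
    finally show ?thesis .
  qed
  \<comment> \<open>The form at \<open>y0\<close> has a positive minimum on the compact unit sphere.\<close>
  have "\<exists>\<mu>>0. \<forall>v. \<mu> * (norm v)\<^sup>2 \<le> G y0 v v"
  proof (cases "sphere (0::'e) 1 = {}")
    case True
    have "v = 0" for v :: 'e
    proof (rule ccontr)
      assume "v \<noteq> 0"
      then have "(1 / norm v) *\<^sub>R v \<in> sphere 0 1" by simp
      with True show False by blast
    qed
    then have v0: "\<And>v::'e. v = 0" by blast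
    have "G y0 v v = 0" for v
      using bilinear_lzero[OF G[OF S(2)]] v0[of v] by simp
    moreover have "norm v = 0" for v :: 'e using v0[of v] by simp
    ultimately show ?thesis by (intro exI[of _ 1]) simp
  next
    case False
    have "continuous_on (sphere (0::'e) 1) (\<lambda>v. G y0 v v)"
      by (rule continuous_on_form[OF co, of S G]) (use G cG S in \<open>auto intro: continuous_intros\<close>)
    then obtain w where w: "w \<in> sphere 0 1" "\<And>v. v \<in> sphere 0 1 \<Longrightarrow> G y0 w w \<le> G y0 v v"
      using continuous_attains_inf[OF compact_sphere_finite_dim[OF co] False, of "\<lambda>v. G y0 v v"] by blast
    have "G y0 w w * (norm v)\<^sup>2 \<le> G y0 v v" for v
    proof (cases "v = 0")
      case True
      then show ?thesis using bilinear_lzero[OF G[OF S(2)]] by simp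
    next
      case False
      then have "G y0 w w \<le> G y0 ((1 / norm v) *\<^sub>R v) ((1 / norm v) *\<^sub>R v)"
        by (intro w) simp
      also have "\<dots> = G y0 v v / (norm v)\<^sup>2"
        using bilinear_lmul[OF G[OF S(2)]] bilinear_rmul[OF G[OF S(2)]]
        by (simp add: power2_eq_square)
      finally show ?thesis using False by (simp add: field_simps)
    qed
    moreover have "w \<noteq> 0" using w(1) by auto
    then have "G y0 w w > 0" by (rule pos)
    ultimately show ?thesis by blast
  qed
  then obtain \<mu> where \<mu>: "\<mu> > 0" "\<And>v. \<mu> * (norm v)\<^sup>2 \<le> G y0 v v" by blast
  \<comment> \<open>The entries at \<open>y\<close> differ in total by \<open>D y\<close> from those at \<open>y0\<close>, and \<open>\<eta>\<close> is chosen
    so that \<open>D y < \<eta>\<close> changes the form by at most \<open>\<mu> / 2\<close> on the unit sphere.\<close>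
  define D where "D y = (\<Sum>i<m. \<Sum>j<m. \<bar>G y (e i) (e j) - G y0 (e i) (e j)\<bar>)" for y
  have "continuous_on S D"
    unfolding D_def by (intro continuous_intros cG)
  moreover have "D y0 = 0" by (simp add: D_def)
  moreover define \<eta> where "\<eta> = \<mu> / (2 * (K\<^sup>2 + 1))"
  have "\<eta> > 0" unfolding \<eta>_def using \<mu>(1) by (intro divide_pos_pos) (auto intro: add_nonneg_pos)
  ultimately obtain \<delta> where \<delta>: "\<delta> > 0" "\<And>y. y \<in> S \<Longrightarrow> dist y y0 < \<delta> \<Longrightarrow> \<bar>D y\<bar> < \<eta>"
    using S(2) unfolding continuous_on_iff by (metis dist_real_def diff_zero)
  obtain \<delta>' where \<delta>': "\<delta>' > 0" "ball y0 \<delta>' \<subseteq> S"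
    using S by (meson open_contains_ball)
  define B where "B = K\<^sup>2 * (\<Sum>i<m. \<Sum>j<m. \<bar>G y0 (e i) (e j)\<bar>)"
  have B0: "B \<ge> 0" unfolding B_def by (intro mult_nonneg_nonneg sum_nonneg) auto
  have bounds: "(\<mu> / 2) * (norm v)\<^sup>2 \<le> G y v v" "G y v v \<le> (B + \<mu>) * (norm v)\<^sup>2"
    if y: "y \<in> ball y0 (min \<delta> \<delta>')" for y v
  proof -
    have yS: "y \<in> S" and Dy: "\<bar>D y\<bar> < \<eta>"
      using y \<delta>' \<delta>(2)[of y] by (auto simp: dist_commute)
    have "G y v v - G y0 v v = (\<Sum>i<m. \<Sum>j<m. r i v * r j v * (G y (e i) (e j) - G y0 (e i) (e j)))"
      unfolding bilinear_coordinates[OF co G[OF yS], of v v] bilinear_coordinates[OF co G[OF S(2)], of v v]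
      by (simp add: sum_subtractf algebra_simps)
    then have "\<bar>G y v v - G y0 v v\<bar> \<le> K\<^sup>2 * D y * (norm v)\<^sup>2"
      using est[of v "\<lambda>i j. G y (e i) (e j) - G y0 (e i) (e j)"] by (simp add: D_def)
    also have "\<dots> \<le> (\<mu> / 2) * (norm v)\<^sup>2"
    proof (rule mult_right_mono)
      have "K\<^sup>2 * D y \<le> (K\<^sup>2 + 1) * \<eta>"
        using Dy \<open>\<eta> > 0\<close> by (intro mult_mono) (auto simp: D_def intro!: sum_nonneg)
      also have "\<dots> = \<mu> / 2"
      proof -
        have "K\<^sup>2 + 1 \<noteq> 0" by (metis add_nonneg_pos less_irrefl zero_le_power2 zero_less_one)
        then show ?thesis unfolding \<eta>_def by (simp add: field_simps)
      qed
      finally show "K\<^sup>2 * D y \<le> \<mu> / 2" .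
    qed simp
    finally have d: "\<bar>G y v v - G y0 v v\<bar> \<le> (\<mu> / 2) * (norm v)\<^sup>2" .
    have "\<mu> * (norm v)\<^sup>2 = (\<mu> / 2) * (norm v)\<^sup>2 + (\<mu> / 2) * (norm v)\<^sup>2" by (simp add: field_simps)
    with d \<mu>(2)[of v] show "(\<mu> / 2) * (norm v)\<^sup>2 \<le> G y v v" by linarith
    have "G y0 v v \<le> B * (norm v)\<^sup>2"
      using est[of v "\<lambda>i j. G y0 (e i) (e j)"]
      unfolding bilinear_coordinates[OF co G[OF S(2)], of v v] B_def by linarith
    moreover have "(\<mu> / 2) * (norm v)\<^sup>2 \<le> \<mu> * (norm v)\<^sup>2"
      using \<mu>(1) by (intro mult_right_mono) auto
    ultimately show "G y v v \<le> (B + \<mu>) * (norm v)\<^sup>2"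
      using d by (simp only: distrib_right)
  qed
  show thesis
  proof (rule that[of "min \<delta> \<delta>'" "sqrt (\<mu> / 2)" "sqrt (B + \<mu>)"])
    fix y and v :: 'e assume y: "y \<in> ball y0 (min \<delta> \<delta>')"
    have "sqrt (\<mu> / 2) * norm v = sqrt ((\<mu> / 2) * (norm v)\<^sup>2)"
      "sqrt (B + \<mu>) * norm v = sqrt ((B + \<mu>) * (norm v)\<^sup>2)"
      by (simp_all only: real_sqrt_mult real_sqrt_abs abs_norm_cancel)
    then show "sqrt (\<mu> / 2) * norm v \<le> sqrt (G y v v) \<and> sqrt (G y v v) \<le> sqrt (B + \<mu>) * norm v"
      using bounds[OF y, of v] by (auto intro: real_sqrt_le_mono)
  qed (use \<delta> \<delta>' \<mu> B0 in auto)
qed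

section \<open>Continuously differentiable maps\<close>

abbreviation C1_on :: "'a::real_normed_vector set \<Rightarrow> ('a \<Rightarrow> 'b::real_normed_vector) \<Rightarrow> bool" where
  "C1_on S f \<equiv> Ck_on (Suc 0) S f"

lemma smooth_on_C1: "smooth_on S f \<Longrightarrow> C1_on S f"
  unfolding smooth_on_def by blast

lemma smooth_on_continuous: "smooth_on S f \<Longrightarrow> continuous_on S f"
  unfolding smooth_on_def by (metis Ck_on.simps(1))

lemma C1_on_has_derivative:
  "C1_on S f \<Longrightarrow> x \<in> S \<Longrightarrow> (f has_derivative frechet_derivative f (at x)) (at x)"
  by (simp flip: frechet_derivative_works)

lemma C1_on_cong:
  assumes "C1_on S f" "open S" "\<And>x. x \<in> S \<Longrightarrow> f x = g x"
  shows "C1_on S g"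
proof -
  have der: "(g has_derivative frechet_derivative f (at x)) (at x)" if "x \<in> S" for x
    by (rule has_derivative_transform_within_open[OF C1_on_has_derivative[OF assms(1) that] assms(2) that])
       (rule assms(3))
  then have fr: "frechet_derivative g (at x) = frechet_derivative f (at x)" if "x \<in> S" for x
    using frechet_derivative_at[OF der[OF that]] that by simp
  have "continuous_on S (\<lambda>x. frechet_derivative g (at x) v)" for v
    by (rule continuous_on_eq[of S "\<lambda>x. frechet_derivative f (at x) v"]) (use assms(1) fr in auto)
  with der show ?thesis by (auto simp: differentiable_def)
qed

lemma C1_on_subset: "C1_on S f \<Longrightarrow> T \<subseteq> S \<Longrightarrow> C1_on T f"
  by (auto intro: continuous_on_subset)

lemma C1_on_local:
  assumes "\<And>x. x \<in> S \<Longrightarrow> \<exists>T. open T \<and> x \<in> T \<and> C1_on T f"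
  shows "C1_on S f"
proof -
  have "f differentiable (at x)" if "x \<in> S" for x
    using assms[OF that] by auto
  moreover have "continuous_on S (\<lambda>x. frechet_derivative f (at x) v)" for v
  proof (rule continuous_at_imp_continuous_on, intro ballI)
    fix x assume "x \<in> S"
    then obtain T where T: "open T" "x \<in> T" "C1_on T f" using assms by blast
    then have "continuous_on T (\<lambda>x. frechet_derivative f (at x) v)" by simp
    with T show "isCont (\<lambda>x. frechet_derivative f (at x) v) x"
      using continuous_on_eq_continuous_at by blast
  qed
  ultimately show ?thesis by simp
qed

text \<open>
  By the definition of the class, the derivative of \<open>g\<close> is continuous only for fixed tangent vectors.
  Expanding the vector produced by the derivative of \<open>f\<close> in coordinates reduces the chain rule to these.
\<close>

lemma C1_on_compose:
  fixes f :: "'a::real_normed_vector \<Rightarrow> 'b::real_normed_vector" and g :: "'b \<Rightarrow> 'c::real_normed_vector"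
  assumes co: "bounded_coordinates m (e :: nat \<Rightarrow> 'b) r"
    and f: "C1_on S f" and g: "C1_on T g" and fS: "f ` S \<subseteq> T"
  shows "C1_on S (g \<circ> f)"
proof -
  have der: "(g \<circ> f has_derivative frechet_derivative g (at (f x)) \<circ> frechet_derivative f (at x)) (at x)"
    if "x \<in> S" for x
    using C1_on_has_derivative[OF f that] C1_on_has_derivative[OF g, of "f x"] fS that
    by (intro diff_chain_at) auto
  have bl: "\<And>i. i < m \<Longrightarrow> bounded_linear (r i)"
    using co by (auto simp: bounded_coordinates_def)
  have cf: "continuous_on S f"
    using f by (auto intro!: continuous_at_imp_continuous_on differentiable_imp_continuous_within)
  have "continuous_on S (\<lambda>x. \<Sum>i<m. r i (frechet_derivative f (at x) v) *\<^sub>R frechet_derivative g (at (f x)) (e i))" for v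
  proof (intro continuous_on_sum continuous_on_scaleR)
    fix i assume "i \<in> {..<m}"
    then show "continuous_on S (\<lambda>x. r i (frechet_derivative f (at x) v))"
      using f by (intro bounded_linear.continuous_on[OF bl]) auto
    show "continuous_on S (\<lambda>x. frechet_derivative g (at (f x)) (e i))"
      by (rule continuous_on_compose2[of T "\<lambda>y. frechet_derivative g (at y) (e i)" S f])
        (use g cf fS in auto)
  qed
  then have "continuous_on S (\<lambda>x. frechet_derivative (g \<circ> f) (at x) v)" for v
  proof (rule continuous_on_eq)
    fix x assume x: "x \<in> S"
    then have "f x \<in> T" using fS by blast
    then have "linear (frechet_derivative g (at (f x)))"
      by (rule has_derivative_linear[OF C1_on_has_derivative[OF g]])
    from linear_coordinates[OF co this, of "frechet_derivative f (at x) v"]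
    show "(\<Sum>i<m. r i (frechet_derivative f (at x) v) *\<^sub>R frechet_derivative g (at (f x)) (e i)) =
        frechet_derivative (g \<circ> f) (at x) v"
      unfolding frechet_derivative_at[OF der[OF x], symmetric] comp_apply by (rule sym)
  qed
  with der show ?thesis by (auto simp: differentiable_def)
qed

lemma C1_on_map_prod:
  assumes f: "C1_on S f" and g: "C1_on T g"
  shows "C1_on (S \<times> T) (map_prod f g)"
proof -
  have der: "(map_prod f g has_derivative
      (\<lambda>v. (frechet_derivative f (at (fst x)) (fst v), frechet_derivative g (at (snd x)) (snd v)))) (at x)"
    if "x \<in> S \<times> T" for x
  proof -
    have 1: "(f \<circ> fst has_derivative frechet_derivative f (at (fst x)) \<circ> fst) (at x)"
      using C1_on_has_derivative[OF f, of "fst x"] that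
      by (intro diff_chain_at) (auto intro: bounded_linear_imp_has_derivative bounded_linear_fst)
    have 2: "(g \<circ> snd has_derivative frechet_derivative g (at (snd x)) \<circ> snd) (at x)"
      using C1_on_has_derivative[OF g, of "snd x"] that
      by (intro diff_chain_at) (auto intro: bounded_linear_imp_has_derivative bounded_linear_snd)
    have "map_prod f g = (\<lambda>x. ((f \<circ> fst) x, (g \<circ> snd) x))" by (auto simp: fun_eq_iff)
    with has_derivative_Pair[OF 1 2] show ?thesis by (simp add: comp_def)
  qed
  have "continuous_on (S \<times> T) (\<lambda>x. (frechet_derivative f (at (fst x)) v, frechet_derivative g (at (snd x)) w))" for v w
  proof (rule continuous_on_Pair)
    show "continuous_on (S \<times> T) (\<lambda>x. frechet_derivative f (at (fst x)) v)"
      by (rule continuous_on_compose2[of S "\<lambda>y. frechet_derivative f (at y) v" "S \<times> T" fst])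
        (use f in \<open>auto intro: continuous_intros\<close>)
    show "continuous_on (S \<times> T) (\<lambda>x. frechet_derivative g (at (snd x)) w)"
      by (rule continuous_on_compose2[of T "\<lambda>y. frechet_derivative g (at y) w" "S \<times> T" snd])
        (use g in \<open>auto intro: continuous_intros\<close>)
  qed
  then have "continuous_on (S \<times> T) (\<lambda>x. frechet_derivative (map_prod f g) (at x) v)" for v
    by (rule continuous_on_eq[where f = "\<lambda>x. (frechet_derivative f (at (fst x)) (fst v), frechet_derivative g (at (snd x)) (snd v))"])
       (simp add: frechet_derivative_at[OF der, symmetric])
  with der show ?thesis by (auto simp: differentiable_def)
qed

section \<open>Curves and Riemannian distance in charts\<close>

lemma chart_inj:
  assumes "openin T U" "homeomorphic_map (subtopology T U) (top_of_set (\<phi> ` U)) \<phi>"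
  shows "inj_on \<phi> U"
  using homeomorphic_imp_injective_map[OF assms(2)] openin_subset[OF assms(1)]
  by (simp add: inf.absorb2)

lemma chart_inv_continuous:
  assumes U: "openin T U" and h: "homeomorphic_map (subtopology T U) (top_of_set (\<phi> ` U)) \<phi>"
  shows "continuous_map (top_of_set (\<phi> ` U)) (subtopology T U) (inv_into U \<phi>)"
proof -
  obtain k where k: "homeomorphic_maps (subtopology T U) (top_of_set (\<phi> ` U)) \<phi> k"
    using h homeomorphic_map_maps by blast
  have "continuous_map (top_of_set (\<phi> ` U)) (subtopology T U) k"
    using k by (simp add: homeomorphic_maps_def)
  then show ?thesis
  proof (rule continuous_map_eq)
    fix y assume "y \<in> topspace (top_of_set (\<phi> ` U))"
    then obtain x where x: "x \<in> U" "y = \<phi> x" by auto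
    then have "k y = x"
      using k openin_subset[OF U] by (auto simp: homeomorphic_maps_def)
    then show "k y = inv_into U \<phi> y"
      using x by (simp add: inv_into_f_f[OF chart_inj[OF assms]])
  qed
qed

lemma chart_openin_preimage:
  assumes U: "openin T U" and h: "homeomorphic_map (subtopology T U) (top_of_set (\<phi> ` U)) \<phi>" and S: "open S"
  shows "openin T {x \<in> U. \<phi> x \<in> S}"
proof -
  have "continuous_map (subtopology T U) euclidean \<phi>"
    using homeomorphic_imp_continuous_map[OF h] by (simp add: continuous_map_in_subtopology)
  then have "openin (subtopology T U) {x \<in> topspace (subtopology T U). \<phi> x \<in> S}"
    by (rule openin_continuous_map_preimage) (use S in simp)
  then have "openin T {x \<in> topspace (subtopology T U). \<phi> x \<in> S}"
    using U by (rule openin_trans_full)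
  then show ?thesis using openin_subset[OF U] by (simp add: inf.absorb2)
qed

lemma chart_open_image:
  assumes U: "openin T U" and h: "homeomorphic_map (subtopology T U) (top_of_set (\<phi> ` U)) \<phi>"
    and o: "open (\<phi> ` U)" and W: "openin T W" "W \<subseteq> U"
  shows "open (\<phi> ` W)"
proof -
  have "openin (subtopology T U) W" using W by (simp add: openin_open_subtopology[OF U])
  then have "openin (top_of_set (\<phi> ` U)) (\<phi> ` W)"
    using homeomorphic_map_openness_eq[OF h] by blast
  then show ?thesis using o by (simp add: openin_open_eq)
qed

lemma C1_curve_subinterval:
  assumes "C1_curve X a b \<gamma>" "a \<le> s" "t \<le> b"
  shows "C1_curve X s t \<gamma>"
  unfolding C1_curve_def
proof (intro conjI ballI, goal_cases)
  case 1
  have "continuous_map (top_of_set {a..b}) (mtop X) \<gamma>" using assms(1) by (simp add: C1_curve_def)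
  moreover have "{s..t} \<subseteq> {a..b}" using assms by auto
  ultimately show ?case
    by (metis continuous_map_from_subtopology inf.absorb_iff2 subtopology_subtopology)
next
  case (2 c)
  obtain U \<phi> where c: "c = (U, \<phi>)" by (cases c)
  obtain D where D: "continuous_on {t \<in> {a..b}. \<gamma> t \<in> U} D"
    "\<forall>t \<in> {a..b}. \<gamma> t \<in> U \<longrightarrow> (\<phi> \<circ> \<gamma> has_vector_derivative D t) (at t within {a..b})"
    using assms(1)[unfolded C1_curve_def, THEN conjunct2, THEN bspec, OF 2] unfolding c by auto
  have sub: "{s..t} \<subseteq> {a..b}" using assms by auto
  show ?case
    unfolding c prod.case
  proof (intro exI[of _ D] conjI ballI impI)
    show "continuous_on {x \<in> {s..t}. \<gamma> x \<in> U} D"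
      using sub by (intro continuous_on_subset[OF D(1)]) auto
    fix x assume "x \<in> {s..t}" "\<gamma> x \<in> U"
    then have "(\<phi> \<circ> \<gamma> has_vector_derivative D x) (at x within {a..b})" using D(2) sub by blast
    then show "(\<phi> \<circ> \<gamma> has_vector_derivative D x) (at x within {s..t})"
      using sub by (rule has_vector_derivative_within_subset)
  qed
qed

lemma curve_preimage_open:
  assumes "continuous_map (top_of_set {a..b}) T \<gamma>" "openin T U"
  shows "open {t \<in> {a<..<b::real}. \<gamma> t \<in> U}"
proof -
  have "openin (top_of_set {a..b}) {t \<in> topspace (top_of_set {a..b}). \<gamma> t \<in> U}"
    by (rule openin_continuous_map_preimage[OF assms])
  then obtain O' where O': "open O'" "{t \<in> {a..b}. \<gamma> t \<in> U} = {a..b} \<inter> O'"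
    by (auto simp: openin_open)
  have "{t \<in> {a<..<b}. \<gamma> t \<in> U} = {a<..<b} \<inter> {t \<in> {a..b}. \<gamma> t \<in> U}" by auto
  also have "\<dots> = {a<..<b} \<inter> O'" unfolding O'(2) by auto
  finally show ?thesis using O'(1) by (simp add: open_Int)
qed

text \<open>
  Division by the constant, which is positive and finite, turns \<open>r\<close> into a lower bound of \<open>S\<close>.
\<close>

lemma ennreal_le_mult_Inf:
  assumes K: "K > 0" and le: "\<And>s. s \<in> S \<Longrightarrow> r \<le> ennreal K * s"
  shows "r \<le> ennreal K * Inf S"
proof -
  have "r / ennreal K \<le> Inf S"
  proof (rule Inf_greatest)
    fix s assume "s \<in> S"
    from le[OF this] show "r / ennreal K \<le> s"
      using K by (simp add: divide_le_posI_ennreal mult.commute)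
  qed
  then have "r / ennreal K * ennreal K \<le> Inf S * ennreal K"
    by (rule mult_right_mono) simp
  moreover have "r / ennreal K * ennreal K = r"
    using K by (simp add: ennreal_divide_times ennreal_times_divide mult_divide_eq_ennreal)
  ultimately show ?thesis by (simp add: mult.commute)
qed

text \<open>
  A Riemannian manifold whose coordinate changes are continuously differentiable.  This regularity
  suffices for the lengths of curves, and it is what is established for the suspension.
\<close>

locale C1_riemannian =
  fixes X :: "('a, 'e::real_normed_vector) mfd"
    and g :: "('a, 'e) chart \<Rightarrow> 'a \<Rightarrow> 'e \<Rightarrow> 'e \<Rightarrow> real"
    and m :: nat and e :: "nat \<Rightarrow> 'e" and r :: "nat \<Rightarrow> 'e \<Rightarrow> real"
  assumes coordinates: "bounded_coordinates m e r"
    and chart_open: "(U, \<phi>) \<in> atlas X \<Longrightarrow> openin (mtop X) U"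
    and chart_image_open: "(U, \<phi>) \<in> atlas X \<Longrightarrow> open (\<phi> ` U)"
    and chart_homeo: "(U, \<phi>) \<in> atlas X \<Longrightarrow> homeomorphic_map (subtopology (mtop X) U) (top_of_set (\<phi> ` U)) \<phi>"
    and charts_cover: "x \<in> points X \<Longrightarrow> \<exists>(U, \<phi>) \<in> atlas X. x \<in> U"
    and transition_C1: "(U, \<phi>) \<in> atlas X \<Longrightarrow> (V, \<psi>) \<in> atlas X \<Longrightarrow> C1_on (\<phi> ` (U \<inter> V)) (\<psi> \<circ> inv_into U \<phi>)"
    and metric: "riemannian_metric X g"
begin

lemma chart_map_inj: "(U, \<phi>) \<in> atlas X \<Longrightarrow> inj_on \<phi> U"
  using chart_inj[OF chart_open chart_homeo] .

lemma metric_chart: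
  assumes "(U, \<phi>) \<in> atlas X"
  shows "(\<forall>x\<in>U. bilinear (g (U, \<phi>) x) \<and> (\<forall>v w. g (U, \<phi>) x v w = g (U, \<phi>) x w v) \<and>
           (\<forall>v. v \<noteq> 0 \<longrightarrow> 0 < g (U, \<phi>) x v v)) \<and>
        (\<forall>v w. smooth_on (\<phi> ` U) (\<lambda>y. g (U, \<phi>) (inv_into U \<phi> y) v w))"
  using metric[unfolded riemannian_metric_def, THEN conjunct1, THEN bspec, OF assms] by simp

lemma metric_bilinear: "(U, \<phi>) \<in> atlas X \<Longrightarrow> x \<in> U \<Longrightarrow> bilinear (g (U, \<phi>) x)"
  using metric_chart by simp

lemma metric_pos: "(U, \<phi>) \<in> atlas X \<Longrightarrow> x \<in> U \<Longrightarrow> v \<noteq> 0 \<Longrightarrow> 0 < g (U, \<phi>) x v v"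
  using metric_chart by simp

lemma metric_continuous:
  "(U, \<phi>) \<in> atlas X \<Longrightarrow> continuous_on (\<phi> ` U) (\<lambda>y. g (U, \<phi>) (inv_into U \<phi> y) v w)"
  by (rule smooth_on_continuous) (simp add: metric_chart)

lemma metric_transform:
  assumes "(U, \<phi>) \<in> atlas X" "(V, \<psi>) \<in> atlas X" "x \<in> U" "x \<in> V"
  shows "g (U, \<phi>) x v w =
          g (V, \<psi>) x (frechet_derivative (\<psi> \<circ> inv_into U \<phi>) (at (\<phi> x)) v)
                     (frechet_derivative (\<psi> \<circ> inv_into U \<phi>) (at (\<phi> x)) w)"
  using metric[unfolded riemannian_metric_def, THEN conjunct2, THEN bspec, OF assms(1), unfolded prod.case,
      THEN bspec, OF assms(2)] assms(3,4) by simp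

text \<open>
  The speed is defined through an arbitrarily chosen chart.  By the chain rule its velocity is the image of \<open>v\<close> under the
  derivative of the coordinate change, and the transformation law of the metric cancels this derivative.
\<close>

lemma speed_in_chart:
  assumes \<gamma>: "C1_curve X a b \<gamma>" and t: "t \<in> {a<..<b}" and c: "(U, \<phi>) \<in> atlas X" "\<gamma> t \<in> U"
    and v: "(\<phi> \<circ> \<gamma> has_vector_derivative v) (at t)"
  shows "speed X g \<gamma> t = sqrt (g (U, \<phi>) (\<gamma> t) v v)"
proof -
  have cont: "continuous_map (top_of_set {a..b}) (mtop X) \<gamma>" using \<gamma> by (simp add: C1_curve_def)
  let ?c = "SOME c. c \<in> atlas X \<and> \<gamma> t \<in> fst c"
  have "?c \<in> atlas X \<and> \<gamma> t \<in> fst ?c"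
    by (rule someI[of _ "(U, \<phi>)"]) (use c in simp)
  moreover obtain V \<psi> where V: "?c = (V, \<psi>)" by (cases ?c)
  ultimately have c': "(V, \<psi>) \<in> atlas X" "\<gamma> t \<in> V" by auto
  let ?\<tau> = "\<psi> \<circ> inv_into U \<phi>"
  let ?L = "frechet_derivative ?\<tau> (at (\<phi> (\<gamma> t)))"
  have L: "(?\<tau> has_derivative ?L) (at ((\<phi> \<circ> \<gamma>) t))"
    using C1_on_has_derivative[OF transition_C1[OF c(1) c'(1)], of "\<phi> (\<gamma> t)"] c(2) c'(2) by simp
  have "(?\<tau> \<circ> (\<phi> \<circ> \<gamma>) has_derivative ?L \<circ> (\<lambda>h. h *\<^sub>R v)) (at t)"
    by (rule diff_chain_at[OF v[unfolded has_vector_derivative_def] L])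
  moreover have "?L \<circ> (\<lambda>h. h *\<^sub>R v) = (\<lambda>h. h *\<^sub>R ?L v)"
    using linear_scale[OF has_derivative_linear[OF L]] by (auto simp: fun_eq_iff)
  ultimately have "(?\<tau> \<circ> (\<phi> \<circ> \<gamma>) has_vector_derivative ?L v) (at t)"
    by (simp add: has_vector_derivative_def)
  then have "(\<psi> \<circ> \<gamma> has_vector_derivative ?L v) (at t)"
  proof (rule has_vector_derivative_transform_within_open)
    show "open {t \<in> {a<..<b}. \<gamma> t \<in> U}" by (rule curve_preimage_open[OF cont chart_open[OF c(1)]])
    show "t \<in> {t \<in> {a<..<b}. \<gamma> t \<in> U}" using t c by simp
    show "(?\<tau> \<circ> (\<phi> \<circ> \<gamma>)) s = (\<psi> \<circ> \<gamma>) s" if "s \<in> {t \<in> {a<..<b}. \<gamma> t \<in> U}" for s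
      using that by (simp add: inv_into_f_f[OF chart_map_inj[OF c(1)]])
  qed
  then have "vector_derivative (\<psi> \<circ> \<gamma>) (at t) = ?L v" by (rule vector_derivative_at)
  then show ?thesis
    using metric_transform[OF c(1) c'(1) c(2) c'(2), of v v] by (simp add: speed_def V Let_def)
qed

text \<open>
  At the end points the two-sided velocity need not exist, but the one-sided velocity \<open>D\<close> extends the speed
  continuously.  So the speed is integrable, and its integral is that of a continuous function.
\<close>

lemma speed_continuous_in_chart:
  assumes \<gamma>: "C1_curve X a b \<gamma>" and ab: "a < b" and c: "(U, \<phi>) \<in> atlas X" and im: "\<gamma> ` {a..b} \<subseteq> U"
  obtains D where "continuous_on {a..b} (\<phi> \<circ> \<gamma>)"
    "\<And>t. t \<in> {a<..<b} \<Longrightarrow> (\<phi> \<circ> \<gamma> has_vector_derivative D t) (at t)"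
    "continuous_on {a..b} (\<lambda>t. sqrt (g (U, \<phi>) (\<gamma> t) (D t) (D t)))"
    "(speed X g \<gamma> has_integral integral {a..b} (\<lambda>t. sqrt (g (U, \<phi>) (\<gamma> t) (D t) (D t)))) {a..b}"
    "\<And>t. t \<in> {a<..<b} \<Longrightarrow> speed X g \<gamma> t = sqrt (g (U, \<phi>) (\<gamma> t) (D t) (D t))"
proof -
  have "{t \<in> {a..b}. \<gamma> t \<in> U} = {a..b}" using im by auto
  then obtain D where D: "continuous_on {a..b} D"
    "\<forall>t \<in> {a..b}. \<gamma> t \<in> U \<longrightarrow> (\<phi> \<circ> \<gamma> has_vector_derivative D t) (at t within {a..b})"
    using \<gamma>[unfolded C1_curve_def, THEN conjunct2, THEN bspec, OF c] by auto
  have Dw: "(\<phi> \<circ> \<gamma> has_vector_derivative D t) (at t within {a..b})" if "t \<in> {a..b}" for t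
    using D(2) that im by blast
  then have cont: "continuous_on {a..b} (\<phi> \<circ> \<gamma>)"
    unfolding continuous_on_eq_continuous_within using has_vector_derivative_continuous[OF Dw] by blast
  have Dt: "(\<phi> \<circ> \<gamma> has_vector_derivative D t) (at t)" if "t \<in> {a<..<b}" for t
    using Dw[of t] that at_within_Icc_at[of a t b] by simp
  have sp: "speed X g \<gamma> t = sqrt (g (U, \<phi>) (\<gamma> t) (D t) (D t))" if "t \<in> {a<..<b}" for t
  proof (rule speed_in_chart[OF \<gamma> that c _ Dt[OF that]])
    show "\<gamma> t \<in> U" using im that by auto
  qed
  have "continuous_on {a..b} (\<lambda>t. g (U, \<phi>) (inv_into U \<phi> ((\<phi> \<circ> \<gamma>) t)) (D t) (D t))"
    by (rule continuous_on_form[OF coordinates _ metric_continuous[OF c] cont _ D(1)])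
       (use im metric_bilinear[OF c] in \<open>auto simp: inv_into_f_f[OF chart_map_inj[OF c]]\<close>)
  then have "continuous_on {a..b} (\<lambda>t. g (U, \<phi>) (\<gamma> t) (D t) (D t))"
    by (rule continuous_on_eq) (use im in \<open>simp add: image_subset_iff inv_into_f_f[OF chart_map_inj[OF c]]\<close>)
  then have cs: "continuous_on {a..b} (\<lambda>t. sqrt (g (U, \<phi>) (\<gamma> t) (D t) (D t)))"
    by (rule continuous_on_real_sqrt)
  have "((\<lambda>t. sqrt (g (U, \<phi>) (\<gamma> t) (D t) (D t))) has_integral
      integral {a..b} (\<lambda>t. sqrt (g (U, \<phi>) (\<gamma> t) (D t) (D t)))) (cbox a b)"
    using integrable_integral[OF integrable_continuous_real[OF cs]] by simp
  then have "(speed X g \<gamma> has_integral integral {a..b} (\<lambda>t. sqrt (g (U, \<phi>) (\<gamma> t) (D t) (D t)))) (cbox a b)"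
    by (rule has_integral_spike_interior) (use sp in auto)
  then show thesis using that[OF cont Dt cs _ sp] by simp
qed

text \<open>
  In every other chart the velocity of a coordinate segment is the derivative of the coordinate change applied to the
  fixed vector \<open>w - u\<close>, which is continuous.
\<close>

lemma chart_segment_curve:
  assumes c: "(U, \<phi>) \<in> atlas X" and seg: "closed_segment u w \<subseteq> \<phi> ` U"
  shows "C1_curve X 0 1 (\<lambda>t. inv_into U \<phi> ((1 - t) *\<^sub>R u + t *\<^sub>R w))"
proof -
  have segU: "(1 - t) *\<^sub>R u + t *\<^sub>R w \<in> \<phi> ` U" if "t \<in> {0..1}" for t
    by (rule subsetD[OF seg]) (use that in \<open>auto simp: closed_segment_def\<close>)
  show ?thesis
    unfolding C1_curve_def
  proof (intro conjI ballI, goal_cases)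
    case 1
    have "continuous_map (top_of_set {0..1}) (top_of_set (\<phi> ` U)) (\<lambda>t::real. (1 - t) *\<^sub>R u + t *\<^sub>R w)"
      using segU by (simp add: continuous_map_in_subtopology Pi_iff continuous_intros)
    moreover have "continuous_map (top_of_set (\<phi> ` U)) (mtop X) (inv_into U \<phi>)"
      using chart_inv_continuous[OF chart_open[OF c] chart_homeo[OF c]] by (simp add: continuous_map_in_subtopology)
    ultimately have "continuous_map (top_of_set {0..1}) (mtop X) (inv_into U \<phi> \<circ> (\<lambda>t::real. (1 - t) *\<^sub>R u + t *\<^sub>R w))"
      by (rule continuous_map_compose)
    then show ?case by (simp add: comp_def)
  next
    case (2 c')
    obtain V \<psi> where c': "c' = (V, \<psi>)" by (cases c')
    let ?\<tau> = "\<psi> \<circ> inv_into U \<phi>" and ?s = "\<lambda>t::real. (1 - t) *\<^sub>R u + t *\<^sub>R w"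
    let ?\<gamma> = "\<lambda>t. inv_into U \<phi> (?s t)"
    let ?D = "\<lambda>t. frechet_derivative ?\<tau> (at (?s t)) (w - u)"
    have C1: "C1_on (\<phi> ` (U \<inter> V)) ?\<tau>" using transition_C1[OF c] 2 c' by blast
    have mem: "?s t \<in> \<phi> ` (U \<inter> V)" if t: "t \<in> {0..1}" "?\<gamma> t \<in> V" for t
    proof -
      have "?s t \<in> \<phi> ` U" by (rule segU[OF t(1)])
      then obtain x where "x \<in> U" "?s t = \<phi> x" by blast
      then show ?thesis using t(2) by (simp add: inv_into_f_f[OF chart_map_inj[OF c]])
    qed
    show ?case
      unfolding c' prod.case
    proof (intro exI[of _ ?D] conjI ballI impI)
      have "continuous_on {t \<in> {0..1}. ?\<gamma> t \<in> V} ?s" by (intro continuous_intros)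
      then show "continuous_on {t \<in> {0..1}. ?\<gamma> t \<in> V} ?D"
        by (rule continuous_on_compose2[of "\<phi> ` (U \<inter> V)" "\<lambda>y. frechet_derivative ?\<tau> (at y) (w - u)", rotated])
           (use C1 mem in auto)
      fix t :: real assume t: "t \<in> {0..1}" "?\<gamma> t \<in> V"
      have L: "(?\<tau> has_derivative frechet_derivative ?\<tau> (at (?s t))) (at (?s t))"
        by (rule C1_on_has_derivative[OF C1 mem[OF t]])
      have s: "(?s has_derivative (\<lambda>h. h *\<^sub>R (w - u))) (at t)"
        by (auto intro!: derivative_eq_intros simp: algebra_simps)
      have "(?\<tau> \<circ> ?s has_derivative frechet_derivative ?\<tau> (at (?s t)) \<circ> (\<lambda>h. h *\<^sub>R (w - u))) (at t)"
        by (rule diff_chain_at[OF s L])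
      moreover have "frechet_derivative ?\<tau> (at (?s t)) \<circ> (\<lambda>h. h *\<^sub>R (w - u)) = (\<lambda>h. h *\<^sub>R ?D t)"
        using linear_scale[OF has_derivative_linear[OF L]] by (auto simp: fun_eq_iff)
      ultimately have "(?\<tau> \<circ> ?s has_vector_derivative ?D t) (at t)"
        by (simp add: has_vector_derivative_def)
      then have "(\<psi> \<circ> ?\<gamma> has_vector_derivative ?D t) (at t)"
        unfolding comp_def .
      then show "(\<psi> \<circ> ?\<gamma> has_vector_derivative ?D t) (at t within {0..1})"
        by (rule has_vector_derivative_at_within)
    qed
  qed
qed

lemma C1_imp_piecewise_C1:
  assumes "C1_curve X a b \<gamma>" "a \<le> b"
  shows "piecewise_C1_curve X a b \<gamma>"
  unfolding piecewise_C1_curve_def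
proof (intro conjI exI[of _ "{a, b}"] ballI impI)
  fix s t assume "s \<in> {a, b}" "t \<in> {a, b}" "s < t \<and> {a, b} \<inter> {s<..<t} = {}"
  then have "s = a" "t = b" using assms(2) by auto
  then show "C1_curve X s t \<gamma>" using assms(1) by simp
qed (use assms in \<open>auto simp: C1_curve_def\<close>)

text \<open>
  On a small coordinate ball the metric lies between two multiples of the norm.  The upper bound is applied to
  the coordinate segment, which stays in the ball by convexity; the lower bound together with the mean value
  inequality bounds the displacement of the coordinates along any curve inside the ball.
\<close>

theorem length_comparable_to_chart_norm:
  assumes c: "(U, \<phi>) \<in> atlas X" and x: "x \<in> U"
  obtains W c C where "openin (mtop X) W" "x \<in> W" "W \<subseteq> U" "c > 0" "C > 0"
    "\<And>y z. y \<in> W \<Longrightarrow> z \<in> W \<Longrightarrow> riemannian_dist X g y z \<le> ennreal (C * norm (\<phi> y - \<phi> z))"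
    "\<And>\<gamma> a b. C1_curve X a b \<gamma> \<Longrightarrow> a \<le> b \<Longrightarrow> \<gamma> ` {a..b} \<subseteq> W \<Longrightarrow>
       speed X g \<gamma> integrable_on {a..b} \<and> c * norm (\<phi> (\<gamma> a) - \<phi> (\<gamma> b)) \<le> integral {a..b} (speed X g \<gamma>)"
proof -
  have inv: "inv_into U \<phi> (\<phi> y) = y" if "y \<in> U" for y
    using that by (simp add: inv_into_f_f[OF chart_map_inj[OF c]])
  obtain \<epsilon> k K where \<epsilon>: "\<epsilon> > 0" "k > 0" "K > 0" "ball (\<phi> x) \<epsilon> \<subseteq> \<phi> ` U"
    and cmp: "\<And>y v. y \<in> ball (\<phi> x) \<epsilon> \<Longrightarrow>
      k * norm v \<le> sqrt (g (U, \<phi>) (inv_into U \<phi> y) v v) \<and> sqrt (g (U, \<phi>) (inv_into U \<phi> y) v v) \<le> K * norm v"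
    by (rule form_locally_comparable[OF coordinates chart_image_open[OF c], of "\<phi> x" "\<lambda>y. g (U, \<phi>) (inv_into U \<phi> y)"])
       (use x inv metric_bilinear[OF c] metric_pos[OF c x] metric_continuous[OF c] in auto)
  let ?W = "{y \<in> U. \<phi> y \<in> ball (\<phi> x) \<epsilon>}"
  have W: "openin (mtop X) ?W"
    by (rule chart_openin_preimage[OF chart_open[OF c] chart_homeo[OF c]]) simp
  have up: "riemannian_dist X g y z \<le> ennreal (K * norm (\<phi> y - \<phi> z))" if y: "y \<in> ?W" and z: "z \<in> ?W" for y z
  proof -
    have "closed_segment (\<phi> y) (\<phi> z) \<subseteq> ball (\<phi> x) \<epsilon>"
      using y z by (intro closed_segment_subset) auto
    then have seg: "closed_segment (\<phi> y) (\<phi> z) \<subseteq> \<phi> ` U"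
      and segb: "\<And>t. t \<in> {0..1} \<Longrightarrow> (1 - t) *\<^sub>R \<phi> y + t *\<^sub>R \<phi> z \<in> ball (\<phi> x) \<epsilon>"
      using \<epsilon>(4) by (auto simp: closed_segment_def)
    let ?\<gamma> = "\<lambda>t. inv_into U \<phi> ((1 - t) *\<^sub>R \<phi> y + t *\<^sub>R \<phi> z)"
    have C1: "C1_curve X 0 1 ?\<gamma>" by (rule chart_segment_curve[OF c seg])
    have inU: "?\<gamma> t \<in> U" "\<phi> (?\<gamma> t) = (1 - t) *\<^sub>R \<phi> y + t *\<^sub>R \<phi> z" if "t \<in> {0..1}" for t
    proof -
      have "(1 - t) *\<^sub>R \<phi> y + t *\<^sub>R \<phi> z \<in> \<phi> ` U" using segb[OF that] \<epsilon>(4) by blast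
      then show "?\<gamma> t \<in> U" "\<phi> (?\<gamma> t) = (1 - t) *\<^sub>R \<phi> y + t *\<^sub>R \<phi> z"
        by (auto intro: inv_into_into f_inv_into_f)
    qed
    have im: "?\<gamma> ` {0..1} \<subseteq> U" using inU(1) by blast
    obtain D where D: "(speed X g ?\<gamma> has_integral integral {0..1} (\<lambda>t. sqrt (g (U, \<phi>) (?\<gamma> t) (D t) (D t)))) {0..1}"
      by (rule speed_continuous_in_chart[OF C1 zero_less_one c im])
    have sp: "speed X g ?\<gamma> t \<le> K * norm (\<phi> y - \<phi> z)" if t: "t \<in> {0<..<1}" for t
    proof -
      have t': "t \<in> {0..1}" using t by simp
      have "((\<lambda>t. (1 - t) *\<^sub>R \<phi> y + t *\<^sub>R \<phi> z) has_vector_derivative \<phi> z - \<phi> y) (at t)"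
        by (auto intro!: derivative_eq_intros simp: has_vector_derivative_def algebra_simps)
      then have "(\<phi> \<circ> ?\<gamma> has_vector_derivative \<phi> z - \<phi> y) (at t)"
        by (rule has_vector_derivative_transform_within_open[of _ _ _ "{0<..<1}"]) (use t inU(2) in auto)
      from speed_in_chart[OF C1 t c inU(1)[OF t'] this]
      have "speed X g ?\<gamma> t = sqrt (g (U, \<phi>) (?\<gamma> t) (\<phi> z - \<phi> y) (\<phi> z - \<phi> y))" .
      also have "\<dots> \<le> K * norm (\<phi> z - \<phi> y)" using cmp[OF segb[OF t']] by blast
      finally show ?thesis by (simp add: norm_minus_commute)
    qed
    have "((\<lambda>t::real. K * norm (\<phi> y - \<phi> z)) has_integral K * norm (\<phi> y - \<phi> z)) {0<..<1}"
      using has_integral_const_real[of "K * norm (\<phi> y - \<phi> z)" 0 1] by (simp add: has_integral_Icc_iff_Ioo)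
    from has_integral_le[OF D[unfolded has_integral_Icc_iff_Ioo] this sp]
    have "integral {0..1} (speed X g ?\<gamma>) \<le> K * norm (\<phi> y - \<phi> z)"
      unfolding integral_unique[OF D] .
    then have "curve_length X g 0 1 ?\<gamma> \<le> K * norm (\<phi> y - \<phi> z)"
      by (simp add: curve_length_def)
    moreover have "riemannian_dist X g y z \<le> ennreal (curve_length X g 0 1 ?\<gamma>)"
      unfolding riemannian_dist_def
    proof (rule Inf_lower, rule CollectI, intro exI conjI)
      show "piecewise_C1_curve X 0 1 ?\<gamma>" by (rule C1_imp_piecewise_C1[OF C1]) simp
      show "?\<gamma> 0 = y" "?\<gamma> 1 = z" using y z inv by auto
    qed (rule refl)
    ultimately show ?thesis by (meson ennreal_leI order_trans)
  qed
  have lo: "speed X g \<gamma> integrable_on {a..b} \<and> k * norm (\<phi> (\<gamma> a) - \<phi> (\<gamma> b)) \<le> integral {a..b} (speed X g \<gamma>)"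
    if \<gamma>: "C1_curve X a b \<gamma>" "a \<le> b" "\<gamma> ` {a..b} \<subseteq> ?W" for \<gamma> a b
  proof (cases "a = b")
    case True
    then show ?thesis using integrable_on_refl[of "speed X g \<gamma>" b] by simp
  next
    case False
    then have ab: "a < b" using \<gamma> by simp
    have im: "\<gamma> ` {a..b} \<subseteq> U" using \<gamma>(3) by blast
    obtain D where D: "continuous_on {a..b} (\<phi> \<circ> \<gamma>)"
      "\<And>t. t \<in> {a<..<b} \<Longrightarrow> (\<phi> \<circ> \<gamma> has_vector_derivative D t) (at t)"
      "continuous_on {a..b} (\<lambda>t. sqrt (g (U, \<phi>) (\<gamma> t) (D t) (D t)))"
      "(speed X g \<gamma> has_integral integral {a..b} (\<lambda>t. sqrt (g (U, \<phi>) (\<gamma> t) (D t) (D t)))) {a..b}"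
      by (rule speed_continuous_in_chart[OF \<gamma>(1) ab c im]) blast
    let ?\<sigma> = "\<lambda>t. sqrt (g (U, \<phi>) (\<gamma> t) (D t) (D t))"
    let ?F = "\<lambda>t. integral {a..t} ?\<sigma> / k"
    have dF: "(?F has_vector_derivative ?\<sigma> t / k) (at t within {a..b})" if "t \<in> {a..b}" for t
      using bounded_linear.has_vector_derivative[OF bounded_linear_divide[of k] integral_has_vector_derivative[OF D(3) that]] .
    have "norm ((\<phi> \<circ> \<gamma>) b - (\<phi> \<circ> \<gamma>) a) \<le> ?F b - ?F a"
    proof (rule differentiable_bound_general[OF ab D(1)])
      show "continuous_on {a..b} ?F"
        unfolding continuous_on_eq_continuous_within using has_vector_derivative_continuous[OF dF] by blast
      show "(\<phi> \<circ> \<gamma> has_vector_derivative D t) (at t)" if "a < t" "t < b" for t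
        using D(2) that by simp
      show "(?F has_vector_derivative ?\<sigma> t / k) (at t)" if "a < t" "t < b" for t
        using dF[of t] that at_within_Icc_at[of a t b] by simp
      show "norm (D t) \<le> ?\<sigma> t / k" if "a < t" "t < b" for t
      proof -
        have "\<gamma> t \<in> ?W" by (rule subsetD[OF \<gamma>(3) imageI]) (use that in simp)
        then have "k * norm (D t) \<le> ?\<sigma> t" using cmp[of "\<phi> (\<gamma> t)" "D t"] inv[of "\<gamma> t"] by simp
        then show ?thesis using \<epsilon>(2) by (simp add: field_simps)
      qed
    qed
    then have "k * norm (\<phi> (\<gamma> b) - \<phi> (\<gamma> a)) \<le> integral {a..b} ?\<sigma>"
      using \<epsilon>(2) by (simp add: field_simps)
    then show ?thesis
      using has_integral_integrable[OF D(4)] integral_unique[OF D(4)] by (simp add: norm_minus_commute)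
  qed
  show thesis
    by (rule that[OF W _ _ \<epsilon>(2,3)]) (use x \<epsilon>(1) up lo in auto)
qed

end

section \<open>Locally Lipschitz pseudometrics\<close>

context C1_riemannian
begin

text \<open>
  Integrability of the speed is part of the property: the integral of a function that is not integrable is \<open>0\<close>, so
  without it lengths would not be additive.
\<close>

definition bounds_along :: "('a \<Rightarrow> 'a \<Rightarrow> ennreal) \<Rightarrow> real \<Rightarrow> (real \<Rightarrow> 'a) \<Rightarrow> real \<Rightarrow> real \<Rightarrow> bool" where
  "bounds_along \<rho> K \<gamma> s t \<longleftrightarrow> speed X g \<gamma> integrable_on {s..t} \<and> 0 \<le> integral {s..t} (speed X g \<gamma>) \<and>
     \<rho> (\<gamma> s) (\<gamma> t) \<le> ennreal (K * integral {s..t} (speed X g \<gamma>))"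

lemma bounds_along_trans:
  assumes tri: "\<And>x y z. \<rho> x z \<le> \<rho> x y + \<rho> y z" and K: "0 \<le> K"
    and st: "bounds_along \<rho> K \<gamma> s t" "bounds_along \<rho> K \<gamma> t u" "s \<le> t" "t \<le> u"
  shows "bounds_along \<rho> K \<gamma> s u"
proof -
  let ?f = "speed X g \<gamma>"
  have i: "?f integrable_on {s..u}"
    using st Henstock_Kurzweil_Integration.integrable_combine[of s t u ?f] by (simp add: bounds_along_def)
  have c: "integral {s..t} ?f + integral {t..u} ?f = integral {s..u} ?f"
    using st(3,4) i by (rule Henstock_Kurzweil_Integration.integral_combine)
  have n: "0 \<le> integral {s..t} ?f" "0 \<le> integral {t..u} ?f"
    using st by (simp_all add: bounds_along_def)
  have "\<rho> (\<gamma> s) (\<gamma> u) \<le> \<rho> (\<gamma> s) (\<gamma> t) + \<rho> (\<gamma> t) (\<gamma> u)" by (rule tri)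
  also have "\<dots> \<le> ennreal (K * integral {s..t} ?f) + ennreal (K * integral {t..u} ?f)"
    using st by (intro add_mono) (simp_all add: bounds_along_def)
  also have "\<dots> = ennreal (K * integral {s..u} ?f)"
    using n K by (simp add: distrib_left flip: ennreal_plus c)
  finally show ?thesis using i c n by (simp add: bounds_along_def)
qed

lemma bounds_along_refl: "\<rho> (\<gamma> s) (\<gamma> s) = 0 \<Longrightarrow> bounds_along \<rho> K \<gamma> s s"
  using integrable_on_refl[of "speed X g \<gamma>" s] by (simp add: bounds_along_def)

lemma uminus_has_vector_derivative: "(uminus has_vector_derivative (- 1 :: real)) (at t within S)"
  using has_vector_derivative_minus[OF has_vector_derivative_id, of "at t within S"] by simp

lemma C1_curve_reverse:
  assumes "C1_curve X a b \<gamma>"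
  shows "C1_curve X (- b) (- a) (\<lambda>t. \<gamma> (- t))"
  unfolding C1_curve_def
proof (intro conjI ballI, goal_cases)
  case 1
  have "continuous_map (top_of_set {- b..- a}) (top_of_set {a..b}) (uminus :: real \<Rightarrow> real)"
    by (auto simp: continuous_map_in_subtopology intro!: continuous_intros)
  then have "continuous_map (top_of_set {- b..- a}) (mtop X) (\<gamma> \<circ> uminus)"
    by (rule continuous_map_compose) (use assms in \<open>simp add: C1_curve_def\<close>)
  then show ?case by (simp add: comp_def)
next
  case (2 c)
  obtain U \<phi> where c: "c = (U, \<phi>)" by (cases c)
  obtain D where D: "continuous_on {t \<in> {a..b}. \<gamma> t \<in> U} D"
    "\<forall>t \<in> {a..b}. \<gamma> t \<in> U \<longrightarrow> (\<phi> \<circ> \<gamma> has_vector_derivative D t) (at t within {a..b})"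
    using assms(1)[unfolded C1_curve_def, THEN conjunct2, THEN bspec, OF 2] unfolding c by auto
  show ?case
    unfolding c prod.case
  proof (intro exI[of _ "\<lambda>t. - D (- t)"] conjI ballI impI)
    show "continuous_on {t \<in> {- b..- a}. \<gamma> (- t) \<in> U} (\<lambda>t. - D (- t))"
      by (intro continuous_on_minus continuous_on_compose2[OF D(1)] continuous_intros) auto
    fix t assume t: "t \<in> {- b..- a}" "\<gamma> (- t) \<in> U"
    have u: "(uminus has_vector_derivative (- 1)) (at t within {- b..- a})"
      by (rule uminus_has_vector_derivative)
    have "uminus ` {- b..- a} = {a..b}" by simp
    moreover have "(\<phi> \<circ> \<gamma> has_vector_derivative D (- t)) (at (- t) within {a..b})" using D(2) t by simp
    ultimately have "((\<phi> \<circ> \<gamma>) \<circ> uminus has_vector_derivative (- 1) *\<^sub>R D (- t)) (at t within {- b..- a})"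
      by (intro vector_diff_chain_within[OF u]) simp
    then show "(\<phi> \<circ> (\<lambda>t. \<gamma> (- t)) has_vector_derivative - D (- t)) (at t within {- b..- a})"
      by (simp add: comp_def)
  qed
qed

lemma piecewise_C1_curve_reverse:
  assumes "piecewise_C1_curve X a b \<gamma>"
  shows "piecewise_C1_curve X (- b) (- a) (\<lambda>t. \<gamma> (- t))"
proof -
  obtain P where ab: "a \<le> b" and cont: "continuous_map (top_of_set {a..b}) (mtop X) \<gamma>"
    and P: "finite P" "{a, b} \<subseteq> P" "P \<subseteq> {a..b}"
      "\<forall>s\<in>P. \<forall>t\<in>P. s < t \<and> P \<inter> {s<..<t} = {} \<longrightarrow> C1_curve X s t \<gamma>"
    using assms unfolding piecewise_C1_curve_def by (elim conjE exE)
  have "continuous_map (top_of_set {- b..- a}) (top_of_set {a..b}) (uminus :: real \<Rightarrow> real)"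
    by (auto simp: continuous_map_in_subtopology intro!: continuous_intros)
  then have "continuous_map (top_of_set {- b..- a}) (mtop X) (\<gamma> \<circ> uminus)"
    using cont by (rule continuous_map_compose)
  then have c: "continuous_map (top_of_set {- b..- a}) (mtop X) (\<lambda>t. \<gamma> (- t))" by (simp add: comp_def)
  show ?thesis
    unfolding piecewise_C1_curve_def
  proof (intro conjI exI[of _ "uminus ` P"] ballI impI c)
    fix s t assume st: "s \<in> uminus ` P" "t \<in> uminus ` P" "s < t \<and> uminus ` P \<inter> {s<..<t} = {}"
    have "C1_curve X (- t) (- s) \<gamma>"
    proof (rule P(4)[rule_format, OF _ _ conjI])
      show "P \<inter> {- t<..<- s} = {}"
      proof (rule ccontr)
        assume "P \<inter> {- t<..<- s} \<noteq> {}"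
        then obtain q where "q \<in> P" "- t < q" "q < - s" by auto
        then have "- q \<in> uminus ` P \<inter> {s<..<t}" by auto
        with st(3) show False by blast
      qed
    qed (use st in auto)
    from C1_curve_reverse[OF this] show "C1_curve X s t (\<lambda>t. \<gamma> (- t))" by simp
  qed (use ab P in auto)
qed

text \<open>
  The curve is smooth between the last break point before \<open>x\<close> and the first one from \<open>x\<close> on.
\<close>

lemma C1_left_of:
  assumes \<gamma>: "piecewise_C1_curve X a b \<gamma>" and x: "a < x" "x \<le> b"
  obtains s where "a \<le> s" "s < x" "C1_curve X s x \<gamma>"
proof -
  obtain P where P: "finite P" "{a, b} \<subseteq> P" "P \<subseteq> {a..b}"
    "\<forall>s\<in>P. \<forall>t\<in>P. s < t \<and> P \<inter> {s<..<t} = {} \<longrightarrow> C1_curve X s t \<gamma>"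
    using \<gamma> unfolding piecewise_C1_curve_def by (elim conjE exE)
  let ?A = "{q \<in> P. q < x}" and ?B = "{q \<in> P. x \<le> q}"
  have A: "finite ?A" "a \<in> ?A" and B: "finite ?B" "b \<in> ?B" using P x by auto
  have mA: "Max ?A \<in> ?A" using A by (intro Max_in) auto
  have mB: "Min ?B \<in> ?B" using B by (intro Min_in) auto
  have "P \<inter> {Max ?A<..<Min ?B} = {}"
  proof (rule ccontr)
    assume "P \<inter> {Max ?A<..<Min ?B} \<noteq> {}"
    then obtain q where q: "q \<in> P" "Max ?A < q" "q < Min ?B" by auto
    show False
    proof (cases "q < x")
      case True
      then show False using q Max_ge[OF A(1), of q] by simp
    next
      case False
      then show False using q Min_le[OF B(1), of q] by simp
    qed
  qed
  moreover have "Max ?A < Min ?B" using mA mB by simp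
  ultimately have "C1_curve X (Max ?A) (Min ?B) \<gamma>" using P(4) mA mB by simp
  then have "C1_curve X (Max ?A) x \<gamma>" by (rule C1_curve_subinterval) (use mB in auto)
  moreover have "a \<le> Max ?A" using A by (rule Max_ge)
  ultimately show thesis using that mA by blast
qed

lemma C1_right_of:
  assumes \<gamma>: "piecewise_C1_curve X a b \<gamma>" and x: "a \<le> x" "x < b"
  obtains t where "x < t" "t \<le> b" "C1_curve X x t \<gamma>"
proof -
  obtain s where s: "- b \<le> s" "s < - x" "C1_curve X s (- x) (\<lambda>t. \<gamma> (- t))"
    by (rule C1_left_of[OF piecewise_C1_curve_reverse[OF \<gamma>], of "- x"]) (use x in auto)
  from C1_curve_reverse[OF s(3)] have "C1_curve X x (- s) \<gamma>" by simp
  with s show thesis by (intro that[of "- s"]) auto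
qed

text \<open>
  By bisection it suffices to treat short intervals around each parameter \<open>x\<close>.  Such an interval is split at
  \<open>x\<close>, so that each half contains no break point in its interior and stays in one of the given neighbourhoods.
\<close>

lemma bounds_along_global:
  assumes tri: "\<And>x y z. \<rho> x z \<le> \<rho> x y + \<rho> y z" and refl: "\<And>x. x \<in> points X \<Longrightarrow> \<rho> x x = 0" and K: "0 \<le> K"
    and loc: "\<And>x. x \<in> points X \<Longrightarrow> \<exists>W. openin (mtop X) W \<and> x \<in> W \<and>
       (\<forall>\<gamma> s t. C1_curve X s t \<gamma> \<and> s \<le> t \<and> \<gamma> ` {s..t} \<subseteq> W \<longrightarrow> bounds_along \<rho> K \<gamma> s t)"
    and \<gamma>: "piecewise_C1_curve X a b \<gamma>"
  shows "bounds_along \<rho> K \<gamma> a b"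
proof -
  have ab: "a \<le> b" and cont: "continuous_map (top_of_set {a..b}) (mtop X) \<gamma>"
    using \<gamma> by (auto simp: piecewise_C1_curve_def)
  have pts: "\<gamma> t \<in> points X" if "t \<in> {a..b}" for t
    using continuous_map_image_subset_topspace[OF cont] that by auto
  define Q where "Q s t \<longleftrightarrow> (a \<le> s \<and> t \<le> b \<and> s \<le> t \<longrightarrow> bounds_along \<rho> K \<gamma> s t)" for s t
  have "Q a b"
    using ab
  proof (induction rule: Bolzano)
    case (trans s t u)
    then show ?case
      unfolding Q_def by (intro impI bounds_along_trans[OF tri K, where s = s and t = t and u = u]) auto
  next
    case (local x)
    obtain W where W: "openin (mtop X) W" "\<gamma> x \<in> W"
      "\<And>\<gamma> s t. C1_curve X s t \<gamma> \<Longrightarrow> s \<le> t \<Longrightarrow> \<gamma> ` {s..t} \<subseteq> W \<Longrightarrow> bounds_along \<rho> K \<gamma> s t"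
      using loc[OF pts, of x] local by auto
    have "openin (top_of_set {a..b}) {t \<in> topspace (top_of_set {a..b}). \<gamma> t \<in> W}"
      by (rule openin_continuous_map_preimage[OF cont W(1)])
    moreover have "x \<in> {t \<in> topspace (top_of_set {a..b}). \<gamma> t \<in> W}" using local W by simp
    ultimately have "\<exists>d>0. \<forall>t\<in>{a..b}. dist t x < d \<longrightarrow> t \<in> {t \<in> topspace (top_of_set {a..b}). \<gamma> t \<in> W}"
      unfolding openin_euclidean_subtopology_iff by blast
    then obtain d where d: "d > 0" "\<And>t. t \<in> {a..b} \<Longrightarrow> \<bar>t - x\<bar> < d \<Longrightarrow> \<gamma> t \<in> W"
      by (auto simp: dist_real_def)
    have "\<exists>d1>0. \<forall>s. a \<le> s \<and> s \<le> x \<and> x - s < d1 \<longrightarrow> bounds_along \<rho> K \<gamma> s x"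
    proof (cases "a < x")
      case True
      then obtain s0 where s0: "a \<le> s0" "s0 < x" "C1_curve X s0 x \<gamma>"
        using C1_left_of[OF \<gamma>] local by blast
      have "bounds_along \<rho> K \<gamma> s x" if s: "a \<le> s" "s \<le> x" "x - s < min d (x - s0)" for s
      proof (rule W(3))
        show "C1_curve X s x \<gamma>" by (rule C1_curve_subinterval[OF s0(3)]) (use s in auto)
        show "\<gamma> ` {s..x} \<subseteq> W" using s local by (intro image_subsetI d(2)) auto
      qed (use s in simp)
      then show ?thesis using d(1) s0(2) by (intro exI[of _ "min d (x - s0)"]) simp
    next
      case False
      then have "x = a" using local by simp
      then show ?thesis
        using bounds_along_refl[of \<rho> \<gamma> a K, OF refl[OF pts]] ab by (intro exI[of _ 1]) auto
    qed
    then obtain d1 where d1: "d1 > 0" "\<And>s. a \<le> s \<Longrightarrow> s \<le> x \<Longrightarrow> x - s < d1 \<Longrightarrow> bounds_along \<rho> K \<gamma> s x"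
      by auto
    have "\<exists>d2>0. \<forall>t. x \<le> t \<and> t \<le> b \<and> t - x < d2 \<longrightarrow> bounds_along \<rho> K \<gamma> x t"
    proof (cases "x < b")
      case True
      then obtain t0 where t0: "x < t0" "t0 \<le> b" "C1_curve X x t0 \<gamma>"
        using C1_right_of[OF \<gamma>] local by blast
      have "bounds_along \<rho> K \<gamma> x t" if t: "x \<le> t" "t \<le> b" "t - x < min d (t0 - x)" for t
      proof (rule W(3))
        show "C1_curve X x t \<gamma>" by (rule C1_curve_subinterval[OF t0(3)]) (use t in auto)
        show "\<gamma> ` {x..t} \<subseteq> W" using t local by (intro image_subsetI d(2)) auto
      qed (use t in simp)
      then show ?thesis using d(1) t0(1) by (intro exI[of _ "min d (t0 - x)"]) simp
    next
      case False
      then have "x = b" using local by simp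
      then show ?thesis
        using bounds_along_refl[of \<rho> \<gamma> b K, OF refl[OF pts]] ab by (intro exI[of _ 1]) auto
    qed
    then obtain d2 where d2: "d2 > 0" "\<And>t. x \<le> t \<Longrightarrow> t \<le> b \<Longrightarrow> t - x < d2 \<Longrightarrow> bounds_along \<rho> K \<gamma> x t"
      by auto
    have "Q s t" if st: "s \<le> x \<and> x \<le> t \<and> t - s < min d1 d2" for s t
      unfolding Q_def
    proof
      assume "a \<le> s \<and> t \<le> b \<and> s \<le> t"
      then have "bounds_along \<rho> K \<gamma> s x" "bounds_along \<rho> K \<gamma> x t"
        using st by (auto intro!: d1(2) d2(2))
      then show "bounds_along \<rho> K \<gamma> s t" by (rule bounds_along_trans[where \<rho> = \<rho>, OF tri K]) (use st in auto)
    qed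
    then show ?case using d1(1) d2(1) by (intro exI[of _ "min d1 d2"]) simp
  qed
  then show ?thesis using ab by (simp add: Q_def)
qed

text \<open>
  Finitely many of the neighbourhoods on which lengths control coordinates cover the compact manifold, which gives a
  uniform constant; then the bound holds along every curve, and hence for the infimum of the lengths.
\<close>

theorem locally_Lipschitz_imp_Lipschitz:
  assumes cpt: "compact_space (mtop X)"
    and tri: "\<And>x y z. \<rho> x z \<le> \<rho> x y + \<rho> y z" and refl: "\<And>x. x \<in> points X \<Longrightarrow> \<rho> x x = 0"
    and loc: "\<And>x. x \<in> points X \<Longrightarrow> \<exists>(U, \<phi>) \<in> atlas X. \<exists>W C. openin (mtop X) W \<and> x \<in> W \<and> W \<subseteq> U \<and>
       (\<forall>y\<in>W. \<forall>z\<in>W. \<rho> y z \<le> ennreal (C * norm (\<phi> y - \<phi> z)))"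
  obtains K where "K > 0" "\<And>x y. \<rho> x y \<le> ennreal K * riemannian_dist X g x y"
proof -
  have "\<exists>W K. openin (mtop X) W \<and> x \<in> W \<and> 0 \<le> K \<and>
       (\<forall>\<gamma> s t. C1_curve X s t \<gamma> \<and> s \<le> t \<and> \<gamma> ` {s..t} \<subseteq> W \<longrightarrow> bounds_along \<rho> K \<gamma> s t)"
    if x: "x \<in> points X" for x
  proof -
    obtain U \<phi> W1 C where U: "(U, \<phi>) \<in> atlas X" and W1: "openin (mtop X) W1" "x \<in> W1" "W1 \<subseteq> U"
      and C: "\<forall>y\<in>W1. \<forall>z\<in>W1. \<rho> y z \<le> ennreal (C * norm (\<phi> y - \<phi> z))"
      using loc[OF x] by blast
    have "x \<in> U" using W1 by blast
    then obtain W2 c where W2: "openin (mtop X) W2" "x \<in> W2" "c > 0" and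
      low: "\<And>\<gamma> a b. C1_curve X a b \<gamma> \<Longrightarrow> a \<le> b \<Longrightarrow> \<gamma> ` {a..b} \<subseteq> W2 \<Longrightarrow>
       speed X g \<gamma> integrable_on {a..b} \<and> c * norm (\<phi> (\<gamma> a) - \<phi> (\<gamma> b)) \<le> integral {a..b} (speed X g \<gamma>)"
      by (rule length_comparable_to_chart_norm[OF U]) blast
    have "bounds_along \<rho> (\<bar>C\<bar> / c) \<gamma> s t"
      if \<gamma>: "C1_curve X s t \<gamma> \<and> s \<le> t \<and> \<gamma> ` {s..t} \<subseteq> W1 \<inter> W2" for \<gamma> s t
    proof -
      let ?n = "norm (\<phi> (\<gamma> s) - \<phi> (\<gamma> t))" and ?I = "integral {s..t} (speed X g \<gamma>)"
      have l: "speed X g \<gamma> integrable_on {s..t}" "c * ?n \<le> ?I"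
        using low[of s t \<gamma>] \<gamma> by auto
      have I: "0 \<le> ?I" using l(2) W2(3) by (meson less_imp_le mult_nonneg_nonneg norm_ge_zero order_trans)
      have "C * ?n \<le> \<bar>C\<bar> * ?n" by (intro mult_right_mono) auto
      also have "\<dots> \<le> \<bar>C\<bar> * (?I / c)" using l(2) W2(3) by (intro mult_left_mono) (auto simp: field_simps)
      finally have "ennreal (C * ?n) \<le> ennreal (\<bar>C\<bar> / c * ?I)" by (intro ennreal_leI) simp
      moreover have "\<gamma> s \<in> W1" "\<gamma> t \<in> W1" using \<gamma> by auto
      then have "\<rho> (\<gamma> s) (\<gamma> t) \<le> ennreal (C * ?n)" using C by blast
      ultimately show ?thesis using l I unfolding bounds_along_def by (meson order_trans)
    qed
    then show ?thesis
      using W1 W2 by (intro exI[of _ "W1 \<inter> W2"] exI[of _ "\<bar>C\<bar> / c"]) (simp add: openin_Int)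
  qed
  then obtain W K where W: "\<And>x. x \<in> points X \<Longrightarrow> openin (mtop X) (W x) \<and> x \<in> W x"
    and K: "\<And>x. x \<in> points X \<Longrightarrow> (0::real) \<le> K x"
    and WK: "\<And>x \<gamma> s t. x \<in> points X \<Longrightarrow> C1_curve X s t \<gamma> \<Longrightarrow> s \<le> t \<Longrightarrow> \<gamma> ` {s..t} \<subseteq> W x \<Longrightarrow> bounds_along \<rho> (K x) \<gamma> s t"
    by metis
  have "\<exists>\<F>. finite \<F> \<and> \<F> \<subseteq> W ` points X \<and> points X \<subseteq> \<Union>\<F>"
    using cpt[unfolded compact_space_alt, rule_format, of "W ` points X"] W by blast
  then obtain T where T: "finite T" "T \<subseteq> points X" "points X \<subseteq> (\<Union>x\<in>T. W x)"
    by (metis finite_subset_image)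
  \<comment> \<open>The summand \<open>1\<close> makes the constant positive also when all \<open>K x\<close> vanish.\<close>
  define K0 where "K0 = 1 + sum K T"
  have KT: "K x \<le> K0" if "x \<in> T" for x
  proof -
    have "K x \<le> sum K T" using that T K by (intro member_le_sum) auto
    then show ?thesis by (simp add: K0_def)
  qed
  have "sum K T \<ge> 0" using K T by (intro sum_nonneg) auto
  then have K0: "K0 > 0" by (simp add: K0_def)
  have all: "bounds_along \<rho> K0 \<gamma> a b" if \<gamma>: "piecewise_C1_curve X a b \<gamma>" for \<gamma> a b
  proof (rule bounds_along_global[where \<rho> = \<rho>, OF tri refl _ _ \<gamma>])
    fix x assume "x \<in> points X"
    then obtain y where y: "y \<in> T" "x \<in> W y" using T by blast
    have "bounds_along \<rho> K0 \<gamma> s t" if "C1_curve X s t \<gamma> \<and> s \<le> t \<and> \<gamma> ` {s..t} \<subseteq> W y" for \<gamma> s t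
    proof -
      have "bounds_along \<rho> (K y) \<gamma> s t" using WK that y T by blast
      moreover from this have "ennreal (K y * integral {s..t} (speed X g \<gamma>)) \<le> ennreal (K0 * integral {s..t} (speed X g \<gamma>))"
        using KT[OF y(1)] by (intro ennreal_leI mult_right_mono) (auto simp: bounds_along_def)
      ultimately show ?thesis unfolding bounds_along_def by (meson order_trans)
    qed
    then show "\<exists>W. openin (mtop X) W \<and> x \<in> W \<and>
       (\<forall>\<gamma> s t. C1_curve X s t \<gamma> \<and> s \<le> t \<and> \<gamma> ` {s..t} \<subseteq> W \<longrightarrow> bounds_along \<rho> K0 \<gamma> s t)"
      using W y T by (intro exI[of _ "W y"]) blast
  next
    show "0 \<le> K0" using K0 by linarith
  qed
  have "\<rho> x y \<le> ennreal K0 * riemannian_dist X g x y" for x y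
  proof -
    show ?thesis
      unfolding riemannian_dist_def
    proof (rule ennreal_le_mult_Inf[OF K0], elim CollectE exE conjE)
      fix l a b \<gamma>
      assume l: "l = ennreal (curve_length X g a b \<gamma>)" and \<gamma>: "piecewise_C1_curve X a b \<gamma>" "\<gamma> a = x" "\<gamma> b = y"
      have "\<rho> x y \<le> ennreal (K0 * curve_length X g a b \<gamma>)"
        using all[OF \<gamma>(1)] \<gamma>(2,3) by (simp add: bounds_along_def curve_length_def)
      also have "\<dots> = ennreal K0 * l"
        using all[OF \<gamma>(1)] K0 by (simp add: l bounds_along_def curve_length_def ennreal_mult)
      finally show "\<rho> x y \<le> ennreal K0 * l" .
    qed
  qed
  with K0 that show thesis by blast
qed

text \<open>
  Both speeds are computed in the same chart.  If the velocity exists, reversal changes its sign; otherwise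
  \<^const>\<open>vector_derivative\<close> returns the same default value for both curves.
\<close>

lemma speed_reverse:
  assumes "\<gamma> (- t) \<in> points X"
  shows "speed X g (\<lambda>s. \<gamma> (- s)) t = speed X g \<gamma> (- t)"
proof -
  let ?c = "SOME c. c \<in> atlas X \<and> \<gamma> (- t) \<in> fst c"
  obtain U \<phi> where "(U, \<phi>) \<in> atlas X" "\<gamma> (- t) \<in> U" using charts_cover[OF assms] by blast
  then have "(U, \<phi>) \<in> atlas X \<and> \<gamma> (- t) \<in> fst (U, \<phi>)" by simp
  then have "?c \<in> atlas X \<and> \<gamma> (- t) \<in> fst ?c" by (rule someI)
  then have bil: "bilinear (g ?c (\<gamma> (- t)))"
    using metric_bilinear[of "fst ?c" "snd ?c"] by simp
  let ?f = "snd ?c \<circ> \<gamma>" and ?h = "snd ?c \<circ> (\<lambda>s. \<gamma> (- s))"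
  have rev: "(h has_vector_derivative D) (at s) \<Longrightarrow> ((\<lambda>s. h (- s)) has_vector_derivative - D) (at (- s))"
    for h :: "real \<Rightarrow> 'e" and D s
    using vector_diff_chain_at[OF uminus_has_vector_derivative, of h D "- s"] by (simp add: comp_def)
  have eq: "(?h has_vector_derivative D) (at t) \<longleftrightarrow> (?f has_vector_derivative - D) (at (- t))" for D
    using rev[of ?h D t] rev[of ?f "- D" "- t"] by (auto simp: comp_def)
  have "vector_derivative ?h (at t) = - vector_derivative ?f (at (- t)) \<or>
      vector_derivative ?h (at t) = vector_derivative ?f (at (- t))"
  proof (cases "\<exists>D. (?h has_vector_derivative D) (at t)")
    case True
    then obtain D where D: "(?h has_vector_derivative D) (at t)" by blast
    with eq have "(?f has_vector_derivative - D) (at (- t))" by blast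
    with D show ?thesis by (simp add: vector_derivative_at)
  next
    case False
    then have "\<not> (?h has_vector_derivative D) (at t)" "\<not> (?f has_vector_derivative D) (at (- t))" for D
      using eq[of "- D"] by auto
    then show ?thesis by (simp add: vector_derivative_def)
  qed
  then have "g ?c (\<gamma> (- t)) (vector_derivative ?h (at t)) (vector_derivative ?h (at t)) =
      g ?c (\<gamma> (- t)) (vector_derivative ?f (at (- t))) (vector_derivative ?f (at (- t)))"
    using bilinear_lneg[OF bil] bilinear_rneg[OF bil] by auto
  then show ?thesis by (simp add: speed_def Let_def)
qed

theorem riemannian_dist_sym: "riemannian_dist X g x y = riemannian_dist X g y x"
proof -
  have "riemannian_dist X g x y \<le> riemannian_dist X g y x" for x y
    unfolding riemannian_dist_def[of X g y x]
  proof (rule Inf_greatest, elim CollectE exE conjE)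
    fix l a b \<gamma>
    assume l: "l = ennreal (curve_length X g a b \<gamma>)" and \<gamma>: "piecewise_C1_curve X a b \<gamma>" "\<gamma> a = y" "\<gamma> b = x"
    let ?\<gamma> = "\<lambda>t. \<gamma> (- t)"
    have pts: "\<gamma> t \<in> points X" if "t \<in> {a..b}" for t
      using \<gamma>(1) continuous_map_image_subset_topspace[of "top_of_set {a..b}" "mtop X" \<gamma>] that
      by (auto simp: piecewise_C1_curve_def)
    have "curve_length X g (- b) (- a) ?\<gamma> = integral {- b..- a} (\<lambda>t. speed X g \<gamma> (- t))"
      unfolding curve_length_def by (rule integral_cong) (use pts in \<open>auto intro!: speed_reverse\<close>)
    also have "\<dots> = curve_length X g a b \<gamma>" by (simp add: curve_length_def)
    finally have "l = ennreal (curve_length X g (- b) (- a) ?\<gamma>)" using l by simp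
    moreover have "piecewise_C1_curve X (- b) (- a) ?\<gamma> \<and> ?\<gamma> (- b) = x \<and> ?\<gamma> (- a) = y"
      using piecewise_C1_curve_reverse[OF \<gamma>(1)] \<gamma> by simp
    ultimately show "riemannian_dist X g x y \<le> l"
      unfolding riemannian_dist_def by (intro Inf_lower) blast
  qed
  from order_antisym[OF this this] show ?thesis .
qed

end

section \<open>Hausdorff quotients under Lipschitz equivalence\<close>

lemma chain_dist_le_set_dist: "A \<in> P \<Longrightarrow> B \<in> P \<Longrightarrow> chain_dist d P A B \<le> set_dist d A B"
  unfolding chain_dist_def by (rule Inf_lower) (auto intro!: exI[of _ "[A, B]"])

lemma chain_dist_le_dist:
  assumes "A \<in> P" "B \<in> P" "x \<in> A" "y \<in> B"
  shows "chain_dist d P A B \<le> d x y"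
proof -
  have "set_dist d A B \<le> d x y"
    unfolding set_dist_def using assms(3,4) by (intro Inf_lower) blast
  with chain_dist_le_set_dist[OF assms(1,2)] show ?thesis by (rule order_trans)
qed

text \<open>
  Every link of a chain from \<open>A\<close> to \<open>B\<close> is mapped to two sets at chain distance at most \<open>K\<close> times the length of
  the link; these distances add up by the triangle inequality, with the same constant for chains of any length.
\<close>

lemma chain_dist_Lipschitz:
  assumes f: "f ` P \<subseteq> Q" and K: "K > 0"
    and le: "\<And>A B x y. A \<in> P \<Longrightarrow> B \<in> P \<Longrightarrow> x \<in> A \<Longrightarrow> y \<in> B \<Longrightarrow>
      chain_dist d' Q (f A) (f B) \<le> ennreal K * d x y"
    and AB: "A \<in> P" "B \<in> P"
  shows "chain_dist d' Q (f A) (f B) \<le> ennreal K * chain_dist d P A B"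
proof -
  have link: "chain_dist d' Q (f A) (f B) \<le> ennreal K * set_dist d A B" if "A \<in> P" "B \<in> P" for A B
    unfolding set_dist_def by (rule ennreal_le_mult_Inf[OF K]) (use le that in blast)
  have chain: "chain_dist d' Q (f (hd Ls)) (f (last Ls)) \<le>
      ennreal K * (\<Sum>i<length Ls - 1. set_dist d (Ls ! i) (Ls ! Suc i))"
    if "Ls \<noteq> []" "set Ls \<subseteq> P" for Ls
    using that
  proof (induction Ls rule: list_nonempty_induct)
    case (single A)
    then show ?case using chain_dist_refl[of "f A" Q d'] f by auto
  next
    case (cons A Ls)
    let ?s = "\<lambda>Ls. \<Sum>i<length Ls - 1. set_dist d (Ls ! i) (Ls ! Suc i)"
    have A: "A \<in> P" "hd Ls \<in> P" "set Ls \<subseteq> P" using cons by auto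
    have sum: "?s (A # Ls) = set_dist d A (hd Ls) + ?s Ls"
    proof -
      have "length (A # Ls) - 1 = Suc (length Ls - 1)" using cons(1) by (cases Ls) auto
      then have "?s (A # Ls) = set_dist d ((A # Ls) ! 0) ((A # Ls) ! Suc 0) +
          (\<Sum>i<length Ls - 1. set_dist d ((A # Ls) ! Suc i) ((A # Ls) ! Suc (Suc i)))"
        by (simp only: sum.lessThan_Suc_shift)
      then show ?thesis using cons(1) by (simp add: hd_conv_nth)
    qed
    have "chain_dist d' Q (f (hd (A # Ls))) (f (last (A # Ls))) \<le>
        chain_dist d' Q (f A) (f (hd Ls)) + chain_dist d' Q (f (hd Ls)) (f (last Ls))"
      using chain_dist_triangle[of d' Q "f A" "f (last Ls)" "f (hd Ls)"] cons(1) by simp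
    also have "\<dots> \<le> ennreal K * set_dist d A (hd Ls) + ennreal K * ?s Ls"
      using link[OF A(1,2)] cons.IH[OF A(3)] by (rule add_mono)
    also have "\<dots> = ennreal K * ?s (A # Ls)" unfolding sum by (simp add: distrib_left)
    finally show ?case .
  qed
  show ?thesis
    unfolding chain_dist_def[of d P]
  proof (rule ennreal_le_mult_Inf[OF K], elim CollectE exE conjE)
    fix s Ls
    assume "s = (\<Sum>i<length Ls - 1. set_dist d (Ls ! i) (Ls ! Suc i))" "Ls \<noteq> []" "set Ls \<subseteq> P" "hd Ls = A" "last Ls = B"
    then show "chain_dist d' Q (f A) (f B) \<le> ennreal K * s" using chain[of Ls] by simp
  qed
qed

lemma Lipschitz_continuous_map_ext_metric:
  assumes f: "f \<in> S \<rightarrow> S'" and K: "K > 0"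
    and le: "\<And>x y. x \<in> S \<Longrightarrow> y \<in> S \<Longrightarrow> d' (f x) (f y) \<le> ennreal K * d x y"
  shows "continuous_map (ext_metric_topology S d) (ext_metric_topology S' d') f"
  unfolding continuous_map_def topspace_ext_metric_topology
proof (intro conjI f allI impI)
  fix U assume "openin (ext_metric_topology S' d') U"
  then have U: "\<forall>x\<in>U. \<exists>e>0. \<forall>y\<in>S'. d' x y < e \<longrightarrow> y \<in> U" by (simp add: openin_ext_metric_topology)
  show "openin (ext_metric_topology S d) {x \<in> S. f x \<in> U}"
    unfolding openin_ext_metric_topology
  proof (intro conjI ballI)
    fix x assume x: "x \<in> {x \<in> S. f x \<in> U}"
    then obtain e where e: "e > 0" "\<And>y. y \<in> S' \<Longrightarrow> d' (f x) y < e \<Longrightarrow> y \<in> U" using U by blast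
    have "f y \<in> U" if y: "y \<in> S" "d x y < e / ennreal K" for y
    proof (rule e(2))
      show "f y \<in> S'" using f y(1) by blast
      have "ennreal K * d x y < e"
      proof (rule ccontr)
        assume "\<not> ennreal K * d x y < e"
        then have "e / ennreal K \<le> d x y"
          using K by (simp add: divide_le_posI_ennreal mult.commute not_less)
        with y(2) show False by simp
      qed
      moreover have "d' (f x) (f y) \<le> ennreal K * d x y" using le x y(1) by simp
      ultimately show "d' (f x) (f y) < e" by (rule le_less_trans[rotated])
    qed
    moreover have "e / ennreal K > 0" using e(1) by (simp add: ennreal_zero_less_divide)
    ultimately show "\<exists>e>0. \<forall>y\<in>S. d x y < e \<longrightarrow> y \<in> {x \<in> S. f x \<in> U}" by blast
  qed auto
qed

text \<open>
  The two inequalities show that \<open>f\<close> identifies the pairs at chain distance \<open>0\<close>, so that it maps classes onto classes.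
\<close>

lemma quotient_image_Lipschitz:
  assumes sym: "\<And>x y. d x y = d y x" "\<And>x y. d' x y = d' y x"
    and bij: "bij_betw f P Q" and K: "K > 0" "K' > 0"
    and le: "\<And>A B. A \<in> P \<Longrightarrow> B \<in> P \<Longrightarrow> chain_dist d' Q (f A) (f B) \<le> ennreal K * chain_dist d P A B"
    and ge: "\<And>A B. A \<in> P \<Longrightarrow> B \<in> P \<Longrightarrow> chain_dist d P A B \<le> ennreal K' * chain_dist d' Q (f A) (f B)"
  shows "continuous_map (hausdorff_quotient d P) (hausdorff_quotient d' Q) ((`) f)"
    and "\<And>A. A \<in> P \<Longrightarrow> f ` (chain_rel d P `` {A}) = chain_rel d' Q `` {f A}"
proof -
  have im: "f ` P = Q" using bij by (simp add: bij_betw_def)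
  have rel: "(f A, f B) \<in> chain_rel d' Q \<longleftrightarrow> (A, B) \<in> chain_rel d P" if "A \<in> P" "B \<in> P" for A B
    using le[OF that] ge[OF that] im that by (auto simp: chain_rel_def)
  show cls: "f ` (chain_rel d P `` {A}) = chain_rel d' Q `` {f A}" if A: "A \<in> P" for A
  proof
    show "f ` (chain_rel d P `` {A}) \<subseteq> chain_rel d' Q `` {f A}"
      using rel A by (auto simp: chain_rel_def)
    show "chain_rel d' Q `` {f A} \<subseteq> f ` (chain_rel d P `` {A})"
    proof
      fix C assume "C \<in> chain_rel d' Q `` {f A}"
      then have C: "(f A, C) \<in> chain_rel d' Q" by simp
      then have "C \<in> Q" by (simp add: chain_rel_def)
      then obtain D where "D \<in> P" "C = f D" using im by blast
      with C rel A show "C \<in> f ` (chain_rel d P `` {A})" by blast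
    qed
  qed
  show "continuous_map (hausdorff_quotient d P) (hausdorff_quotient d' Q) ((`) f)"
    unfolding hausdorff_quotient_def
  proof (rule Lipschitz_continuous_map_ext_metric[OF _ K(1)])
    show "(`) f \<in> P // chain_rel d P \<rightarrow> Q // chain_rel d' Q"
    proof
      fix X assume "X \<in> P // chain_rel d P"
      then obtain A where A: "A \<in> P" "X = chain_rel d P `` {A}" by (auto elim: quotientE)
      then have "f ` X = chain_rel d' Q `` {f A}" "f A \<in> Q" using cls im by auto
      then show "f ` X \<in> Q // chain_rel d' Q" by (simp add: quotientI)
    qed
    fix X Y assume "X \<in> P // chain_rel d P" "Y \<in> P // chain_rel d P"
    then obtain A B where A: "A \<in> P" "X = chain_rel d P `` {A}" and B: "B \<in> P" "Y = chain_rel d P `` {B}"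
      by (auto elim!: quotientE)
    have Q: "f A \<in> Q" "f B \<in> Q" using im A B by auto
    show "class_dist d' Q (f ` X) (f ` Y) \<le> ennreal K * class_dist d P X Y"
      unfolding A(2) B(2) cls[OF A(1)] cls[OF B(1)]
      using le[OF A(1) B(1)] class_dist_eq[of d', OF sym(2) Q] class_dist_eq[of d, OF sym(1) A(1) B(1)] by simp
  qed
qed

text \<open>
  The inverse bijection satisfies the same two inequalities with the constants exchanged, and it induces the inverse
  map of the quotients.
\<close>

theorem hausdorff_quotient_homeomorphic:
  assumes sym: "\<And>x y. d x y = d y x" "\<And>x y. d' x y = d' y x"
    and bij: "bij_betw f P Q" and K: "K > 0" "K' > 0"
    and le: "\<And>A B. A \<in> P \<Longrightarrow> B \<in> P \<Longrightarrow> chain_dist d' Q (f A) (f B) \<le> ennreal K * chain_dist d P A B"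
    and ge: "\<And>A B. A \<in> P \<Longrightarrow> B \<in> P \<Longrightarrow> chain_dist d P A B \<le> ennreal K' * chain_dist d' Q (f A) (f B)"
  shows "hausdorff_quotient d P homeomorphic_space hausdorff_quotient d' Q"
proof -
  let ?g = "inv_into P f"
  have bij': "bij_betw ?g Q P" by (rule bij_betw_inv_into[OF bij])
  have fg: "f (?g C) = C" "?g C \<in> P" if "C \<in> Q" for C
    using bij that by (auto simp: bij_betw_def intro: f_inv_into_f inv_into_into)
  have gf: "?g (f A) = A" "f A \<in> Q" if "A \<in> P" for A
    using bij that by (auto simp: bij_betw_def)
  have le': "chain_dist d P (?g A) (?g B) \<le> ennreal K' * chain_dist d' Q A B" if "A \<in> Q" "B \<in> Q" for A B
    using ge[OF fg(2)[OF that(1)] fg(2)[OF that(2)]] fg that by simp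
  have ge': "chain_dist d' Q A B \<le> ennreal K * chain_dist d P (?g A) (?g B)" if "A \<in> Q" "B \<in> Q" for A B
    using le[OF fg(2)[OF that(1)] fg(2)[OF that(2)]] fg that by simp
  have F1: "continuous_map (hausdorff_quotient d P) (hausdorff_quotient d' Q) ((`) f)"
    by (rule quotient_image_Lipschitz(1)) (fact sym bij K le ge)+
  have F2: "f ` (chain_rel d P `` {A}) = chain_rel d' Q `` {f A}" if "A \<in> P" for A
    by (rule quotient_image_Lipschitz(2)[where K = K and K' = K']) (fact sym bij K le ge that)+
  have G1: "continuous_map (hausdorff_quotient d' Q) (hausdorff_quotient d P) ((`) ?g)"
    by (rule quotient_image_Lipschitz(1)) (fact sym bij' K le' ge')+
  have G2: "?g ` (chain_rel d' Q `` {A}) = chain_rel d P `` {?g A}" if "A \<in> Q" for A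
    by (rule quotient_image_Lipschitz(2)[where K = K' and K' = K]) (fact sym bij' K le' ge' that)+
  have "homeomorphic_maps (hausdorff_quotient d P) (hausdorff_quotient d' Q) ((`) f) ((`) ?g)"
    unfolding homeomorphic_maps_def
  proof (intro conjI ballI F1 G1)
    fix X assume "X \<in> topspace (hausdorff_quotient d P)"
    then obtain A where A: "A \<in> P" "X = chain_rel d P `` {A}"
      unfolding hausdorff_quotient_def topspace_ext_metric_topology by (auto elim: quotientE)
    then show "?g ` (f ` X) = X" using F2[OF A(1)] G2[OF gf(2)[OF A(1)]] gf(1) by simp
  next
    fix Y assume "Y \<in> topspace (hausdorff_quotient d' Q)"
    then obtain A where A: "A \<in> Q" "Y = chain_rel d' Q `` {A}"
      unfolding hausdorff_quotient_def topspace_ext_metric_topology by (auto elim: quotientE)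
    then show "f ` (?g ` Y) = Y" using G2[OF A(1)] F2[OF fg(2)[OF A(1)]] fg(1) by simp
  qed
  then show ?thesis by (auto simp: homeomorphic_space_def)
qed

section \<open>Local properties of smooth manifolds\<close>

lemma manifold_chart:
  assumes "smooth_manifold n M" "(U, \<phi>) \<in> atlas M"
  shows "openin (mtop M) U" "open (\<phi> ` U)" "homeomorphic_map (subtopology (mtop M) U) (top_of_set (\<phi> ` U)) \<phi>"
proof -
  have "\<forall>(U, \<phi>) \<in> atlas M. openin (mtop M) U \<and> open (\<phi> ` U) \<and>
        homeomorphic_map (subtopology (mtop M) U) (top_of_set (\<phi> ` U)) \<phi>"
    using assms(1) unfolding smooth_manifold_def by (elim conjE)
  from bspec[OF this assms(2)] show "openin (mtop M) U" "open (\<phi> ` U)"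
    "homeomorphic_map (subtopology (mtop M) U) (top_of_set (\<phi> ` U)) \<phi>" by simp_all
qed

lemma manifold_cover:
  assumes "smooth_manifold n M" "x \<in> points M"
  obtains U \<phi> where "(U, \<phi>) \<in> atlas M" "x \<in> U"
proof -
  have "(\<Union>(U, \<phi>) \<in> atlas M. U) = points M"
    using assms(1) unfolding smooth_manifold_def by (elim conjE)
  then have "x \<in> (\<Union>(U, \<phi>) \<in> atlas M. U)" using assms(2) by simp
  then show thesis by (auto intro: that)
qed

lemma manifold_transition:
  assumes "smooth_manifold n M" "(U, \<phi>) \<in> atlas M" "(V, \<psi>) \<in> atlas M"
  shows "C1_on (\<phi> ` (U \<inter> V)) (\<psi> \<circ> inv_into U \<phi>)"
proof -
  have "\<forall>(U, \<phi>) \<in> atlas M. \<forall>(V, \<psi>) \<in> atlas M. smooth_on (\<phi> ` (U \<inter> V)) (\<psi> \<circ> inv_into U \<phi>)"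
    using assms(1) unfolding smooth_manifold_def by (elim conjE)
  from bspec[OF bspec[OF this assms(2), unfolded prod.case] assms(3)] show ?thesis
    by (intro smooth_on_C1) simp
qed

lemma manifold_coordinates:
  fixes M :: "('a, 'e::real_normed_vector) mfd"
  assumes "smooth_manifold n M"
  obtains m and e :: "nat \<Rightarrow> 'e" and r where "bounded_coordinates m e r"
proof -
  obtain S :: "'e set" where "finite S" "independent S" "span S = UNIV"
    using assms unfolding smooth_manifold_def by (elim conjE exE)
  then show thesis using that by (rule bounded_coordinates_exist)
qed

lemma manifold_C1_riemannian:
  assumes "smooth_manifold n M" "riemannian_metric M g" "bounded_coordinates m e r"
  shows "C1_riemannian M g m e r"
proof
  fix x assume "x \<in> points M"
  then obtain U \<phi> where "(U, \<phi>) \<in> atlas M" "x \<in> U" by (rule manifold_cover[OF assms(1)])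
  then show "\<exists>(U, \<phi>)\<in>atlas M. x \<in> U" by blast
qed (use assms manifold_chart[OF assms(1)] manifold_transition[OF assms(1)] in simp_all)

lemma manifold_chart_image:
  assumes M: "smooth_manifold n M" and c: "(U, \<phi>) \<in> atlas M" and S: "S \<subseteq> \<phi> ` U"
  shows "inv_into U \<phi> ` S = {x \<in> U. \<phi> x \<in> S}"
proof -
  note inv = inv_into_f_f[OF chart_inj[OF manifold_chart(1,3)[OF M c]]]
  show ?thesis
  proof (intro equalityI subsetI)
    fix x assume "x \<in> inv_into U \<phi> ` S"
    then obtain s where s: "s \<in> S" "x = inv_into U \<phi> s" by blast
    then have "s \<in> \<phi> ` U" using S by blast
    then show "x \<in> {x \<in> U. \<phi> x \<in> S}" using s by (simp add: inv_into_into f_inv_into_f)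
  next
    fix x assume x: "x \<in> {x \<in> U. \<phi> x \<in> S}"
    then have "x = inv_into U \<phi> (\<phi> x)" using inv[of x] by simp
    then show "x \<in> inv_into U \<phi> ` S" using x by blast
  qed
qed

lemma manifold_locally_path_connected:
  assumes M: "smooth_manifold n M"
  shows "locally_path_connected_space (mtop M)"
  unfolding locally_path_connected_space
proof (intro allI impI)
  fix V x assume V: "openin (mtop M) V \<and> x \<in> V"
  then have "x \<in> points M" using openin_subset by blast
  then obtain U \<phi> where c: "(U, \<phi>) \<in> atlas M" "x \<in> U" by (rule manifold_cover[OF M])
  note ch = manifold_chart[OF M c(1)]
  have "open (\<phi> ` (U \<inter> V))"
    by (rule chart_open_image[OF ch(1,3,2)]) (use V ch(1) in auto)
  then obtain r where r: "r > 0" "ball (\<phi> x) r \<subseteq> \<phi> ` (U \<inter> V)"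
    using open_contains_ball c(2) V by (metis IntI imageI)
  then have sub: "ball (\<phi> x) r \<subseteq> \<phi> ` U" by blast
  let ?N = "inv_into U \<phi> ` ball (\<phi> x) r"
  have N: "?N = {y \<in> U. \<phi> y \<in> ball (\<phi> x) r}" by (rule manifold_chart_image[OF M c(1) sub])
  have "continuous_map (top_of_set (\<phi> ` U)) (mtop M) (inv_into U \<phi>)"
    using chart_inv_continuous[OF ch(1,3)] by (simp add: continuous_map_in_subtopology)
  moreover have "path_connectedin (top_of_set (\<phi> ` U)) (ball (\<phi> x) r)"
    using sub by (simp add: path_connectedin_subtopology convex_imp_path_connected)
  ultimately have "path_connectedin (mtop M) ?N" by (rule path_connectedin_continuous_map_image)
  moreover have "openin (mtop M) ?N"
    unfolding N by (rule chart_openin_preimage[OF ch(1,3)]) simp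
  moreover have "x \<in> ?N" unfolding N using c(2) r(1) by simp
  moreover have "?N \<subseteq> V"
  proof
    fix y assume "y \<in> ?N"
    then have y: "y \<in> U" "\<phi> y \<in> ball (\<phi> x) r" unfolding N by auto
    then obtain w where "w \<in> U \<inter> V" "\<phi> y = \<phi> w" using r(2) by blast
    then have "y = w" using chart_inj[OF ch(1,3)] y(1) by (auto dest: inj_onD)
    then show "y \<in> V" using \<open>w \<in> U \<inter> V\<close> by simp
  qed
  ultimately show "\<exists>U. openin (mtop M) U \<and> path_connectedin (mtop M) U \<and> x \<in> U \<and> U \<subseteq> V" by blast
qed

lemma manifold_compact_neighbourhood:
  fixes M :: "('a, 'e::real_normed_vector) mfd"
  assumes M: "smooth_manifold n M" and x: "x \<in> points M"
  obtains N K where "openin (mtop M) N" "x \<in> N" "N \<subseteq> K" "compactin (mtop M) K"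
proof -
  obtain m r and e :: "nat \<Rightarrow> 'e" where co: "bounded_coordinates m e r" by (rule manifold_coordinates[OF M])
  obtain U \<phi> where c: "(U, \<phi>) \<in> atlas M" "x \<in> U" by (rule manifold_cover[OF M x])
  note ch = manifold_chart[OF M c(1)]
  obtain R where R: "R > 0" "cball (\<phi> x) R \<subseteq> \<phi> ` U"
    using ch(2) c(2) by (meson imageI open_contains_cball)
  then have sub: "ball (\<phi> x) R \<subseteq> \<phi> ` U" using ball_subset_cball by blast
  have "continuous_map (top_of_set (\<phi> ` U)) (mtop M) (inv_into U \<phi>)"
    using chart_inv_continuous[OF ch(1,3)] by (simp add: continuous_map_in_subtopology)
  moreover have "compactin (top_of_set (\<phi> ` U)) (cball (\<phi> x) R)"
    using compact_cball_finite_dim[OF co, of "\<phi> x" R] R(2) by (simp add: compactin_subtopology)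
  ultimately have K: "compactin (mtop M) (inv_into U \<phi> ` cball (\<phi> x) R)"
    by (rule image_compactin[rotated])
  have N: "inv_into U \<phi> ` ball (\<phi> x) R = {y \<in> U. \<phi> y \<in> ball (\<phi> x) R}"
    by (rule manifold_chart_image[OF M c(1) sub])
  have "openin (mtop M) (inv_into U \<phi> ` ball (\<phi> x) R)"
    unfolding N by (rule chart_openin_preimage[OF ch(1,3)]) simp
  moreover have "x \<in> inv_into U \<phi> ` ball (\<phi> x) R" unfolding N using c(2) R(1) by simp
  moreover have "inv_into U \<phi> ` ball (\<phi> x) R \<subseteq> inv_into U \<phi> ` cball (\<phi> x) R"
    by (intro image_mono ball_subset_cball)
  ultimately show thesis using K by (rule that)
qed

lemma points_open_submanifold: "W \<subseteq> points M \<Longrightarrow> points (open_submanifold M W) = W"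
  by (simp add: open_submanifold_def inf.absorb2)

lemma (in group_action) orbit_eq_iff:
  assumes x: "x \<in> E" and y: "y \<in> E"
  shows "orbit G \<phi> x = orbit G \<phi> y \<longleftrightarrow> (\<exists>g\<in>carrier G. \<phi> g x = y)"
proof
  assume "orbit G \<phi> x = orbit G \<phi> y"
  then have "y \<in> orbit G \<phi> x" using orbit_refl[OF y] by simp
  then show "\<exists>g\<in>carrier G. \<phi> g x = y" by (auto simp: orbit_def)
next
  assume "\<exists>g\<in>carrier G. \<phi> g x = y"
  then have yx: "y \<in> orbit G \<phi> x" by (auto simp: orbit_def)
  have in_E: "w \<in> E" if "w \<in> orbit G \<phi> v" "v \<in> E" for v w
    using that element_image by (auto simp: orbit_def)
  show "orbit G \<phi> x = orbit G \<phi> y"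
  proof (intro equalityI subsetI)
    fix w assume w: "w \<in> orbit G \<phi> x"
    show "w \<in> orbit G \<phi> y"
      by (rule orbit_trans[OF y x in_E[OF w x] orbit_sym[OF x y yx] w])
  next
    fix w assume w: "w \<in> orbit G \<phi> y"
    show "w \<in> orbit G \<phi> x"
      by (rule orbit_trans[OF x y in_E[OF w y] yx w])
  qed
qed

section \<open>The covering and holonomy actions\<close>

locale suspension =
  fixes B :: "('b, 'd::real_normed_vector) mfd"
    and Bt :: "('c, 'd) mfd"
    and F :: "('f, 'e::real_normed_vector) mfd"
    and p :: "'c \<Rightarrow> 'b"
    and h :: "('c \<Rightarrow> 'c) \<Rightarrow> ('f \<Rightarrow> 'f)"
    and n q :: nat
  assumes B: "smooth_manifold n B" and compact_B: "compact_space (mtop B)"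
    and B_nonempty: "points B \<noteq> {}"
    and Bt: "smooth_manifold n Bt" and covering: "universal_covering Bt B p"
    and F: "smooth_manifold q F" and compact_F: "compact_space (mtop F)"
    and hom: "h \<in> hom (deck_group Bt p) (diff_group F)"
begin

abbreviation \<Gamma> :: "('c \<Rightarrow> 'c) monoid" where "\<Gamma> \<equiv> deck_group Bt p"
abbreviation N :: "('c \<times> 'f, 'd \<times> 'e) mfd" where "N \<equiv> prod_manifold Bt F"
abbreviation act :: "('c \<Rightarrow> 'c) \<Rightarrow> 'c \<times> 'f \<Rightarrow> 'c \<times> 'f" where "act \<equiv> suspension_action Bt F h"
abbreviation proj :: "'c \<times> 'f \<Rightarrow> ('c \<times> 'f) set" where "proj \<equiv> orbit \<Gamma> act"
abbreviation M :: "(('c \<times> 'f) set, 'd \<times> 'e) mfd" where "M \<equiv> suspension_manifold Bt p F h"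

lemma mtop_N: "mtop N = prod_topology (mtop Bt) (mtop F)"
  by (simp add: prod_manifold_def)

lemma points_N: "points N = points Bt \<times> points F"
  by (simp add: mtop_N)

lemma smooth_cover: "smooth_covering Bt B p" and simply_connected: "simply_connected_space (mtop Bt)"
  using covering by (auto simp: universal_covering_def)

lemma p_continuous: "continuous_map (mtop Bt) (mtop B) p" and p_surj: "p ` points Bt = points B"
  using smooth_cover by (auto simp: smooth_covering_def smooth_map_def)

text \<open>
  Only the sheet through a given point is kept from the family of disjoint sheets.
\<close>

lemma evenly_covered:
  assumes "b \<in> points B"
  obtains V where "openin (mtop B) V" "b \<in> V"
    "\<forall>x\<in>points Bt. p x \<in> V \<longrightarrow> (\<exists>U. openin (mtop Bt) U \<and> x \<in> U \<and>
        diffeomorphism (open_submanifold Bt U) (open_submanifold B V) p)"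
proof -
  have "\<forall>y \<in> points B. \<exists>V. openin (mtop B) V \<and> y \<in> V \<and>
        (\<exists>\<U>. (\<forall>U\<in>\<U>. openin (mtop Bt) U) \<and> pairwise disjnt \<U> \<and>
           \<Union>\<U> = {x \<in> points Bt. p x \<in> V} \<and>
           (\<forall>U\<in>\<U>. diffeomorphism (open_submanifold Bt U) (open_submanifold B V) p))"
    using smooth_cover unfolding smooth_covering_def by (elim conjE)
  from bspec[OF this assms] obtain V \<U> where V: "openin (mtop B) V" "b \<in> V" "\<forall>U\<in>\<U>. openin (mtop Bt) U"
    "\<Union>\<U> = {x \<in> points Bt. p x \<in> V}" "\<forall>U\<in>\<U>. diffeomorphism (open_submanifold Bt U) (open_submanifold B V) p"
    by (elim exE conjE)
  show thesis
  proof (rule that[OF V(1,2)], intro ballI impI)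
    fix x assume "x \<in> points Bt" "p x \<in> V"
    then have "x \<in> \<Union>\<U>" unfolding V(4) by simp
    then obtain U where "U \<in> \<U>" "x \<in> U" by blast
    then show "\<exists>U. openin (mtop Bt) U \<and> x \<in> U \<and> diffeomorphism (open_submanifold Bt U) (open_submanifold B V) p"
      using V(3,5) by (intro exI[of _ U]) simp
  qed
qed

lemma sheet:
  assumes V: "openin (mtop B) V" and U: "openin (mtop Bt) U"
    and d: "diffeomorphism (open_submanifold Bt U) (open_submanifold B V) p"
  shows "bij_betw p U V" "continuous_map (subtopology (mtop B) V) (subtopology (mtop Bt) U) (inv_into U p)"
    "smooth_map (open_submanifold Bt U) (open_submanifold B V) p"
    "smooth_map (open_submanifold B V) (open_submanifold Bt U) (inv_into U p)"
  using d openin_subset[OF U] openin_subset[OF V]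
  by (simp_all add: diffeomorphism_def points_open_submanifold smooth_map_def)
     (simp_all add: open_submanifold_def)

sublocale cover: sheeted_map "mtop Bt" "mtop B" p
proof
  show "Hausdorff_space (mtop Bt)" using Bt by (simp add: smooth_manifold_def)
next
  fix b assume "b \<in> points B"
  then obtain V where V: "openin (mtop B) V" "b \<in> V"
    "\<forall>x\<in>points Bt. p x \<in> V \<longrightarrow> (\<exists>U. openin (mtop Bt) U \<and> x \<in> U \<and>
        diffeomorphism (open_submanifold Bt U) (open_submanifold B V) p)"
    by (rule evenly_covered)
  show "\<exists>V. openin (mtop B) V \<and> b \<in> V \<and> (\<forall>y\<in>points Bt. p y \<in> V \<longrightarrow>
      (\<exists>U s. openin (mtop Bt) U \<and> y \<in> U \<and> p ` U \<subseteq> V \<and>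
          continuous_map (subtopology (mtop B) V) (mtop Bt) s \<and> s ` V \<subseteq> U \<and>
          (\<forall>v\<in>V. p (s v) = v) \<and> (\<forall>u\<in>U. s (p u) = u)))"
  proof (intro exI[of _ V] conjI V(1,2) ballI impI)
    fix y assume "y \<in> points Bt" "p y \<in> V"
    then obtain U where U: "openin (mtop Bt) U" "y \<in> U" "diffeomorphism (open_submanifold Bt U) (open_submanifold B V) p"
      using V(3) by auto
    note s = sheet[OF V(1) U(1,3)]
    show "\<exists>U s. openin (mtop Bt) U \<and> y \<in> U \<and> p ` U \<subseteq> V \<and>
          continuous_map (subtopology (mtop B) V) (mtop Bt) s \<and> s ` V \<subseteq> U \<and>
          (\<forall>v\<in>V. p (s v) = v) \<and> (\<forall>u\<in>U. s (p u) = u)"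
    proof (intro exI[of _ U] exI[of _ "inv_into U p"] conjI U(1,2))
      show "p ` U \<subseteq> V" using s(1) by (simp add: bij_betw_def)
      show "continuous_map (subtopology (mtop B) V) (mtop Bt) (inv_into U p)"
        using s(2) by (simp add: continuous_map_in_subtopology)
      show "inv_into U p ` V \<subseteq> U" using bij_betw_inv_into[OF s(1)] by (simp add: bij_betw_def)
      show "\<forall>v\<in>V. p (inv_into U p v) = v" using bij_betw_inv_into_right[OF s(1)] by blast
      show "\<forall>u\<in>U. inv_into U p (p u) = u" using bij_betw_inv_into_left[OF s(1)] by blast
    qed
  qed
qed (rule p_continuous)

lemma deck_iff:
  "\<gamma> \<in> carrier \<Gamma> \<longleftrightarrow> \<gamma> \<in> Bij (points Bt) \<and> homeomorphic_map (mtop Bt) (mtop Bt) \<gamma> \<and> (\<forall>x \<in> points Bt. p (\<gamma> x) = p x)"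
  by (simp add: deck_group_def)

lemma deckD:
  assumes "\<gamma> \<in> carrier \<Gamma>"
  shows "\<gamma> \<in> Bij (points Bt)" "continuous_map (mtop Bt) (mtop Bt) \<gamma>"
    "\<And>x. x \<in> points Bt \<Longrightarrow> p (\<gamma> x) = p x" "\<And>x. x \<in> points Bt \<Longrightarrow> \<gamma> x \<in> points Bt"
proof -
  show 1: "\<gamma> \<in> Bij (points Bt)" using assms by (simp add: deck_iff)
  show "continuous_map (mtop Bt) (mtop Bt) \<gamma>"
    using assms homeomorphic_imp_continuous_map by (auto simp: deck_iff)
  show "\<And>x. x \<in> points Bt \<Longrightarrow> p (\<gamma> x) = p x" using assms by (simp add: deck_iff)
  show "\<And>x. x \<in> points Bt \<Longrightarrow> \<gamma> x \<in> points Bt" using Bij_imp_funcset[OF 1] by blast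
qed

lemma deck_subgroup: "subgroup (carrier \<Gamma>) (BijGroup (points Bt))"
proof (rule group.subgroupI[OF group_BijGroup])
  have "(\<lambda>x\<in>points Bt. x) \<in> carrier \<Gamma>"
    unfolding deck_iff
  proof (intro conjI id_Bij)
    have "homeomorphic_map (mtop Bt) (mtop Bt) id" by simp
    then show "homeomorphic_map (mtop Bt) (mtop Bt) (\<lambda>x\<in>points Bt. x)"
      by (rule homeomorphic_map_eq) simp
  qed simp
  then show "carrier \<Gamma> \<noteq> {}" by blast
  show "carrier \<Gamma> \<subseteq> carrier (BijGroup (points Bt))"
    by (auto simp: deck_iff BijGroup_def)
next
  fix a assume a: "a \<in> carrier \<Gamma>"
  then have bij: "a \<in> Bij (points Bt)" by (rule deckD)
  then have bb: "bij_betw a (points Bt) (points Bt)" by (simp add: Bij_def)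
  let ?i = "\<lambda>x\<in>points Bt. inv_into (points Bt) a x"
  have "homeomorphic_map (mtop Bt) (mtop Bt) a" using a by (simp add: deck_iff)
  then obtain k where k: "homeomorphic_maps (mtop Bt) (mtop Bt) a k" using homeomorphic_map_maps by blast
  then have "homeomorphic_map (mtop Bt) (mtop Bt) k"
    using homeomorphic_maps_sym homeomorphic_maps_imp_map by blast
  then have "homeomorphic_map (mtop Bt) (mtop Bt) ?i"
  proof (rule homeomorphic_map_eq)
    fix x assume x: "x \<in> points Bt"
    then have "a (k x) = x" "k x \<in> points Bt"
      using k by (auto simp: homeomorphic_maps_def continuous_map_def)
    then have "inv_into (points Bt) a x = k x"
      using bb bij_betw_inv_into_left by metis
    then show "k x = ?i x" using x by simp
  qed
  moreover have "p (?i x) = p x" if x: "x \<in> points Bt" for x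
  proof -
    have "inv_into (points Bt) a x \<in> points Bt" using bb x by (meson bij_betwE bij_betw_inv_into)
    from deckD(3)[OF a this] show ?thesis using x bij_betw_inv_into_right[OF bb x] by simp
  qed
  ultimately have "?i \<in> carrier \<Gamma>"
    unfolding deck_iff using restrict_inv_into_Bij[OF bij] by blast
  then show "inv\<^bsub>BijGroup (points Bt)\<^esub> a \<in> carrier \<Gamma>" by (simp add: inv_BijGroup[OF bij])
next
  fix a b assume a: "a \<in> carrier \<Gamma>" and b: "b \<in> carrier \<Gamma>"
  have m: "a \<otimes>\<^bsub>BijGroup (points Bt)\<^esub> b = compose (points Bt) a b"
    using deckD(1)[OF a] deckD(1)[OF b] by (simp add: BijGroup_def)
  have "homeomorphic_map (mtop Bt) (mtop Bt) (a \<circ> b)"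
    using a b by (auto simp: deck_iff intro: homeomorphic_map_compose)
  then have "homeomorphic_map (mtop Bt) (mtop Bt) (compose (points Bt) a b)"
    by (rule homeomorphic_map_eq) (simp add: compose_def)
  then show "a \<otimes>\<^bsub>BijGroup (points Bt)\<^esub> b \<in> carrier \<Gamma>"
    unfolding m deck_iff using compose_Bij[OF deckD(1)[OF a] deckD(1)[OF b]] deckD[OF a] deckD[OF b]
    by (simp add: compose_def)
qed

lemma deck_group: "group \<Gamma>"
  using subgroup.subgroup_is_group[OF deck_subgroup group_BijGroup] by (simp add: deck_group_def)

lemma deck_mult:
  assumes "a \<in> carrier \<Gamma>" "b \<in> carrier \<Gamma>"
  shows "a \<otimes>\<^bsub>\<Gamma>\<^esub> b = compose (points Bt) a b"
  using deckD(1)[OF assms(1)] deckD(1)[OF assms(2)] by (simp add: deck_group_def BijGroup_def)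

lemma deck_one: "\<one>\<^bsub>\<Gamma>\<^esub> = (\<lambda>x\<in>points Bt. x)"
  by (simp add: deck_group_def BijGroup_def)

lemma h_diffeo:
  assumes "\<gamma> \<in> carrier \<Gamma>"
  shows "h \<gamma> \<in> Bij (points F)" "diffeomorphism F F (h \<gamma>)"
proof -
  have "h \<gamma> \<in> carrier (diff_group F)" using hom_in_carrier[OF hom assms] .
  then show "h \<gamma> \<in> Bij (points F)" "diffeomorphism F F (h \<gamma>)" by (simp_all add: diff_group_def)
qed

lemma h_continuous: "\<gamma> \<in> carrier \<Gamma> \<Longrightarrow> continuous_map (mtop F) (mtop F) (h \<gamma>)"
  using h_diffeo(2) by (simp add: diffeomorphism_def smooth_map_def)

lemma h_in: "\<gamma> \<in> carrier \<Gamma> \<Longrightarrow> z \<in> points F \<Longrightarrow> h \<gamma> z \<in> points F"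
  using Bij_imp_funcset[OF h_diffeo(1)] by blast

lemma h_mult:
  assumes "a \<in> carrier \<Gamma>" "b \<in> carrier \<Gamma>"
  shows "h (a \<otimes>\<^bsub>\<Gamma>\<^esub> b) = compose (points F) (h a) (h b)"
proof -
  have "h (a \<otimes>\<^bsub>\<Gamma>\<^esub> b) = h a \<otimes>\<^bsub>diff_group F\<^esub> h b" using hom assms by (simp add: hom_def)
  also have "\<dots> = compose (points F) (h a) (h b)"
    using h_diffeo(1)[OF assms(1)] h_diffeo(1)[OF assms(2)] by (simp add: diff_group_def BijGroup_def)
  finally show ?thesis .
qed

sublocale fibre_action: group_action \<Gamma> "points F" h
proof (rule group_action.intro)
  show "group_hom \<Gamma> (BijGroup (points F)) h"
    unfolding group_hom_def group_hom_axioms_def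
  proof (intro conjI deck_group group_BijGroup)
    show "h \<in> hom \<Gamma> (BijGroup (points F))"
      using h_mult h_diffeo(1) by (auto simp: hom_def BijGroup_def)
  qed
qed

lemma act_apply: "x \<in> points Bt \<Longrightarrow> z \<in> points F \<Longrightarrow> act \<gamma> (x, z) = (\<gamma> x, h \<gamma> z)"
  by (simp add: suspension_action_def)

lemma act_Bij:
  assumes \<gamma>: "\<gamma> \<in> carrier \<Gamma>"
  shows "act \<gamma> \<in> Bij (points N)"
proof -
  have 1: "bij_betw \<gamma> (points Bt) (points Bt)" "bij_betw (h \<gamma>) (points F) (points F)"
    using deckD(1)[OF \<gamma>] h_diffeo(1)[OF \<gamma>] by (auto simp: Bij_def)
  have "bij_betw (map_prod \<gamma> (h \<gamma>)) (points N) (points N)"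
    unfolding points_N by (rule bij_betw_map_prod[OF 1])
  then have "bij_betw (act \<gamma>) (points N) (points N)"
    by (rule bij_betw_cong[THEN iffD1, rotated]) (auto simp: points_N act_apply)
  then show ?thesis by (simp add: Bij_def points_N suspension_action_def)
qed

sublocale total_action: group_action \<Gamma> "points N" act
proof (rule group_action.intro)
  show "group_hom \<Gamma> (BijGroup (points N)) act"
    unfolding group_hom_def group_hom_axioms_def
  proof (intro conjI deck_group group_BijGroup)
    have "act (a \<otimes>\<^bsub>\<Gamma>\<^esub> b) = compose (points N) (act a) (act b)" if ab: "a \<in> carrier \<Gamma>" "b \<in> carrier \<Gamma>" for a b
    proof
      fix w
      show "act (a \<otimes>\<^bsub>\<Gamma>\<^esub> b) w = compose (points N) (act a) (act b) w"
      proof (cases "w \<in> points N")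
        case True
        then obtain x z where w: "w = (x, z)" "x \<in> points Bt" "z \<in> points F" by (auto simp: points_N)
        have 1: "(a \<otimes>\<^bsub>\<Gamma>\<^esub> b) x = a (b x)" using w by (simp add: deck_mult[OF ab] compose_def)
        have 2: "h (a \<otimes>\<^bsub>\<Gamma>\<^esub> b) z = h a (h b z)" using w by (simp add: h_mult[OF ab] compose_def)
        show ?thesis
          using True w deckD(4)[OF ab(2) w(2)] h_in[OF ab(2) w(3)]
          by (simp add: compose_def act_apply 1 2)
      next
        case False
        then show ?thesis by (auto simp: compose_def points_N suspension_action_def)
      qed
    qed
    then show "act \<in> hom \<Gamma> (BijGroup (points N))"
      using act_Bij by (auto simp: hom_def BijGroup_def)
  qed
qed

lemma act_continuous:
  assumes \<gamma>: "\<gamma> \<in> carrier \<Gamma>"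
  shows "continuous_map (mtop N) (mtop N) (act \<gamma>)"
proof -
  have "continuous_map (mtop N) (mtop N) (\<lambda>w. (\<gamma> (fst w), h \<gamma> (snd w)))"
    unfolding mtop_N continuous_map_pairwise
    using continuous_map_compose[OF continuous_map_fst[of "mtop Bt" "mtop F"] deckD(2)[OF \<gamma>]]
      continuous_map_compose[OF continuous_map_snd[of "mtop Bt" "mtop F"] h_continuous[OF \<gamma>]]
    by (simp add: comp_def)
  then show ?thesis
    by (rule continuous_map_eq) (auto simp: points_N act_apply)
qed

text \<open>
  A covering transformation and the identity are both lifts of \<open>p\<close>.
\<close>

lemma deck_eq_one:
  assumes \<gamma>: "\<gamma> \<in> carrier \<Gamma>" and x: "x \<in> points Bt" "\<gamma> x = x"
  shows "\<gamma> = \<one>\<^bsub>\<Gamma>\<^esub>"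
proof -
  have conn: "connected_space (mtop Bt)"
    using simply_connected path_connected_imp_connected_space by (auto simp: simply_connected_space_def)
  have "\<gamma> u = u" if "u \<in> points Bt" for u
    using cover.lift_unique[OF conn deckD(2)[OF \<gamma>] continuous_map_id[unfolded id_def], of x u]
      deckD(3)[OF \<gamma>] x that by auto
  then show ?thesis
    unfolding deck_one using Bij_imp_extensional[OF deckD(1)[OF \<gamma>]]
    by (intro extensionalityI[of _ "points Bt"]) auto
qed

section \<open>Charts of the suspension\<close>

lemma proj_eq_iff:
  "w \<in> points N \<Longrightarrow> w' \<in> points N \<Longrightarrow> proj w = proj w' \<longleftrightarrow> (\<exists>\<gamma>\<in>carrier \<Gamma>. act \<gamma> w = w')"
  by (rule total_action.orbit_eq_iff)

text \<open>
  If two points of \<open>W\<close> lie in one orbit, their base points have the same projection and coincide; the transformation relating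
  them has a fixed point, so it is the identity and acts trivially on the fibre as well.
\<close>

lemma proj_inj_on:
  assumes U: "inj_on p U" and W: "W \<subseteq> points N" "fst ` W \<subseteq> U"
  shows "inj_on proj W"
proof (rule inj_onI)
  fix w w' assume w: "w \<in> W" "w' \<in> W" and eq: "proj w = proj w'"
  have wN: "w \<in> points N" "w' \<in> points N" using w W by auto
  then obtain x z x' z' where xz: "w = (x, z)" "x \<in> points Bt" "z \<in> points F"
    "w' = (x', z')" "x' \<in> points Bt" "z' \<in> points F"
    unfolding points_N by blast
  obtain \<gamma> where \<gamma>: "\<gamma> \<in> carrier \<Gamma>" "act \<gamma> w = w'" using eq proj_eq_iff[OF wN] by blast
  then have g: "\<gamma> x = x'" "h \<gamma> z = z'" using xz by (auto simp: act_apply)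
  have "x \<in> U" "x' \<in> U" using w W(2) xz by auto
  moreover have "p x = p x'" using deckD(3)[OF \<gamma>(1) xz(2)] g(1) by simp
  ultimately have "x = x'" using U by (auto dest: inj_onD)
  then have "\<gamma> = \<one>\<^bsub>\<Gamma>\<^esub>" using deck_eq_one[OF \<gamma>(1) xz(2)] g(1) by simp
  then have "act \<gamma> w = w" using total_action.id_eq_one wN(1) by (metis restrict_apply')
  then show "w = w'" using \<gamma>(2) by simp
qed

lemma mtop_M: "mtop M = orbit_topology \<Gamma> (mtop N) act"
  by (simp add: suspension_manifold_def quotient_manifold_def)

lemma atlas_M: "atlas M = {(proj ` W, \<phi> \<circ> inv_into W proj) | W U \<phi>.
        (U, \<phi>) \<in> atlas N \<and> openin (mtop N) W \<and> W \<subseteq> U \<and> inj_on proj W}"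
  by (simp add: suspension_manifold_def quotient_manifold_def)

lemma points_M: "points M = proj ` points N"
  unfolding mtop_M topspace_orbit_topology by (auto simp: orbits_def)

lemma proj_continuous: "continuous_map (mtop N) (mtop M) proj"
  unfolding mtop_M by (rule quotient_imp_continuous_map[OF quotient_map_orbit])

text \<open>
  The saturation of an open set is the union of its preimages under the group elements.
\<close>

lemma proj_open:
  assumes W: "openin (mtop N) W"
  shows "openin (mtop M) (proj ` W)"
proof -
  have WN: "W \<subseteq> points N" by (rule openin_subset[OF W])
  have "{w \<in> points N. proj w \<in> proj ` W} = (\<Union>\<gamma>\<in>carrier \<Gamma>. {w \<in> points N. act \<gamma> w \<in> W})"
  proof (intro equalityI subsetI)
    fix w assume "w \<in> {w \<in> points N. proj w \<in> proj ` W}"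
    then obtain v where v: "w \<in> points N" "v \<in> W" "proj w = proj v" by blast
    then have "v \<in> points N" using WN by blast
    then obtain \<gamma> where "\<gamma> \<in> carrier \<Gamma>" "act \<gamma> w = v" using v proj_eq_iff by blast
    then show "w \<in> (\<Union>\<gamma>\<in>carrier \<Gamma>. {w \<in> points N. act \<gamma> w \<in> W})" using v by blast
  next
    fix w assume "w \<in> (\<Union>\<gamma>\<in>carrier \<Gamma>. {w \<in> points N. act \<gamma> w \<in> W})"
    then obtain \<gamma> where \<gamma>: "\<gamma> \<in> carrier \<Gamma>" "w \<in> points N" "act \<gamma> w \<in> W" by blast
    then have "proj w = proj (act \<gamma> w)" using proj_eq_iff[OF \<gamma>(2)] WN by blast
    then show "w \<in> {w \<in> points N. proj w \<in> proj ` W}" using \<gamma> by blast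
  qed
  moreover have "openin (mtop N) (\<Union>\<gamma>\<in>carrier \<Gamma>. {w \<in> points N. act \<gamma> w \<in> W})"
    using openin_continuous_map_preimage[OF act_continuous W] by (intro openin_Union) auto
  moreover have "proj ` W \<subseteq> orbits \<Gamma> (points N) act" using WN by (auto simp: orbits_def)
  ultimately show ?thesis unfolding mtop_M openin_orbit_topology by simp
qed

lemma atlas_N: "(U, \<phi>) \<in> atlas N \<longleftrightarrow>
  (\<exists>Ua a Ub b. U = Ua \<times> Ub \<and> \<phi> = map_prod a b \<and> (Ua, a) \<in> atlas Bt \<and> (Ub, b) \<in> atlas F)"
  by (auto simp: prod_manifold_def)

lemma chart_N:
  assumes a: "(Ua, a) \<in> atlas Bt" and b: "(Ub, b) \<in> atlas F"
  shows "openin (mtop N) (Ua \<times> Ub)" "open (map_prod a b ` (Ua \<times> Ub))"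
    "homeomorphic_map (subtopology (mtop N) (Ua \<times> Ub)) (top_of_set (map_prod a b ` (Ua \<times> Ub))) (map_prod a b)"
proof -
  note A = manifold_chart[OF Bt a] and Bb = manifold_chart[OF F b]
  have im: "map_prod a b ` (Ua \<times> Ub) = a ` Ua \<times> b ` Ub" by force
  show "openin (mtop N) (Ua \<times> Ub)" unfolding mtop_N using A Bb by (simp add: openin_prod_Times_iff)
  show "open (map_prod a b ` (Ua \<times> Ub))" unfolding im using A Bb by (simp add: open_Times)
  obtain a' b' where ab: "homeomorphic_maps (subtopology (mtop Bt) Ua) (top_of_set (a ` Ua)) a a'"
     "homeomorphic_maps (subtopology (mtop F) Ub) (top_of_set (b ` Ub)) b b'"
    using A(3) Bb(3) homeomorphic_map_maps by metis
  have "homeomorphic_maps (prod_topology (subtopology (mtop Bt) Ua) (subtopology (mtop F) Ub))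
      (prod_topology (top_of_set (a ` Ua)) (top_of_set (b ` Ub)))
      (\<lambda>(x, y). (a x, b y)) (\<lambda>(x, y). (a' x, b' y))"
    unfolding homeomorphic_maps_prod using ab by blast
  moreover have "(\<lambda>(x, y). (a x, b y)) = map_prod a b" by (auto simp: fun_eq_iff)
  ultimately have "homeomorphic_maps (subtopology (mtop N) (Ua \<times> Ub)) (top_of_set (a ` Ua \<times> b ` Ub))
      (map_prod a b) (\<lambda>(x, y). (a' x, b' y))"
    by (simp add: mtop_N subtopology_Times)
  then show "homeomorphic_map (subtopology (mtop N) (Ua \<times> Ub)) (top_of_set (map_prod a b ` (Ua \<times> Ub))) (map_prod a b)"
    unfolding im by (rule homeomorphic_maps_imp_map)
qed

lemma chart_M:
  assumes "(Q, \<kappa>) \<in> atlas M"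
  obtains W Ua a Ub b where "Q = proj ` W" "\<kappa> = map_prod a b \<circ> inv_into W proj"
    "(Ua, a) \<in> atlas Bt" "(Ub, b) \<in> atlas F" "openin (mtop N) W" "W \<subseteq> Ua \<times> Ub" "inj_on proj W"
  using assms unfolding atlas_M atlas_N by blast

lemma chart_M_apply:
  assumes "inj_on proj W" "w \<in> W"
  shows "(\<phi> \<circ> inv_into W proj) (proj w) = \<phi> w"
  using assms by simp

lemma chart_M_homeo:
  assumes c: "(Q, \<kappa>) \<in> atlas M"
  shows "openin (mtop M) Q" "open (\<kappa> ` Q)" "homeomorphic_map (subtopology (mtop M) Q) (top_of_set (\<kappa> ` Q)) \<kappa>"
proof -
  obtain W Ua a Ub b where W: "Q = proj ` W" "\<kappa> = map_prod a b \<circ> inv_into W proj"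
    "(Ua, a) \<in> atlas Bt" "(Ub, b) \<in> atlas F" "openin (mtop N) W" "W \<subseteq> Ua \<times> Ub" "inj_on proj W"
    by (rule chart_M[OF c])
  note ch = chart_N[OF W(3,4)]
  have WN: "W \<subseteq> points N" by (rule openin_subset[OF W(5)])
  show o: "openin (mtop M) Q" unfolding W(1) by (rule proj_open[OF W(5)])
  have im: "\<kappa> ` Q = map_prod a b ` W"
    unfolding W(1,2) image_comp using W(7) by (intro image_cong) simp_all
  show "open (\<kappa> ` Q)"
    unfolding im by (rule chart_open_image[OF ch(1,3,2) W(5,6)])
  have "homeomorphic_map (subtopology (mtop N) W) (subtopology (mtop M) Q) proj"
  proof (rule bijective_open_imp_homeomorphic_map)
    show "continuous_map (subtopology (mtop N) W) (subtopology (mtop M) Q) proj"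
      unfolding W(1) using proj_continuous by (auto simp: continuous_map_in_subtopology continuous_map_from_subtopology)
    show "open_map (subtopology (mtop N) W) (subtopology (mtop M) Q) proj"
      unfolding open_map_def
    proof (intro allI impI)
      fix T assume "openin (subtopology (mtop N) W) T"
      then have T: "openin (mtop N) T" "T \<subseteq> W" using openin_open_subtopology[OF W(5)] by auto
      then have "openin (mtop M) (proj ` T)" "proj ` T \<subseteq> Q" unfolding W(1) using proj_open by auto
      then show "openin (subtopology (mtop M) Q) (proj ` T)" using openin_open_subtopology[OF o] by blast
    qed
    show "proj ` topspace (subtopology (mtop N) W) = topspace (subtopology (mtop M) Q)"
      using WN openin_subset[OF o] by (simp add: inf.absorb2 W(1))
    show "inj_on proj (topspace (subtopology (mtop N) W))" using W(7) WN by (simp add: inf.absorb2)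
  qed
  then obtain k where k: "homeomorphic_maps (subtopology (mtop N) W) (subtopology (mtop M) Q) proj k"
    using homeomorphic_map_maps by blast
  have "homeomorphic_map (subtopology (mtop M) Q) (subtopology (mtop N) W) k"
    using k homeomorphic_maps_sym homeomorphic_maps_imp_map by blast
  then have "homeomorphic_map (subtopology (mtop M) Q) (subtopology (mtop N) W) (inv_into W proj)"
  proof (rule homeomorphic_map_eq)
    fix m assume "m \<in> topspace (subtopology (mtop M) Q)"
    then obtain w where w: "w \<in> W" "m = proj w" unfolding W(1) by auto
    have "k (proj w) = w" using k w(1) WN by (auto simp: homeomorphic_maps_def)
    then show "k m = inv_into W proj m" using w W(7) by simp
  qed
  moreover have "homeomorphic_map (subtopology (mtop N) W) (top_of_set (map_prod a b ` W)) (map_prod a b)"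
  proof -
    have "homeomorphic_map (subtopology (subtopology (mtop N) (Ua \<times> Ub)) W)
        (subtopology (top_of_set (map_prod a b ` (Ua \<times> Ub))) (map_prod a b ` W)) (map_prod a b)"
    proof (rule homeomorphic_map_subtopologies[OF ch(3)])
      show "map_prod a b ` (topspace (subtopology (mtop N) (Ua \<times> Ub)) \<inter> W) =
          topspace (top_of_set (map_prod a b ` (Ua \<times> Ub))) \<inter> map_prod a b ` W"
        using W(6) openin_subset[OF ch(1)] WN by (auto simp: inf.absorb2)
    qed
    moreover have "Ua \<times> Ub \<inter> W = W" "map_prod a b ` (Ua \<times> Ub) \<inter> map_prod a b ` W = map_prod a b ` W"
      using W(6) by blast+
    ultimately show ?thesis by (simp add: subtopology_subtopology)
  qed
  ultimately show "homeomorphic_map (subtopology (mtop M) Q) (top_of_set (\<kappa> ` Q)) \<kappa>"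
    unfolding im unfolding W(2) by (rule homeomorphic_map_compose)
qed

text \<open>
  A product chart becomes a chart of the quotient after its base factor is shrunk to a sheet of the covering.
\<close>

lemma chart_M_exists:
  assumes a: "(Ua, a) \<in> atlas Bt" "x \<in> Ua" and b: "(Ub, b) \<in> atlas F" "z \<in> Ub"
  obtains W where "(proj ` W, map_prod a b \<circ> inv_into W proj) \<in> atlas M" "openin (mtop N) W"
    "(x, z) \<in> W" "W \<subseteq> Ua \<times> Ub" "inj_on proj W"
proof -
  note A = manifold_chart[OF Bt a(1)] and Bb = manifold_chart[OF F b(1)]
  have "x \<in> points Bt" using a(2) openin_subset[OF A(1)] by blast
  then obtain V U s where U: "openin (mtop Bt) U" "x \<in> U" "\<forall>u\<in>U. s (p u) = u"
    by (rule cover.local_section)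
  let ?W = "(Ua \<inter> U) \<times> Ub"
  have W: "openin (mtop N) ?W" unfolding mtop_N using A(1) Bb(1) U(1) by (simp add: openin_prod_Times_iff openin_Int)
  have "inj_on p U" using U(3) by (metis inj_onI)
  then have inj: "inj_on proj ?W" by (rule proj_inj_on[OF _ openin_subset[OF W]]) auto
  have "(Ua \<times> Ub, map_prod a b) \<in> atlas N" unfolding atlas_N using a(1) b(1) by blast
  then have "(proj ` ?W, map_prod a b \<circ> inv_into ?W proj) \<in> atlas M"
    unfolding atlas_M using W inj by blast
  then show thesis using W _ _ inj by (rule that) (use a b U in auto)
qed

section \<open>Coordinate changes of the suspension\<close>

text \<open>
  Near a point, a covering transformation is \<open>p\<close> followed by the local inverse of \<open>p\<close> through the image point.  In
  coordinates both are smooth, and a chart of the base serves as the intermediate space.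
\<close>

lemma deck_C1:
  assumes \<gamma>: "\<gamma> \<in> carrier \<Gamma>" and U: "(U, \<phi>) \<in> atlas Bt" and V: "(V, \<psi>) \<in> atlas Bt"
  shows "C1_on (\<phi> ` {x \<in> U. \<gamma> x \<in> V}) (\<psi> \<circ> \<gamma> \<circ> inv_into U \<phi>)"
proof (rule C1_on_local)
  fix y assume "y \<in> \<phi> ` {x \<in> U. \<gamma> x \<in> V}"
  then obtain x where x: "y = \<phi> x" "x \<in> U" "\<gamma> x \<in> V" by blast
  note chU = manifold_chart[OF Bt U] and chV = manifold_chart[OF Bt V]
  note invU = inv_into_f_f[OF chart_inj[OF chU(1,3)]]
  have UBt: "U \<subseteq> points Bt" by (rule openin_subset[OF chU(1)])
  have xBt: "x \<in> points Bt" using x(2) UBt by blast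
  obtain S where S: "openin (mtop B) S" "p x \<in> S"
    "\<forall>x\<in>points Bt. p x \<in> S \<longrightarrow> (\<exists>U. openin (mtop Bt) U \<and> x \<in> U \<and>
        diffeomorphism (open_submanifold Bt U) (open_submanifold B S) p)"
    by (rule evenly_covered[OF cover.in_base[OF xBt]])
  obtain E where E: "openin (mtop Bt) E" "x \<in> E" "diffeomorphism (open_submanifold Bt E) (open_submanifold B S) p"
    using S(3)[rule_format, OF xBt S(2)] by (elim exE conjE)
  have pgx: "p (\<gamma> x) \<in> S" using S(2) deckD(3)[OF \<gamma> xBt] by simp
  obtain E' where E': "openin (mtop Bt) E'" "\<gamma> x \<in> E'" "diffeomorphism (open_submanifold Bt E') (open_submanifold B S) p"
    using S(3)[rule_format, OF deckD(4)[OF \<gamma> xBt] pgx] by (elim exE conjE)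
  obtain Q \<kappa> where Q: "(Q, \<kappa>) \<in> atlas B" "p x \<in> Q" by (rule manifold_cover[OF B cover.in_base[OF xBt]])
  note chQ = manifold_chart[OF B Q(1)]
  note sE = sheet[OF S(1) E(1,3)] and sE' = sheet[OF S(1) E'(1,3)]
  let ?s = "inv_into E' p"
  have atl: "(U \<inter> E, \<phi>) \<in> atlas (open_submanifold Bt E)" "(V \<inter> E', \<psi>) \<in> atlas (open_submanifold Bt E')"
    "(Q \<inter> S, \<kappa>) \<in> atlas (open_submanifold B S)"
    using U V Q(1) unfolding open_submanifold_def by force+
  have f: "C1_on (\<phi> ` {u \<in> U \<inter> E. p u \<in> Q \<inter> S}) (\<kappa> \<circ> p \<circ> inv_into (U \<inter> E) \<phi>)"
    using bspec[OF bspec[OF conjunct2[OF sE(3)[unfolded smooth_map_def]] atl(1), unfolded prod.case] atl(3)]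
    by (intro smooth_on_C1) simp
  have g: "C1_on (\<kappa> ` {v \<in> Q \<inter> S. ?s v \<in> V \<inter> E'}) (\<psi> \<circ> ?s \<circ> inv_into (Q \<inter> S) \<kappa>)"
    using bspec[OF bspec[OF conjunct2[OF sE'(4)[unfolded smooth_map_def]] atl(3), unfolded prod.case] atl(2)]
    by (intro smooth_on_C1) simp
  obtain m r and e :: "nat \<Rightarrow> 'd" where co: "bounded_coordinates m e r" by (rule manifold_coordinates[OF B])
  let ?T0 = "U \<inter> E \<inter> {u \<in> points Bt. p u \<in> Q} \<inter> {u \<in> points Bt. \<gamma> u \<in> V \<inter> E'}"
  have T0: "openin (mtop Bt) ?T0"
    by (intro openin_Int chU(1) E(1) openin_continuous_map_preimage[OF p_continuous chQ(1)]
        openin_continuous_map_preimage[OF deckD(2)[OF \<gamma>]] chV(1) E'(1))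
  have T: "open (\<phi> ` ?T0)"
    by (rule chart_open_image[OF chU(1,3,2) T0]) blast
  have pE: "p u \<in> S" if "u \<in> E" for u using that sE(1) by (auto simp: bij_betw_def)
  have s: "?s (p u) = \<gamma> u" if u: "u \<in> ?T0" for u
  proof -
    have "?s (p (\<gamma> u)) = \<gamma> u" using bij_betw_inv_into_left[OF sE'(1)] u by simp
    then show ?thesis using deckD(3)[OF \<gamma>, of u] u by simp
  qed
  have injQS: "inj_on \<kappa> (Q \<inter> S)" and injUE: "inj_on \<phi> (U \<inter> E)"
    using chart_inj[OF chQ(1,3)] chart_inj[OF chU(1,3)] by (auto intro: inj_on_subset)
  have ft: "(\<kappa> \<circ> p \<circ> inv_into (U \<inter> E) \<phi>) (\<phi> u) = \<kappa> (p u)" if "u \<in> ?T0" for u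
    using that by (simp add: inv_into_f_f[OF injUE])
  have "C1_on (\<phi> ` ?T0) ((\<psi> \<circ> ?s \<circ> inv_into (Q \<inter> S) \<kappa>) \<circ> (\<kappa> \<circ> p \<circ> inv_into (U \<inter> E) \<phi>))"
  proof (rule C1_on_compose[OF co _ g])
    show "C1_on (\<phi> ` ?T0) (\<kappa> \<circ> p \<circ> inv_into (U \<inter> E) \<phi>)"
      by (rule C1_on_subset[OF f]) (use pE in auto)
    show "(\<kappa> \<circ> p \<circ> inv_into (U \<inter> E) \<phi>) ` \<phi> ` ?T0 \<subseteq> \<kappa> ` {v \<in> Q \<inter> S. ?s v \<in> V \<inter> E'}"
    proof (rule subsetI, elim imageE)
      fix y v u assume u: "u \<in> ?T0" and y: "y = (\<kappa> \<circ> p \<circ> inv_into (U \<inter> E) \<phi>) v" "v = \<phi> u"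
      have "y = \<kappa> (p u)" unfolding y using ft[OF u] .
      moreover have "p u \<in> {v \<in> Q \<inter> S. ?s v \<in> V \<inter> E'}" using s[OF u] u pE by simp
      ultimately show "y \<in> \<kappa> ` {v \<in> Q \<inter> S. ?s v \<in> V \<inter> E'}" by blast
    qed
  qed
  then have "C1_on (\<phi> ` ?T0) (\<psi> \<circ> \<gamma> \<circ> inv_into U \<phi>)"
  proof (rule C1_on_cong[OF _ T])
    fix v assume "v \<in> \<phi> ` ?T0"
    then obtain u where u: "u \<in> ?T0" "v = \<phi> u" by blast
    have "((\<psi> \<circ> ?s \<circ> inv_into (Q \<inter> S) \<kappa>) \<circ> (\<kappa> \<circ> p \<circ> inv_into (U \<inter> E) \<phi>)) v = (\<psi> \<circ> ?s \<circ> inv_into (Q \<inter> S) \<kappa>) (\<kappa> (p u))"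
      unfolding u(2) using ft[OF u(1)] by simp
    also have "\<dots> = \<psi> (?s (p u))" using u(1) pE by (simp add: inv_into_f_f[OF injQS])
    also have "\<dots> = \<psi> (\<gamma> u)" using s[OF u(1)] by simp
    also have "\<dots> = (\<psi> \<circ> \<gamma> \<circ> inv_into U \<phi>) v" unfolding u(2) using u(1) invU by simp
    finally show "((\<psi> \<circ> ?s \<circ> inv_into (Q \<inter> S) \<kappa>) \<circ> (\<kappa> \<circ> p \<circ> inv_into (U \<inter> E) \<phi>)) v =
        (\<psi> \<circ> \<gamma> \<circ> inv_into U \<phi>) v" .
  qed
  moreover have "y \<in> \<phi> ` ?T0"
    unfolding x(1) using x E(2) E'(2) Q(2) xBt by (intro imageI) simp
  ultimately show "\<exists>T. open T \<and> y \<in> T \<and> C1_on T (\<psi> \<circ> \<gamma> \<circ> inv_into U \<phi>)"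
    using T by blast
qed

lemma h_C1:
  assumes \<gamma>: "\<gamma> \<in> carrier \<Gamma>" and U: "(U, \<phi>) \<in> atlas F" and V: "(V, \<psi>) \<in> atlas F"
  shows "C1_on (\<phi> ` {x \<in> U. h \<gamma> x \<in> V}) (\<psi> \<circ> h \<gamma> \<circ> inv_into U \<phi>)"
proof -
  have "smooth_map F F (h \<gamma>)" using h_diffeo(2)[OF \<gamma>] by (simp add: diffeomorphism_def)
  from bspec[OF bspec[OF conjunct2[OF this[unfolded smooth_map_def]] U, unfolded prod.case] V]
  show ?thesis by (intro smooth_on_C1) simp
qed

text \<open>
  Representatives of one point in two charts differ by some \<open>\<gamma>\<close>, and the same \<open>\<gamma>\<close> serves for all
  nearby points, since both representatives move inside open sets on which the projection is injective.
\<close>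

lemma transition_M:
  assumes c1: "(Q1, \<kappa>1) \<in> atlas M" and c2: "(Q2, \<kappa>2) \<in> atlas M"
  shows "C1_on (\<kappa>1 ` (Q1 \<inter> Q2)) (\<kappa>2 \<circ> inv_into Q1 \<kappa>1)"
proof (rule C1_on_local)
  obtain W1 Ua1 a1 Ub1 b1 where W1: "Q1 = proj ` W1" "\<kappa>1 = map_prod a1 b1 \<circ> inv_into W1 proj"
    "(Ua1, a1) \<in> atlas Bt" "(Ub1, b1) \<in> atlas F" "openin (mtop N) W1" "W1 \<subseteq> Ua1 \<times> Ub1" "inj_on proj W1"
    by (rule chart_M[OF c1])
  obtain W2 Ua2 a2 Ub2 b2 where W2: "Q2 = proj ` W2" "\<kappa>2 = map_prod a2 b2 \<circ> inv_into W2 proj"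
    "(Ua2, a2) \<in> atlas Bt" "(Ub2, b2) \<in> atlas F" "openin (mtop N) W2" "W2 \<subseteq> Ua2 \<times> Ub2" "inj_on proj W2"
    by (rule chart_M[OF c2])
  note A1 = manifold_chart[OF Bt W1(3)] and B1 = manifold_chart[OF F W1(4)]
  note inva = inv_into_f_f[OF chart_inj[OF A1(1,3)]] and invb = inv_into_f_f[OF chart_inj[OF B1(1,3)]]
  have W1N: "W1 \<subseteq> points N" and W2N: "W2 \<subseteq> points N"
    using openin_subset[OF W1(5)] openin_subset[OF W2(5)] .
  fix y assume "y \<in> \<kappa>1 ` (Q1 \<inter> Q2)"
  then obtain w1 w2 where w: "w1 \<in> W1" "w2 \<in> W2" "proj w1 = proj w2" "y = \<kappa>1 (proj w1)"
    unfolding W1(1) W2(1) by blast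
  have "w1 \<in> points N" "w2 \<in> points N" using w W1N W2N by blast+
  then obtain \<gamma> where \<gamma>: "\<gamma> \<in> carrier \<Gamma>" "act \<gamma> w1 = w2" using w(3) proj_eq_iff by blast
  let ?T0 = "W1 \<inter> {w \<in> points N. act \<gamma> w \<in> W2}" and ?A = "map_prod a1 b1"
  have T0: "openin (mtop N) ?T0"
    by (intro openin_Int W1(5) openin_continuous_map_preimage[OF act_continuous[OF \<gamma>(1)] W2(5)])
  note ch1 = chart_N[OF W1(3,4)]
  have T: "open (?A ` ?T0)" by (rule chart_open_image[OF ch1(1,3,2) T0]) (use W1(6) in blast)
  let ?S = "(a1 ` {x \<in> Ua1. \<gamma> x \<in> Ua2}) \<times> (b1 ` {z \<in> Ub1. h \<gamma> z \<in> Ub2})"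
  let ?f = "map_prod (a2 \<circ> \<gamma> \<circ> inv_into Ua1 a1) (b2 \<circ> h \<gamma> \<circ> inv_into Ub1 b1)"
  have pts: "\<exists>x z. w = (x, z) \<and> x \<in> Ua1 \<and> z \<in> Ub1 \<and> \<gamma> x \<in> Ua2 \<and> h \<gamma> z \<in> Ub2 \<and> act \<gamma> w = (\<gamma> x, h \<gamma> z)"
    if wT: "w \<in> ?T0" for w
  proof -
    obtain x z where xz: "w = (x, z)" by (cases w)
    have "x \<in> points Bt" "z \<in> points F" using wT xz by (auto simp: points_N)
    then have "act \<gamma> w = (\<gamma> x, h \<gamma> z)" unfolding xz by (rule act_apply)
    moreover have "act \<gamma> w \<in> Ua2 \<times> Ub2" using wT W2(6) by blast
    moreover have "w \<in> Ua1 \<times> Ub1" using wT W1(6) by blast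
    ultimately show ?thesis using xz by simp
  qed
  have "C1_on ?S ?f" by (rule C1_on_map_prod[OF deck_C1[OF \<gamma>(1) W1(3) W2(3)] h_C1[OF \<gamma>(1) W1(4) W2(4)]])
  then have "C1_on (?A ` ?T0) ?f"
  proof (rule C1_on_subset)
    show "?A ` ?T0 \<subseteq> ?S"
    proof (rule image_subsetI)
      fix w assume "w \<in> ?T0"
      from pts[OF this] show "?A w \<in> ?S" by auto
    qed
  qed
  then have "C1_on (?A ` ?T0) (\<kappa>2 \<circ> inv_into Q1 \<kappa>1)"
  proof (rule C1_on_cong[OF _ T])
    fix v assume "v \<in> ?A ` ?T0"
    then obtain w where "v = ?A w" "w \<in> ?T0" by (rule imageE)
    then have wT: "w \<in> ?T0" "v = ?A w" by simp_all
    from pts[OF wT(1)] obtain x z where xz: "w = (x, z)" "x \<in> Ua1" "z \<in> Ub1" "act \<gamma> w = (\<gamma> x, h \<gamma> z)"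
      by (elim exE conjE)
    have ww: "w \<in> W1" "w \<in> points N" "act \<gamma> w \<in> W2" using wT(1) by simp_all
    have "\<kappa>1 (proj w) = v" unfolding W1(2) wT(2) by (rule chart_M_apply[OF W1(7) ww(1)])
    moreover have "proj w \<in> Q1" unfolding W1(1) using ww(1) by (rule imageI)
    ultimately have "inv_into Q1 \<kappa>1 v = proj w"
      using inv_into_f_f[OF chart_inj[OF chart_M_homeo(1,3)[OF c1]], of "proj w"] by simp
    moreover have "proj w = proj (act \<gamma> w)"
    proof -
      have "act \<gamma> w \<in> points N" using ww(3) W2N by (rule subsetD[rotated])
      then show ?thesis using proj_eq_iff[OF ww(2)] \<gamma>(1) by simp blast
    qed
    moreover have "\<kappa>2 (proj (act \<gamma> w)) = map_prod a2 b2 (act \<gamma> w)"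
      unfolding W2(2) by (rule chart_M_apply[OF W2(7) ww(3)])
    ultimately have "(\<kappa>2 \<circ> inv_into Q1 \<kappa>1) v = map_prod a2 b2 (act \<gamma> w)" by simp
    also have "\<dots> = ?f v" unfolding xz(4) wT(2) unfolding xz(1) using xz(2,3) inva invb by simp
    finally show "?f v = (\<kappa>2 \<circ> inv_into Q1 \<kappa>1) v" by simp
  qed
  moreover have "y \<in> ?A ` ?T0"
  proof -
    have "y = ?A w1" unfolding w(4) W1(2) by (rule chart_M_apply[OF W1(7) w(1)])
    moreover have "w1 \<in> ?T0" using w(1,2) \<gamma>(2) W1N by blast
    ultimately show ?thesis by blast
  qed
  ultimately show "\<exists>T. open T \<and> y \<in> T \<and> C1_on T (\<kappa>2 \<circ> inv_into Q1 \<kappa>1)" using T by blast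
qed

lemma M_C1_riemannian:
  assumes g: "riemannian_metric M g" and co: "bounded_coordinates m e r"
  shows "C1_riemannian M g m e r"
proof
  fix o' assume "o' \<in> points M"
  then obtain x z where xz: "o' = proj (x, z)" "x \<in> points Bt" "z \<in> points F"
    unfolding points_M points_N by blast
  obtain Ua a where a: "(Ua, a) \<in> atlas Bt" "x \<in> Ua" by (rule manifold_cover[OF Bt xz(2)])
  obtain Ub b where b: "(Ub, b) \<in> atlas F" "z \<in> Ub" by (rule manifold_cover[OF F xz(3)])
  obtain W where "(proj ` W, map_prod a b \<circ> inv_into W proj) \<in> atlas M" "(x, z) \<in> W"
    by (rule chart_M_exists[OF a b])
  then show "\<exists>(U, \<phi>)\<in>atlas M. o' \<in> U" unfolding xz(1) by blast
qed (use assms chart_M_homeo transition_M in blast)+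

section \<open>Compactness of the suspension\<close>

lemma deck_transitive:
  assumes "x \<in> points Bt" "y \<in> points Bt" "p x = p y"
  obtains \<gamma> where "\<gamma> \<in> carrier \<Gamma>" "\<gamma> x = y"
proof -
  obtain f where f: "homeomorphic_map (mtop Bt) (mtop Bt) f" "\<And>u. u \<in> points Bt \<Longrightarrow> p (f u) = p u" "f x = y"
    using cover.deck_transitive[OF simply_connected manifold_locally_path_connected[OF Bt] assms] by metis
  let ?\<gamma> = "restrict f (points Bt)"
  have h: "homeomorphic_map (mtop Bt) (mtop Bt) ?\<gamma>"
    by (rule homeomorphic_map_eq[OF f(1)]) simp
  have "bij_betw ?\<gamma> (points Bt) (points Bt)"
    using homeomorphic_imp_injective_map[OF h] homeomorphic_imp_surjective_map[OF h] by (simp add: bij_betw_def)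
  then have "?\<gamma> \<in> Bij (points Bt)" by (simp add: Bij_def)
  then have "?\<gamma> \<in> carrier \<Gamma>" unfolding deck_iff using h f(2) by simp
  moreover have "?\<gamma> x = y" using f(3) assms(1) by simp
  ultimately show thesis by (rule that)
qed

text \<open>
  Finitely many compact coordinate balls of the universal covering project onto the base.  Their union \<open>K\<close> meets every fibre of \<open>p\<close>,
  and by transitivity every point of \<open>M\<close> has a representative over \<open>K\<close>.
\<close>

lemma compact_M: "compact_space (mtop M)"
proof -
  have "\<exists>N K. openin (mtop Bt) N \<and> x \<in> N \<and> N \<subseteq> K \<and> compactin (mtop Bt) K" if "x \<in> points Bt" for x
    by (rule manifold_compact_neighbourhood[OF Bt that]) blast
  then obtain V K where VK: "\<And>x. x \<in> points Bt \<Longrightarrow> openin (mtop Bt) (V x) \<and> x \<in> V x \<and> V x \<subseteq> K x \<and> compactin (mtop Bt) (K x)"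
    by metis
  have op: "openin (mtop B) (p ` V x)" if "x \<in> points Bt" for x
    using cover.open_map VK[OF that] unfolding open_map_def by blast
  have "points B \<subseteq> \<Union> ((\<lambda>x. p ` V x) ` points Bt)"
  proof
    fix b assume "b \<in> points B"
    then have "b \<in> p ` points Bt" unfolding p_surj .
    then obtain x where x: "b = p x" "x \<in> points Bt" by (rule imageE)
    then have "x \<in> V x" using VK[OF x(2)] by simp
    then show "b \<in> \<Union> ((\<lambda>x. p ` V x) ` points Bt)" using x by auto
  qed
  moreover have "\<forall>U\<in>(\<lambda>x. p ` V x) ` points Bt. openin (mtop B) U" using op by simp
  ultimately have "\<exists>\<F>. finite \<F> \<and> \<F> \<subseteq> (\<lambda>x. p ` V x) ` points Bt \<and> points B \<subseteq> \<Union>\<F>"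
    using compact_B[unfolded compact_space_alt, rule_format, of "(\<lambda>x. p ` V x) ` points Bt"] by simp
  then obtain T where T: "finite T" "T \<subseteq> points Bt" "points B \<subseteq> (\<Union>x\<in>T. p ` V x)"
    by (metis finite_subset_image)
  let ?K = "\<Union>x\<in>T. K x"
  have K: "compactin (mtop Bt) ?K"
    using T(1,2) VK by (intro compactin_Union) auto
  then have KBt: "?K \<subseteq> points Bt" by (rule compactin_subset_topspace)
  have "compactin (mtop N) (?K \<times> points F)"
    unfolding mtop_N compactin_Times using K compact_F by (simp add: compact_space_def)
  then have "compactin (mtop M) (proj ` (?K \<times> points F))"
    using proj_continuous by (rule image_compactin)
  moreover have "proj ` (?K \<times> points F) = points M"
  proof
    show "proj ` (?K \<times> points F) \<subseteq> points M" unfolding points_M points_N using KBt by blast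
    show "points M \<subseteq> proj ` (?K \<times> points F)"
    proof
      fix o' assume "o' \<in> points M"
      then obtain x z where xz: "o' = proj (x, z)" "x \<in> points Bt" "z \<in> points F"
        unfolding points_M points_N by blast
      have "p x \<in> (\<Union>x\<in>T. p ` V x)" using T(3) cover.in_base[OF xz(2)] by blast
      then obtain t k where t: "t \<in> T" "k \<in> V t" "p x = p k" by blast
      then have k: "k \<in> ?K" using VK T(2) by blast
      then have kBt: "k \<in> points Bt" using KBt by blast
      obtain \<gamma> where \<gamma>: "\<gamma> \<in> carrier \<Gamma>" "\<gamma> x = k" by (rule deck_transitive[OF xz(2) kBt t(3)])
      have hz: "h \<gamma> z \<in> points F" by (rule h_in[OF \<gamma>(1) xz(3)])
      have "act \<gamma> (x, z) = (k, h \<gamma> z)" using act_apply[OF xz(2,3)] \<gamma>(2) by simp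
      then have "proj (x, z) = proj (k, h \<gamma> z)"
        using proj_eq_iff[of "(x, z)" "(k, h \<gamma> z)"] \<gamma>(1) xz kBt hz points_N by blast
      then show "o' \<in> proj ` (?K \<times> points F)" unfolding xz(1) using k hz by blast
    qed
  qed
  ultimately show ?thesis by (simp add: compact_space_def)
qed

end

section \<open>Leaves, orbits and their chain distances\<close>

context suspension
begin

definition leaf :: "'f \<Rightarrow> ('c \<times> 'f) set set" where
  "leaf z = proj ` (points Bt \<times> {z})"

abbreviation leaves :: "('c \<times> 'f) set set set" where
  "leaves \<equiv> suspension_leaves Bt p F h"

abbreviation holonomy :: "('f \<Rightarrow> 'f) monoid" where
  "holonomy \<equiv> (diff_group F)\<lparr>carrier := h ` carrier \<Gamma>\<rparr>"

abbreviation orb :: "'f \<Rightarrow> 'f set" where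
  "orb \<equiv> orbit holonomy (\<lambda>f. f)"

abbreviation orbs :: "'f set set" where
  "orbs \<equiv> orbits holonomy (points F) (\<lambda>f. f)"

lemma leaves_eq: "leaves = leaf ` points F"
  by (simp add: suspension_leaves_def leaf_def)

lemma orbs_eq: "orbs = orb ` points F"
  by (auto simp: orbits_def)

lemma orb_eq: "orb z = orbit \<Gamma> h z"
  by (auto simp: orbit_def)

lemma orb_eq_iff: "z \<in> points F \<Longrightarrow> w \<in> points F \<Longrightarrow> orb z = orb w \<longleftrightarrow> (\<exists>\<gamma>\<in>carrier \<Gamma>. h \<gamma> z = w)"
  unfolding orb_eq by (rule fibre_action.orbit_eq_iff)

lemma proj_eq_imp_orb_eq:
  assumes "x \<in> points Bt" "z \<in> points F" "x' \<in> points Bt" "z' \<in> points F" "proj (x, z) = proj (x', z')"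
  shows "orb z = orb z'"
proof -
  have "(x, z) \<in> points N" "(x', z') \<in> points N" using assms by (simp_all add: points_N)
  then obtain \<gamma> where \<gamma>: "\<gamma> \<in> carrier \<Gamma>" "act \<gamma> (x, z) = (x', z')"
    using proj_eq_iff assms(5) by blast
  then have "h \<gamma> z = z'" using act_apply[OF assms(1,2)] by simp
  then show ?thesis using orb_eq_iff[OF assms(2,4)] \<gamma>(1) by blast
qed

text \<open>
  A covering transformation \<open>\<gamma>\<close> carries the representatives over \<open>z\<close> to representatives over \<open>h \<gamma> z\<close> of the same
  points.  Conversely, since the universal covering is nonempty, a common leaf provides one point with
  representatives over \<open>z\<close> and over \<open>w\<close>.
\<close>

lemma leaf_eq_iff:
  assumes z: "z \<in> points F" and w: "w \<in> points F"
  shows "leaf z = leaf w \<longleftrightarrow> orb z = orb w"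
proof
  have sub: "leaf z \<subseteq> leaf w" if z: "z \<in> points F" and w: "w \<in> points F" and eq: "orb z = orb w" for z w
  proof
    fix m assume "m \<in> leaf z"
    then obtain x where x: "x \<in> points Bt" "m = proj (x, z)" by (auto simp: leaf_def)
    obtain \<gamma> where \<gamma>: "\<gamma> \<in> carrier \<Gamma>" "h \<gamma> z = w" using eq orb_eq_iff[OF z w] by blast
    have N: "(x, z) \<in> points N" "(\<gamma> x, w) \<in> points N"
      using x(1) z w deckD(4)[OF \<gamma>(1) x(1)] by (simp_all add: points_N)
    have "act \<gamma> (x, z) = (\<gamma> x, w)" using act_apply[OF x(1) z] \<gamma>(2) by simp
    then have "proj (x, z) = proj (\<gamma> x, w)" using proj_eq_iff[OF N] \<gamma>(1) by blast
    then show "m \<in> leaf w" unfolding leaf_def x(2) using deckD(4)[OF \<gamma>(1) x(1)] by simp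
  qed
  assume "orb z = orb w"
  then show "leaf z = leaf w" using sub[OF z w] sub[OF w z] by blast
next
  assume eq: "leaf z = leaf w"
  obtain x where x: "x \<in> points Bt" using B_nonempty p_surj by blast
  then have "proj (x, z) \<in> leaf z" by (simp add: leaf_def)
  then have "proj (x, z) \<in> leaf w" unfolding eq .
  then obtain x' where x': "x' \<in> points Bt" "proj (x, z) = proj (x', w)" by (auto simp: leaf_def)
  show "orb z = orb w" by (rule proj_eq_imp_orb_eq[OF x z x'(1) w x'(2)])
qed

text \<open>
  The fibre component of some representative.  The choice affects it only up to the holonomy group
  (\<open>orb_transverse\<close>).
\<close>

definition transverse :: "('c \<times> 'f) set \<Rightarrow> 'f" where
  "transverse m = snd (inv_into (points N) proj m)"

lemma transverse_in:
  assumes "m \<in> points M"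
  shows "transverse m \<in> points F"
proof -
  have "inv_into (points N) proj m \<in> points N" using assms unfolding points_M by (rule inv_into_into)
  then show ?thesis by (auto simp: transverse_def points_N)
qed

lemma orb_transverse:
  assumes "x \<in> points Bt" "z \<in> points F"
  shows "orb (transverse (proj (x, z))) = orb z"
proof -
  let ?w = "inv_into (points N) proj (proj (x, z))"
  have m: "proj (x, z) \<in> proj ` points N" using assms by (simp add: points_N)
  have "?w \<in> points N" "proj ?w = proj (x, z)" using inv_into_into[OF m] f_inv_into_f[OF m] by simp_all
  then show ?thesis
    using proj_eq_imp_orb_eq[of "fst ?w" "snd ?w" x z] assms by (auto simp: transverse_def points_N)
qed

end

locale riemannian_suspension =
  suspension B Bt F p h n q +
  M: C1_riemannian "suspension_manifold Bt p F h" gM k d s +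
  F: C1_riemannian F gF m e r
  for B :: "('b, 'd::real_normed_vector) mfd" and Bt :: "('c, 'd) mfd"
    and F :: "('f, 'e::real_normed_vector) mfd" and p h n q gM k d s gF m e r
begin

text \<open>
  Fix a point \<open>x\<close> of the universal covering.  The points \<open>(x, u)\<close> and \<open>(x, w)\<close> represent points on the leaves of \<open>u\<close> and \<open>w\<close>, and in a product
  chart their coordinates differ only in the fibre part.
\<close>

theorem leaf_chain_dist_Lipschitz:
  obtains K where "K > 0" "\<And>z w. chain_dist (riemannian_dist M gM) leaves (leaf z) (leaf w)
      \<le> ennreal K * riemannian_dist F gF z w"
proof -
  obtain x where x: "x \<in> points Bt" using B_nonempty p_surj by blast
  let ?\<rho> = "\<lambda>z w. chain_dist (riemannian_dist M gM) leaves (leaf z) (leaf w)"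
  show thesis
  proof (rule F.locally_Lipschitz_imp_Lipschitz[OF compact_F, of ?\<rho>])
    show "?\<rho> u w \<le> ?\<rho> u v + ?\<rho> v w" for u v w by (rule chain_dist_triangle)
    show "?\<rho> z z = 0" if "z \<in> points F" for z
      by (rule chain_dist_refl) (use that in \<open>simp add: leaves_eq\<close>)
    fix z assume z: "z \<in> points F"
    obtain Ua a where a: "(Ua, a) \<in> atlas Bt" "x \<in> Ua" by (rule manifold_cover[OF Bt x])
    obtain Ub b where b: "(Ub, b) \<in> atlas F" "z \<in> Ub" by (rule manifold_cover[OF F z])
    obtain W where W: "(proj ` W, map_prod a b \<circ> inv_into W proj) \<in> atlas M" "openin (mtop N) W"
      "(x, z) \<in> W" "W \<subseteq> Ua \<times> Ub" "inj_on proj W" by (rule chart_M_exists[OF a b])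
    obtain W' C where W': "openin (mtop M) W'" "proj (x, z) \<in> W'"
      and C: "\<And>y y'. y \<in> W' \<Longrightarrow> y' \<in> W' \<Longrightarrow> riemannian_dist M gM y y' \<le>
        ennreal (C * norm ((map_prod a b \<circ> inv_into W proj) y - (map_prod a b \<circ> inv_into W proj) y'))"
      by (rule M.length_comparable_to_chart_norm[OF W(1) imageI[OF W(3)]]) blast
    let ?V = "{w \<in> points F. (x, w) \<in> W \<inter> {v \<in> points N. proj v \<in> W'}}"
    have "continuous_map (mtop F) (mtop N) (Pair x)"
      unfolding mtop_N using x by (simp add: continuous_map_pairwise comp_def)
    then have "openin (mtop F) ?V"
      by (rule openin_continuous_map_preimage)
        (intro openin_Int W(2) openin_continuous_map_preimage[OF proj_continuous W'(1)])
    moreover have "z \<in> ?V"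
      using z x W(3) W'(2) by (simp add: points_N)
    moreover have "?V \<subseteq> Ub" using W(4) by blast
    moreover have "?\<rho> u w \<le> ennreal (C * norm (b u - b w))"
      if u: "u \<in> ?V"
        and w: "w \<in> ?V" for u w
    proof -
      have "?\<rho> u w \<le> riemannian_dist M gM (proj (x, u)) (proj (x, w))"
        by (rule chain_dist_le_dist) (use u w x in \<open>auto simp: leaves_eq leaf_def\<close>)
      also have "\<dots> \<le> ennreal (C * norm (map_prod a b (x, u) - map_prod a b (x, w)))"
        using C[of "proj (x, u)" "proj (x, w)"] u w W(5) by simp
      also have "\<dots> = ennreal (C * norm (b u - b w))" by (simp add: norm_Pair)
      finally show ?thesis .
    qed
    ultimately show "\<exists>(U, \<phi>) \<in> atlas F. \<exists>W C. openin (mtop F) W \<and> z \<in> W \<and> W \<subseteq> U \<and>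
       (\<forall>y\<in>W. \<forall>w\<in>W. ?\<rho> y w \<le> ennreal (C * norm (\<phi> y - \<phi> w)))"
      by (intro bexI[OF _ b(1)] case_prodI exI[of _ ?V] exI[of _ C] conjI ballI)
  qed (rule that)
qed

text \<open>
  Two nearby points of \<open>M\<close> have representatives in one product chart.  The distance of their fibre components, and with it the chain
  distance of the orbits, is at most a multiple of the distance of their fibre coordinates.
\<close>

theorem orbit_chain_dist_Lipschitz:
  obtains K where "K > 0" "\<And>y y'. chain_dist (riemannian_dist F gF) orbs (orb (transverse y)) (orb (transverse y'))
      \<le> ennreal K * riemannian_dist M gM y y'"
proof -
  let ?\<rho> = "\<lambda>y y'. chain_dist (riemannian_dist F gF) orbs (orb (transverse y)) (orb (transverse y'))"
  show thesis
  proof (rule M.locally_Lipschitz_imp_Lipschitz[OF compact_M, of ?\<rho>])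
    show "?\<rho> u w \<le> ?\<rho> u v + ?\<rho> v w" for u v w by (rule chain_dist_triangle)
    show "?\<rho> y y = 0" if "y \<in> points M" for y
      by (rule chain_dist_refl) (use transverse_in[OF that] in \<open>simp add: orbs_eq\<close>)
    fix o' assume "o' \<in> points M"
    then obtain x z where xz: "o' = proj (x, z)" "x \<in> points Bt" "z \<in> points F"
      unfolding points_M points_N by blast
    obtain Ua a where a: "(Ua, a) \<in> atlas Bt" "x \<in> Ua" by (rule manifold_cover[OF Bt xz(2)])
    obtain Ub b where b: "(Ub, b) \<in> atlas F" "z \<in> Ub" by (rule manifold_cover[OF F xz(3)])
    obtain W where W: "(proj ` W, map_prod a b \<circ> inv_into W proj) \<in> atlas M" "openin (mtop N) W"
      "(x, z) \<in> W" "W \<subseteq> Ua \<times> Ub" "inj_on proj W" by (rule chart_M_exists[OF a b])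
    obtain V C where V: "openin (mtop F) V" "z \<in> V" and C0: "C > 0"
      and C: "\<And>y y'. y \<in> V \<Longrightarrow> y' \<in> V \<Longrightarrow> riemannian_dist F gF y y' \<le> ennreal (C * norm (b y - b y'))"
      by (rule F.length_comparable_to_chart_norm[OF b]) blast
    let ?T = "W \<inter> (points Bt \<times> V)"
    have T: "openin (mtop N) ?T"
      using W(2) V(1) by (intro openin_Int) (simp_all add: mtop_N openin_prod_Times_iff)
    have VF: "V \<subseteq> points F" by (rule openin_subset[OF V(1)])
    have est: "?\<rho> y y' \<le> ennreal (C * norm ((map_prod a b \<circ> inv_into W proj) y - (map_prod a b \<circ> inv_into W proj) y'))"
      if y: "y \<in> proj ` ?T" and y': "y' \<in> proj ` ?T" for y y'
    proof -
      obtain u v where u: "y = proj (u, v)" "(u, v) \<in> W" "u \<in> points Bt" "v \<in> V" using y by auto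
      obtain u' v' where u': "y' = proj (u', v')" "(u', v') \<in> W" "u' \<in> points Bt" "v' \<in> V" using y' by auto
      have vF: "v \<in> points F" "v' \<in> points F" using u(4) u'(4) VF by auto
      have "?\<rho> y y' = chain_dist (riemannian_dist F gF) orbs (orb v) (orb v')"
        unfolding u(1) u'(1) orb_transverse[OF u(3) vF(1)] orb_transverse[OF u'(3) vF(2)] by (rule refl)
      also have "\<dots> \<le> riemannian_dist F gF v v'"
        by (rule chain_dist_le_dist) (use vF fibre_action.orbit_refl in \<open>auto simp: orbs_eq orb_eq\<close>)
      also have "\<dots> \<le> ennreal (C * norm (b v - b v'))" by (rule C[OF u(4) u'(4)])
      also have "\<dots> \<le> ennreal (C * norm (map_prod a b (u, v) - map_prod a b (u', v')))"
        using norm_snd_le[of "b v - b v'" "a u - a u'"] C0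
        by (intro ennreal_leI mult_left_mono) simp_all
      also have "\<dots> = ennreal (C * norm ((map_prod a b \<circ> inv_into W proj) y - (map_prod a b \<circ> inv_into W proj) y'))"
        using u(1,2) u'(1,2) W(5) by simp
      finally show ?thesis .
    qed
    have "openin (mtop M) (proj ` ?T)" by (rule proj_open[OF T])
    moreover have "o' \<in> proj ` ?T" unfolding xz(1) using W(3) xz(2) V(2) by simp
    moreover have "proj ` ?T \<subseteq> proj ` W" by blast
    ultimately show "\<exists>(U, \<phi>) \<in> atlas M. \<exists>W C. openin (mtop M) W \<and> o' \<in> W \<and> W \<subseteq> U \<and>
       (\<forall>y\<in>W. \<forall>w\<in>W. ?\<rho> y w \<le> ennreal (C * norm (\<phi> y - \<phi> w)))"
      using est by (intro bexI[OF _ W(1)] case_prodI exI[of _ "proj ` ?T"] exI[of _ C] conjI ballI)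
  qed (rule that)
qed

theorem leaf_space_homeomorphic_orbit_space:
  shows "HLS M gM leaves homeomorphic_space HOS holonomy (\<lambda>f. f) (points F) (riemannian_dist F gF)"
proof -
  let ?dM = "riemannian_dist M gM" and ?dF = "riemannian_dist F gF"
  obtain K where K: "K > 0" "\<And>z w. chain_dist ?dM leaves (leaf z) (leaf w) \<le> ennreal K * ?dF z w"
    by (rule leaf_chain_dist_Lipschitz) blast
  obtain L where L: "L > 0" "\<And>y y'. chain_dist ?dF orbs (orb (transverse y)) (orb (transverse y')) \<le> ennreal L * ?dM y y'"
    by (rule orbit_chain_dist_Lipschitz) blast
  define f where "f A = orb (inv_into (points F) leaf A)" for A
  have f: "f (leaf z) = orb z" if z: "z \<in> points F" for z
  proof -
    have "leaf z \<in> leaf ` points F" using z by simp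
    from inv_into_into[OF this] f_inv_into_f[OF this] show ?thesis
      unfolding f_def using leaf_eq_iff z by blast
  qed
  have "inj_on f leaves"
    unfolding leaves_eq
  proof (rule inj_onI, elim imageE)
    fix A A' z z' assume "f A = f A'" "A = leaf z" "A' = leaf z'" "z \<in> points F" "z' \<in> points F"
    then show "A = A'" using f leaf_eq_iff by simp
  qed
  moreover have "f ` leaves = orbs" unfolding leaves_eq orbs_eq image_image using f by (intro image_cong) auto
  ultimately have bij: "bij_betw f leaves orbs" by (simp add: bij_betw_def)
  have le: "chain_dist ?dF orbs (f A) (f A') \<le> ennreal L * chain_dist ?dM leaves A A'"
    if "A \<in> leaves" "A' \<in> leaves" for A A'
  proof (rule chain_dist_Lipschitz[OF _ L(1) _ that])
    show "f ` leaves \<subseteq> orbs" using \<open>f ` leaves = orbs\<close> by simp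
    fix A A' y y' assume A: "A \<in> leaves" "A' \<in> leaves" "y \<in> A" "y' \<in> A'"
    then obtain z z' where z: "z \<in> points F" "A = leaf z" "z' \<in> points F" "A' = leaf z'" by (auto simp: leaves_eq)
    then obtain x x' where x: "x \<in> points Bt" "y = proj (x, z)" "x' \<in> points Bt" "y' = proj (x', z')"
      using A(3,4) by (auto simp: leaf_def)
    show "chain_dist ?dF orbs (f A) (f A') \<le> ennreal L * ?dM y y'"
      using L(2)[of y y'] unfolding x(2,4) z(2,4) orb_transverse[OF x(1) z(1)] orb_transverse[OF x(3) z(3)]
        f[OF z(1)] f[OF z(3)] .
  qed
  let ?g = "inv_into leaves f"
  have g: "?g (orb z) = leaf z" if "z \<in> points F" for z
    using bij_betw_inv_into_left[OF bij, of "leaf z"] f[OF that] that by (simp add: leaves_eq)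
  have ge: "chain_dist ?dM leaves A A' \<le> ennreal K * chain_dist ?dF orbs (f A) (f A')"
    if A: "A \<in> leaves" "A' \<in> leaves" for A A'
  proof -
    have fA: "f A \<in> orbs" "f A' \<in> orbs" using A \<open>f ` leaves = orbs\<close> by auto
    have "chain_dist ?dM leaves (?g (f A)) (?g (f A')) \<le> ennreal K * chain_dist ?dF orbs (f A) (f A')"
    proof (rule chain_dist_Lipschitz[OF _ K(1) _ fA])
      show "?g ` orbs \<subseteq> leaves" using bij_betw_inv_into[OF bij] by (simp add: bij_betw_def)
      fix C C' y y' assume C: "C \<in> orbs" "C' \<in> orbs" "y \<in> C" "y' \<in> C'"
      then obtain z z' where z: "z \<in> points F" "C = orb z" "z' \<in> points F" "C' = orb z'" by (auto simp: orbs_eq)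
      obtain \<gamma> \<gamma>' where \<gamma>: "\<gamma> \<in> carrier \<Gamma>" "y = h \<gamma> z" "\<gamma>' \<in> carrier \<Gamma>" "y' = h \<gamma>' z'"
        using C(3,4) unfolding z(2,4) by (auto simp: orbit_def)
      have yF: "y \<in> points F" "y' \<in> points F" using \<gamma> z h_in by auto
      have "orb z = orb y" "orb z' = orb y'" using orb_eq_iff z yF \<gamma> by blast+
      then have "leaf z = leaf y" "leaf z' = leaf y'" using leaf_eq_iff z yF by auto
      then show "chain_dist ?dM leaves (?g C) (?g C') \<le> ennreal K * ?dF y y'"
        unfolding z(2,4) g[OF z(1)] g[OF z(3)] using K(2)[of y y'] by simp
    qed
    then show ?thesis using bij_betw_inv_into_left[OF bij] A by simp
  qed
  show ?thesis
    unfolding HLS_def HOS_def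
    by (rule hausdorff_quotient_homeomorphic[OF M.riemannian_dist_sym F.riemannian_dist_sym bij L(1) K(1)])
      (fact le ge)+
qed

end

theorem theorem4p5:
  fixes B :: "('b, 'd::real_normed_vector) mfd"
    and Bt :: "('c, 'd) mfd"
    and F :: "('f, 'e::real_normed_vector) mfd"
    and p :: "'c \<Rightarrow> 'b"
    and h :: "('c \<Rightarrow> 'c) \<Rightarrow> ('f \<Rightarrow> 'f)"
    and n q :: nat
    and gM :: "(('c \<times> 'f) set, 'd \<times> 'e) chart \<Rightarrow> ('c \<times> 'f) set \<Rightarrow> 'd \<times> 'e \<Rightarrow> 'd \<times> 'e \<Rightarrow> real"
    and gF :: "('f, 'e) chart \<Rightarrow> 'f \<Rightarrow> 'e \<Rightarrow> 'e \<Rightarrow> real"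
  assumes "smooth_manifold n B" and "compact_space (mtop B)"
    and "connected_space (mtop B)" and "points B \<noteq> {}"
    and "smooth_manifold n Bt" and "universal_covering Bt B p"
    and "smooth_manifold q F" and "compact_space (mtop F)"
    and "h \<in> hom (deck_group Bt p) (diff_group F)"
    and "riemannian_metric (suspension_manifold Bt p F h) gM"
    and "riemannian_metric F gF"
  shows "HLS (suspension_manifold Bt p F h) gM (suspension_leaves Bt p F h)
      homeomorphic_space
    HOS ((diff_group F)\<lparr>carrier := h ` carrier (deck_group Bt p)\<rparr>) (\<lambda>f. f)
      (points F) (riemannian_dist F gF)"
proof -
  interpret suspension B Bt F p h n q
    by (rule suspension.intro) (fact assms)+
  obtain m r and e :: "nat \<Rightarrow> 'd" where cod: "bounded_coordinates m e r" by (rule manifold_coordinates[OF B])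
  obtain m' r' and e' :: "nat \<Rightarrow> 'e" where coe: "bounded_coordinates m' e' r'" by (rule manifold_coordinates[OF F])
  obtain k s and d :: "nat \<Rightarrow> 'd \<times> 'e" where co: "bounded_coordinates k d s" by (rule bounded_coordinates_prod[OF cod coe])
  interpret riemannian_suspension B Bt F p h n q gM k d s gF m' e' r'
    by (intro riemannian_suspension.intro suspension_axioms M_C1_riemannian[OF assms(10) co]
        manifold_C1_riemannian[OF F assms(11) coe])
  show ?thesis by (rule leaf_space_homeomorphic_orbit_space)
qed

end
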